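(* Let $\Psi$ be a bounded set of nonnegative matrices that define operators on $\ell^2$, let $r\in\{\rho_{ess},\hat\rho_{ess}\}$, and let $\alpha,\beta\ge0$ with $\alpha+\beta\ge1$. For $n\in\mathbb{N}\cup\{0\}$ put $r_n=r(S_{\alpha,\beta}(\Psi^{2^n}))^{2^{-n}}$. Then for every $n$, $$r(S_{\alpha,\beta}(\Psi))=r_0\le r_1\le\cdots\le r_n\le r(\Psi)^{\alpha+\beta}.$$
   Context: A nonnegative matrix $A=[a_{ij}]_{i,j\in\mathbb{N}}$ defines an operator on $\ell^2$ if $(Ax)_i=\sum_j a_{ij}x_j$ converges absolutely and $Ax\in\ell^2$ for all $x\in\ell^2$; $A^*$ is its transpose. Hadamard power $A^{(t)}=[a_{ij}^t]$, Hadamard product $A\circ B=[a_{ij}b_{ij}]$. $\Psi^n=\{A_1\cdots A_n:A_i\in\Psi\}$, $\Psi^*=\{A^*:A\in\Psi\}$. $S_{\alpha,\beta}(\Psi)=\{A^{(\alpha)}\circ(B^* )^{(\beta)}:A,B\in\Psi\}$, with the convention that a Hadamard factor with exponent $0$ is omitted. $\gamma$ is the Hausdorff measure of noncompactness, $\rho_{ess}$ the essential spectral radius; for a bounded set $\Sigma$, $\rho_{ess}(\Sigma)=\sup_m[\sup_{A\in\Sigma^m}\rho_{ess}(A)]^{1/m}$ and $\hat\rho_{ess}(\Sigma)=\lim_{m\to\infty}[\sup_{A\in\Sigma^m}\gamma(A)]^{1/m}$. *)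

theory Defs
  imports Complex_Main
begin

type_synonym mat = "nat \<Rightarrow> nat \<Rightarrow> real"
type_synonym seq = "nat \<Rightarrow> complex"

definition l2 :: "seq set" where
  "l2 = {x. summable (\<lambda>i. (cmod (x i))\<^sup>2)}"

definition l2norm :: "seq \<Rightarrow> real" where
  "l2norm x = sqrt (\<Sum>i. (cmod (x i))\<^sup>2)"

definition nonneg_mat :: "mat \<Rightarrow> bool" where
  "nonneg_mat A \<longleftrightarrow> (\<forall>i j. 0 \<le> A i j)"

definition mat_apply :: "mat \<Rightarrow> seq \<Rightarrow> seq" where
  "mat_apply A x = (\<lambda>i. \<Sum>j. complex_of_real (A i j) * x j)"

definition defines_op :: "mat \<Rightarrow> bool" where
  "defines_op A \<longleftrightarrow> (\<forall>x\<in>l2. (\<forall>i. summable (\<lambda>j. cmod (complex_of_real (A i j) * x j)))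
                              \<and> mat_apply A x \<in> l2)"

definition bounded_mat_set :: "mat set \<Rightarrow> bool" where
  "bounded_mat_set \<Psi> \<longleftrightarrow> (\<exists>M. \<forall>A\<in>\<Psi>. \<forall>x\<in>l2. l2norm (mat_apply A x) \<le> M * l2norm x)"

definition id_mat :: mat where
  "id_mat = (\<lambda>i j. if i = j then 1 else 0)"

definition mat_mult :: "mat \<Rightarrow> mat \<Rightarrow> mat" where
  "mat_mult A B = (\<lambda>i j. \<Sum>k. A i k * B k j)"

definition mat_transpose :: "mat \<Rightarrow> mat" where
  "mat_transpose A = (\<lambda>i j. A j i)"

text \<open>Hadamard power; exponent 0 means the factor is omitted (all-ones matrix = Hadamard unit).\<close>
definition hpow :: "mat \<Rightarrow> real \<Rightarrow> mat" where
  "hpow A t = (\<lambda>i j. if t = 0 then 1 else A i j powr t)"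

definition hprod :: "mat \<Rightarrow> mat \<Rightarrow> mat" where
  "hprod A B = (\<lambda>i j. A i j * B i j)"

fun set_pow :: "mat set \<Rightarrow> nat \<Rightarrow> mat set" where
  "set_pow \<Psi> 0 = {id_mat}"
| "set_pow \<Psi> (Suc n) = {mat_mult A B | A B. A \<in> \<Psi> \<and> B \<in> set_pow \<Psi> n}"

definition S_ab :: "real \<Rightarrow> real \<Rightarrow> mat set \<Rightarrow> mat set" where
  "S_ab \<alpha> \<beta> \<Psi> = {hprod (hpow A \<alpha>) (hpow (mat_transpose B) \<beta>) | A B. A \<in> \<Psi> \<and> B \<in> \<Psi>}"

definition hmnc :: "seq set \<Rightarrow> real" where
  "hmnc X = Inf {\<epsilon>. 0 < \<epsilon> \<and> (\<exists>F. finite F \<and> F \<subseteq> l2 \<and>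
      X \<subseteq> (\<Union>c\<in>F. {x\<in>l2. l2norm (\<lambda>i. x i - c i) \<le> \<epsilon>}))}"

definition gamma :: "mat \<Rightarrow> real" where
  "gamma A = hmnc (mat_apply A ` {x\<in>l2. l2norm x \<le> 1})"

definition fredholm_l2 :: "(seq \<Rightarrow> seq) \<Rightarrow> bool" where
  "fredholm_l2 T \<longleftrightarrow>
     (\<exists>vs. set vs \<subseteq> l2 \<and> (\<forall>x\<in>l2. T x = (\<lambda>i. 0) \<longrightarrow>
            (\<exists>c. x = (\<lambda>i. \<Sum>k<length vs. c k * (vs ! k) i)))) \<and>
     (\<forall>y\<in>l2. (\<forall>\<epsilon>>0. \<exists>x\<in>l2. l2norm (\<lambda>i. T x i - y i) < \<epsilon>) \<longrightarrow> (\<exists>x\<in>l2. T x = y)) \<and>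
     (\<exists>ws. set ws \<subseteq> l2 \<and> (\<forall>y\<in>l2. \<exists>x\<in>l2. \<exists>c.
            y = (\<lambda>i. T x i + (\<Sum>k<length ws. c k * (ws ! k) i))))"

definition ess_spectrum :: "mat \<Rightarrow> complex set" where
  "ess_spectrum A = {z. \<not> fredholm_l2 (\<lambda>x i. mat_apply A x i - z * x i)}"

definition ess_rad :: "mat \<Rightarrow> real" where
  "ess_rad A = Sup (insert 0 (cmod ` ess_spectrum A))"

text \<open>rho_ess(Sigma) = sup_m [sup_{A in Sigma^m} rho_ess(A)]^(1/m)  (sup of empty set read as 0)\<close>
definition ess_rad_set :: "mat set \<Rightarrow> real" where
  "ess_rad_set \<Sigma> = Sup (insert 0 {(Sup (insert 0 (ess_rad ` set_pow \<Sigma> m))) powr (1 / real m) | m. m \<ge> 1})"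

definition ess_rad_hat :: "mat set \<Rightarrow> real" where
  "ess_rad_hat \<Sigma> = lim (\<lambda>m. (Sup (insert 0 (gamma ` set_pow \<Sigma> (Suc m)))) powr (1 / real (Suc m)))"

end

theory Submission
  imports Defs "HOL-Analysis.Analysis"
begin

text \<open>
  For a nonnegative matrix \<open>A\<close> the measure of noncompactness \<open>\<gamma>(A)\<close> is the limit \<open>ess A\<close> of the norms
  of the truncations of \<open>A\<close> to the indices \<open>\<ge> n\<close>.  It is monotone, submultiplicative and invariant
  under transposition, and Young's inequality, applied entry by entry, bounds it on Hadamard products
  of powers.  Products in \<open>S\<^sub>\<alpha>\<^sub>,\<^sub>\<beta>(\<Psi>)\<close> are dominated entrywise by \<open>A\<^sup>(\<^sup>\<alpha>\<^sup>) \<circ> (B\<^sup>*)\<^sup>(\<^sup>\<beta>\<^sup>)\<close> with \<open>A\<close>, \<open>B\<close> in the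
  corresponding power of \<open>\<Psi>\<close>, by Hoelder's inequality; this settles \<open>r = ess_rad_hat\<close>.

  The other radius is reduced to it by Nussbaum's formula \<open>\<rho>\<^sub>e\<^sub>s\<^sub>s(A) = lim \<gamma>(A\<^sup>m)\<^sup>1\<^sup>/\<^sup>m\<close>.  For \<open>\<le>\<close>, some
  truncation of \<open>A\<close> has spectral radius below \<open>|z|\<close>, so \<open>A - z\<close> is invertible up to finite rank.  For
  \<open>\<ge>\<close>, positivity is used to show that the limit \<open>t\<close> is itself in the essential spectrum: otherwise
  \<open>A\<^sup>* - t\<close> is bounded below on tails, the positive resolvents of tails of \<open>A\<^sup>*\<close> stay bounded near \<open>t\<close>,
  and they extend to a point below \<open>t\<close>.
\<close>

subsection \<open>The Banach space of square summable sequences\<close>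

text \<open>A nonnegative matrix differs from its truncation by finitely many rows and columns, so
  noncompactness becomes a norm bound on a corner. The chain comes from squaring: a product of two
  elements of S(\<Psi>) is dominated entrywise by an element of S(\<Psi>^2). Transposition reverses
  the order of the factors \<open>B\<close>, which does no harm since both orders lie in \<Psi>^2.
  The obstacle is the radius defined through the spectrum: entrywise domination gives no direct
  comparison of spectra, and Nussbaum's formula is what makes this radius monotone. Its harder half
  asserts that one particular number t lies in the essential spectrum. The Fredholm property of A -
  t gives finite codimension of the range, hence information about the transpose, which has the same
  limit t. General arguments about boundary points of the essential spectrum are replaced by order:
  only upper bounds on nonnegative vectors are continued across t, and for these an inequality in
  place of the resolvent equation suffices.\<close>

typedef (overloaded) ('b::real_normed_vector) sq = "{x :: nat \<Rightarrow> 'b. summable (\<lambda>i. (norm (x i))\<^sup>2)}"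
  morphisms co mk
  by (rule exI[of _ "\<lambda>_. 0"]) simp

lemma sq_eqI: "(\<And>i. co x i = co y i) \<Longrightarrow> x = y"
  by (metis co_inject ext)

lemma summable_co: "summable (\<lambda>i. (norm (co x i))\<^sup>2)"
  using co[of x] by simp

lemma L2_set_power2: "(L2_set f A)\<^sup>2 = (\<Sum>i\<in>A. (f i)\<^sup>2)"
  by (simp add: L2_set_def sum_nonneg)

lemma square_summableI:
  fixes f :: "nat \<Rightarrow> 'b::real_normed_vector"
  assumes "\<And>n. L2_set (\<lambda>i. norm (f i)) {..<n} \<le> c"
  shows "summable (\<lambda>i. (norm (f i))\<^sup>2)"
proof (rule summableI_nonneg_bounded[where x = "c\<^sup>2"])
  fix n
  show "(\<Sum>i<n. (norm (f i))\<^sup>2) \<le> c\<^sup>2"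
    using power_mono[OF assms[of n], of 2] by (simp add: L2_set_power2)
qed simp

lemma L2_set_le_sqrt_suminf:
  fixes f :: "nat \<Rightarrow> 'b::real_normed_vector"
  assumes "summable (\<lambda>i. (norm (f i))\<^sup>2)"
  shows "L2_set (\<lambda>i. norm (f i)) {..<n} \<le> sqrt (\<Sum>i. (norm (f i))\<^sup>2)"
  unfolding L2_set_def by (intro real_sqrt_le_mono sum_le_suminf assms) auto

lemma sqrt_suminf_leI:
  fixes f :: "nat \<Rightarrow> 'b::real_normed_vector"
  assumes "\<And>n. L2_set (\<lambda>i. norm (f i)) {..<n} \<le> c"
  shows "sqrt (\<Sum>i. (norm (f i))\<^sup>2) \<le> c"
proof (rule real_le_lsqrt)
  show c0: "0 \<le> c" using assms[of 0] by simp
  show "(\<Sum>i. (norm (f i))\<^sup>2) \<le> c\<^sup>2"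
  proof (rule suminf_le_const[OF square_summableI[OF assms]])
    fix n
    show "(\<Sum>i<n. (norm (f i))\<^sup>2) \<le> c\<^sup>2"
      using power_mono[OF assms[of n], of 2] by (simp add: L2_set_power2)
  qed
qed

lemma L2_set_norm_add_le:
  "L2_set (\<lambda>i. norm (f i + g i)) A \<le> L2_set (\<lambda>i. norm (f i)) A + L2_set (\<lambda>i. norm (g i)) A"
  by (rule order_trans[OF L2_set_mono[OF norm_triangle_ineq] L2_set_triangle_ineq]) auto

lemma square_summable_add:
  fixes f :: "nat \<Rightarrow> 'b::real_normed_vector"
  assumes "summable (\<lambda>i. (norm (f i))\<^sup>2)" "summable (\<lambda>i. (norm (g i))\<^sup>2)"
  shows "summable (\<lambda>i. (norm (f i + g i))\<^sup>2)"
  by (rule square_summableI[where c = "sqrt (\<Sum>i. (norm (f i))\<^sup>2) + sqrt (\<Sum>i. (norm (g i))\<^sup>2)"])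
    (intro order_trans[OF L2_set_norm_add_le] add_mono L2_set_le_sqrt_suminf assms)

lemma square_summable_scaleR:
  fixes f :: "nat \<Rightarrow> 'b::real_normed_vector"
  assumes "summable (\<lambda>i. (norm (f i))\<^sup>2)"
  shows "summable (\<lambda>i. (norm (c *\<^sub>R f i))\<^sup>2)"
  using summable_mult[OF assms, of "c\<^sup>2"] by (simp add: power_mult_distrib)

text \<open>The scalars stay generic so that order arguments run over \<open>real sq\<close> and
  spectral ones over \<open>complex sq\<close> with the same lemmas. Even over complex entries the
  space is a real normed space; complex multiples come in later as operators.\<close>

instantiation sq :: (real_normed_vector) real_normed_vector
begin

definition "0 = mk (\<lambda>_. 0)"
definition "x + y = mk (\<lambda>i. co x i + co y i)"
definition "- x = mk (\<lambda>i. - co x i)"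
definition "x - y = mk (\<lambda>i. co x i - co y i)"
definition "c *\<^sub>R x = mk (\<lambda>i. c *\<^sub>R co x i)"
definition "norm x = sqrt (\<Sum>i. (norm (co x i))\<^sup>2)"
definition "sgn (x :: 'a sq) = inverse (norm x) *\<^sub>R x"
definition "dist (x :: 'a sq) y = norm (x - y)"
definition "uniformity = (INF e\<in>{0<..}. principal {(x :: 'a sq, y). dist x y < e})"
definition "open (U :: 'a sq set) \<longleftrightarrow> (\<forall>x\<in>U. eventually (\<lambda>(x', y). x' = x \<longrightarrow> y \<in> U) uniformity)"

lemma co_zero_fun: "co (0 :: 'a sq) = (\<lambda>_. 0)"
  by (simp add: zero_sq_def mk_inverse)

lemma co_add_fun: "co (x + y) = (\<lambda>i. co x i + co y i)" for x y :: "'a sq"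
  unfolding plus_sq_def using square_summable_add[OF summable_co[of x] summable_co[of y]]
  by (simp add: mk_inverse)

lemma co_scaleR_fun: "co (c *\<^sub>R x) = (\<lambda>i. c *\<^sub>R co x i)" for x :: "'a sq"
  unfolding scaleR_sq_def using square_summable_scaleR[OF summable_co[of x], of c]
  by (simp add: mk_inverse)

lemma co_minus_fun: "co (- x) = (\<lambda>i. - co x i)" for x :: "'a sq"
  unfolding uminus_sq_def using summable_co[of x] by (simp add: mk_inverse)

lemma co_diff_fun: "co (x - y) = (\<lambda>i. co x i - co y i)" for x y :: "'a sq"
proof -
  have "summable (\<lambda>i. (norm (co x i - co y i))\<^sup>2)"
    using square_summable_add[OF summable_co[of x] summable_co[of "- y"]] by (simp add: co_minus_fun)
  then show ?thesis unfolding minus_sq_def by (simp add: mk_inverse)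
qed

instance
proof
  fix x y :: "'a sq" and a :: real
  show "norm x = 0 \<longleftrightarrow> x = 0"
  proof
    assume "norm x = 0"
    then have "(\<Sum>i. (norm (co x i))\<^sup>2) = 0" by (simp add: norm_sq_def)
    then have "\<forall>i. (norm (co x i))\<^sup>2 = 0"
      by (subst (asm) suminf_eq_zero_iff) (auto intro: summable_co)
    then show "x = 0" by (intro sq_eqI) (simp add: co_zero_fun)
  qed (simp add: norm_sq_def co_zero_fun)
  show "norm (x + y) \<le> norm x + norm y"
    unfolding norm_sq_def co_add_fun
    by (intro sqrt_suminf_leI order_trans[OF L2_set_norm_add_le] add_mono L2_set_le_sqrt_suminf summable_co)
  show "norm (a *\<^sub>R x) = \<bar>a\<bar> * norm x"
    unfolding norm_sq_def co_scaleR_fun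
    by (simp add: power_mult_distrib suminf_mult[OF summable_co] real_sqrt_mult)
qed (simp_all add: sgn_sq_def dist_sq_def uniformity_sq_def open_sq_def,
     auto intro!: sq_eqI simp: co_add_fun co_zero_fun co_scaleR_fun co_minus_fun co_diff_fun algebra_simps)

end

lemma co_zero [simp]: "co 0 i = 0" by (simp add: co_zero_fun)
lemma co_add [simp]: "co (x + y) i = co x i + co y i" by (simp add: co_add_fun)
lemma co_scaleR [simp]: "co (c *\<^sub>R x) i = c *\<^sub>R co x i" by (simp add: co_scaleR_fun)
lemma co_minus [simp]: "co (- x) i = - co x i" by (simp add: co_minus_fun)
lemma co_diff [simp]: "co (x - y) i = co x i - co y i" by (simp add: co_diff_fun)

lemma co_sum [simp]: "co (sum f A) i = (\<Sum>a\<in>A. co (f a) i)"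
  by (induction A rule: infinite_finite_induct) auto

lemma L2_set_co_le: "L2_set (\<lambda>i. norm (co x i)) {..<n} \<le> norm x"
  unfolding norm_sq_def by (rule L2_set_le_sqrt_suminf[OF summable_co])

lemma norm_sq_leI: "(\<And>n. L2_set (\<lambda>i. norm (co x i)) {..<n} \<le> c) \<Longrightarrow> norm x \<le> c"
  unfolding norm_sq_def by (rule sqrt_suminf_leI)

lemma norm_sq_mono:
  assumes "\<And>i. norm (co x i) \<le> norm (co y i)"
  shows "norm x \<le> norm y"
  by (intro norm_sq_leI order_trans[OF L2_set_mono L2_set_co_le[of y]] assms) auto

lemma norm_co_le: "norm (co x i) \<le> norm x"
  using member_le_L2_set[of "{..<Suc i}" i "\<lambda>i. norm (co x i)"] L2_set_co_le[of x "Suc i"] by simp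

lemma bounded_linear_co: "bounded_linear (\<lambda>x. co x i)"
  by (rule bounded_linear_intro[where K = 1]) (auto simp: norm_co_le)

lemma co_mk:
  assumes "\<And>n. L2_set (\<lambda>i. norm (f i)) {..<n} \<le> c"
  shows "co (mk f) = f"
  using square_summableI[OF assms] by (simp add: mk_inverse)

instance sq :: (banach) banach
proof
  fix X :: "nat \<Rightarrow> 'a sq"
  assume X: "Cauchy X"
  have "Cauchy (\<lambda>n. co (X n) i)" for i
    by (rule bounded_linear.Cauchy[OF bounded_linear_co X])
  then have "\<forall>i. \<exists>y. (\<lambda>n. co (X n) i) \<longlonglongrightarrow> y"
    by (simp add: Cauchy_convergent_iff convergent_def)
  then obtain y where y: "\<And>i. (\<lambda>n. co (X n) i) \<longlonglongrightarrow> y i" by metis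
  \<comment> \<open>A bound on finitely many coordinates survives the coordinatewise limit in n.
    This one estimate yields both that the limit is square summable and that convergence is in
    norm.\<close>
  have bd: "L2_set (\<lambda>i. norm (co (X m) i - y i)) {..<k} \<le> e"
    if "\<And>m n. m \<ge> N \<Longrightarrow> n \<ge> N \<Longrightarrow> norm (X m - X n) < e" "m \<ge> N" for N m k e
  proof (rule tendsto_upperbound)
    show "(\<lambda>n. L2_set (\<lambda>i. norm (co (X m) i - co (X n) i)) {..<k}) \<longlonglongrightarrow> L2_set (\<lambda>i. norm (co (X m) i - y i)) {..<k}"
      unfolding L2_set_def by (intro tendsto_intros y)
    show "\<forall>\<^sub>F n in sequentially. L2_set (\<lambda>i. norm (co (X m) i - co (X n) i)) {..<k} \<le> e"
      unfolding eventually_sequentially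
    proof (intro exI[of _ N] allI impI)
      fix n assume "n \<ge> N"
      then show "L2_set (\<lambda>i. norm (co (X m) i - co (X n) i)) {..<k} \<le> e"
        using L2_set_co_le[of "X m - X n" k] that(1)[OF that(2), of n] by simp
    qed
  qed simp
  have C: "\<exists>N. \<forall>m\<ge>N. \<forall>n\<ge>N. norm (X m - X n) < e" if "e > 0" for e
    using X that unfolding Cauchy_def dist_norm by blast
  obtain N1 where N1: "\<And>m n. m \<ge> N1 \<Longrightarrow> n \<ge> N1 \<Longrightarrow> norm (X m - X n) < 1"
    using C[of 1] by auto
  have "summable (\<lambda>i. (norm (co (X N1) i - y i))\<^sup>2)"
    by (rule square_summableI[where c = 1]) (use bd[OF N1, of N1] in simp)
  from square_summable_add[OF summable_co[of "X N1"] square_summable_scaleR[OF this, of "-1"]]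
  have y2: "summable (\<lambda>i. (norm (y i))\<^sup>2)" by simp
  define Y where "Y = mk y"
  have Y: "co Y = y" unfolding Y_def using y2 by (simp add: mk_inverse)
  have "X \<longlonglongrightarrow> Y"
  proof (rule LIMSEQ_I)
    fix r :: real assume "r > 0"
    then obtain N where N: "\<And>m n. m \<ge> N \<Longrightarrow> n \<ge> N \<Longrightarrow> norm (X m - X n) < r / 2"
      using C[of "r / 2"] by auto
    have "norm (X n - Y) < r" if "n \<ge> N" for n
    proof -
      have "norm (X n - Y) \<le> r / 2"
        by (rule norm_sq_leI) (use bd[OF N that] in \<open>simp add: Y\<close>)
      then show ?thesis using \<open>r > 0\<close> by simp
    qed
    then show "\<exists>no. \<forall>n\<ge>no. norm (X n - Y) < r" by blast
  qed
  then show "convergent X" by (auto simp: convergent_def)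
qed

subsection \<open>Sections, tails and unit sequences\<close>

definition sec :: "nat \<Rightarrow> 'b::real_normed_vector sq \<Rightarrow> 'b sq" where
  "sec n x = mk (\<lambda>i. if i < n then co x i else 0)"

lemma co_mk_dom:
  assumes "\<And>i. norm (f i) \<le> norm (co x i)"
  shows "co (mk f) = f"
  by (rule co_mk[where c = "norm x"], rule order_trans[OF L2_set_mono L2_set_co_le[of x]])
    (use assms in auto)

lemma co_sec [simp]: "co (sec n x) i = (if i < n then co x i else 0)"
  unfolding sec_def by (subst co_mk_dom[where x = x]) auto

lemma bounded_linear_sec: "bounded_linear (sec n)"
  by (rule bounded_linear_intro[where K = 1]) (auto intro!: sq_eqI norm_sq_mono)

lemma norm_tail_le: "norm (x - sec n x) \<le> norm x"
  by (rule norm_sq_mono) simp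

lemma sec_tendsto: "(\<lambda>n. sec n x) \<longlonglongrightarrow> x"
proof (rule LIMSEQ_I)
  fix r :: real assume r: "r > 0"
  then have "r\<^sup>2 > 0" by simp
  from suminf_exist_split[OF this summable_co[of x]]
  obtain N where N: "\<And>n. n \<ge> N \<Longrightarrow> norm (\<Sum>i. (norm (co x (i + n)))\<^sup>2) < r\<^sup>2" by auto
  have "norm (sec n x - x) < r" if "n \<ge> N" for n
  proof -
    have "(\<Sum>i. (norm (co (sec n x - x) i))\<^sup>2)
        = (\<Sum>i. (norm (co (sec n x - x) (i + n)))\<^sup>2) + (\<Sum>i<n. (norm (co (sec n x - x) i))\<^sup>2)"
      by (rule suminf_split_initial_segment[OF summable_co])
    also have "\<dots> = (\<Sum>i. (norm (co x (i + n)))\<^sup>2)" by simp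
    also have "\<dots> < r\<^sup>2" using N[OF that] by (simp add: abs_less_iff)
    finally show ?thesis
      unfolding norm_sq_def using r by (simp add: real_sqrt_less_iff real_less_lsqrt)
  qed
  then show "\<exists>no. \<forall>n\<ge>no. norm (sec n x - x) < r" by blast
qed

lemma tail_tendsto: "(\<lambda>n. norm (x - sec n x)) \<longlonglongrightarrow> 0"
  using tendsto_norm[OF tendsto_diff[OF tendsto_const sec_tendsto[of x]], of x] by simp

definition unt :: "nat \<Rightarrow> 'b::real_normed_vector \<Rightarrow> 'b sq" where
  "unt j b = mk (\<lambda>i. if i = j then b else 0)"

lemma L2_set_single:
  "L2_set (\<lambda>i. norm (if i = j then b else 0)) {..<n::nat} = (if j < n then norm b else 0)"
proof -
  have "(\<Sum>i<n. (norm (if i = j then b else 0))\<^sup>2) = (\<Sum>i<n. if i = j then (norm b)\<^sup>2 else 0)"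
    by (rule sum.cong) auto
  then show ?thesis by (simp add: L2_set_def)
qed

lemma co_unt [simp]: "co (unt j b) i = (if i = j then b else 0)"
  unfolding unt_def by (subst co_mk[where c = "norm b"]) (auto simp: L2_set_single)

lemma norm_unt: "norm (unt j b) \<le> norm b"
  by (rule norm_sq_leI) (simp add: L2_set_single)

lemma sec_eq_sum: "sec n x = (\<Sum>j<n. unt j (co x j))"
  by (rule sq_eqI) (simp add: if_distrib cong: if_cong)

definition rsec :: "nat \<Rightarrow> (nat \<Rightarrow> real) \<Rightarrow> real sq" where
  "rsec n f = (\<Sum>j<n. unt j (f j))"

lemma co_rsec [simp]: "co (rsec n f) i = (if i < n then f i else 0)"
  by (simp add: rsec_def if_distrib cong: if_cong)

lemma L2_set_if_lessThan:
  "L2_set (\<lambda>i. norm (if i < n then f i else 0)) {..<m::nat} \<le> L2_set (\<lambda>i. norm (f i)) {..<n}"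
proof -
  have "(\<Sum>i<m. (norm (if i < n then f i else 0))\<^sup>2) = (\<Sum>i\<in>{..<m} \<inter> {..<n}. (norm (f i))\<^sup>2)"
    by (rule sum.mono_neutral_cong_right) auto
  also have "\<dots> \<le> (\<Sum>i<n. (norm (f i))\<^sup>2)" by (rule sum_mono2) auto
  finally show ?thesis by (simp add: L2_set_def)
qed

lemma norm_rsec: "norm (rsec n f) = L2_set f {..<n}"
proof (rule antisym)
  show "norm (rsec n f) \<le> L2_set f {..<n}"
  proof (rule norm_sq_leI)
    fix m
    show "L2_set (\<lambda>i. norm (co (rsec n f) i)) {..<m} \<le> L2_set f {..<n}"
      using L2_set_if_lessThan[of n f m] by (simp add: L2_set_def)
  qed
  have "L2_set f {..<n} = L2_set (\<lambda>i. norm (co (rsec n f) i)) {..<n}"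
    unfolding L2_set_def by (intro arg_cong[where f = sqrt] sum.cong) auto
  also have "\<dots> \<le> norm (rsec n f)" by (rule L2_set_co_le)
  finally show "L2_set f {..<n} \<le> norm (rsec n f)" .
qed

subsection \<open>Bounded nonnegative matrices\<close>

text \<open>Boundedness as a bilinear form on finite nonnegative vectors: no convergence question
  arises, and transposition, entrywise monotonicity and additivity in the matrix can be read off.
  The operator on the whole space is recovered afterwards.\<close>

definition bm :: "mat \<Rightarrow> real \<Rightarrow> bool" where
  "bm A c \<longleftrightarrow> nonneg_mat A \<and> (\<forall>n x y. (\<forall>i. 0 \<le> x i) \<longrightarrow> (\<forall>i. 0 \<le> y i) \<longrightarrow>
     (\<Sum>i<n. \<Sum>j<n. A i j * y i * x j) \<le> c * L2_set y {..<n} * L2_set x {..<n})"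

lemma bmI:
  assumes "\<And>i j. 0 \<le> A i j"
    and "\<And>n x y. (\<And>i. 0 \<le> x i) \<Longrightarrow> (\<And>i. 0 \<le> y i) \<Longrightarrow>
      (\<Sum>i<n. \<Sum>j<n. A i j * y i * x j) \<le> c * L2_set y {..<n} * L2_set x {..<n}"
  shows "bm A c"
  using assms unfolding bm_def nonneg_mat_def by auto

lemma bm_nonneg: "bm A c \<Longrightarrow> 0 \<le> A i j"
  by (simp add: bm_def nonneg_mat_def)

lemma bmD:
  assumes "bm A c" "\<And>i. 0 \<le> x i" "\<And>i. 0 \<le> y i"
  shows "(\<Sum>i<n. \<Sum>j<n. A i j * y i * x j) \<le> c * L2_set y {..<n} * L2_set x {..<n}"
  using assms unfolding bm_def by blast

lemma bm_bound_nonneg: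
  assumes "bm A c" shows "0 \<le> c"
  using bmD[OF assms, of "\<lambda>_. 1" "\<lambda>_. 1" 1] bm_nonneg[OF assms, of 0 0] by (simp add: L2_set_def)

lemma bm_mono:
  assumes "bm B c" "\<And>i j. 0 \<le> A i j" "\<And>i j. A i j \<le> B i j" "c \<le> d"
  shows "bm A d"
proof (rule bmI)
  fix n and x y :: "nat \<Rightarrow> real" assume xy: "\<And>i. 0 \<le> x i" "\<And>i. 0 \<le> y i"
  have "(\<Sum>i<n. \<Sum>j<n. A i j * y i * x j) \<le> (\<Sum>i<n. \<Sum>j<n. B i j * y i * x j)"
    by (intro sum_mono mult_right_mono assms xy)
  also have "\<dots> \<le> c * L2_set y {..<n} * L2_set x {..<n}" by (rule bmD[OF assms(1) xy])
  also have "\<dots> \<le> d * L2_set y {..<n} * L2_set x {..<n}"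
    by (intro mult_right_mono assms) auto
  finally show "(\<Sum>i<n. \<Sum>j<n. A i j * y i * x j) \<le> d * L2_set y {..<n} * L2_set x {..<n}" .
qed (rule assms)

lemma bm_weaken: "bm A c \<Longrightarrow> c \<le> d \<Longrightarrow> bm A d"
  by (rule bm_mono) (auto simp: bm_nonneg)

lemma bm_add:
  assumes "bm A a" "bm B b"
  shows "bm (\<lambda>i j. A i j + B i j) (a + b)"
proof (rule bmI)
  fix n and x y :: "nat \<Rightarrow> real" assume xy: "\<And>i. 0 \<le> x i" "\<And>i. 0 \<le> y i"
  show "(\<Sum>i<n. \<Sum>j<n. (A i j + B i j) * y i * x j) \<le> (a + b) * L2_set y {..<n} * L2_set x {..<n}"
    using add_mono[OF bmD[where n = n and x = x and y = y, OF assms(1) xy] bmD[where n = n and x = x and y = y, OF assms(2) xy]]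
    by (simp add: algebra_simps sum.distrib)
qed (auto intro: add_nonneg_nonneg bm_nonneg[OF assms(1)] bm_nonneg[OF assms(2)])

lemma bm_scale:
  assumes "bm A a" "0 \<le> t"
  shows "bm (\<lambda>i j. t * A i j) (t * a)"
proof (rule bmI)
  fix n and x y :: "nat \<Rightarrow> real" assume xy: "\<And>i. 0 \<le> x i" "\<And>i. 0 \<le> y i"
  show "(\<Sum>i<n. \<Sum>j<n. t * A i j * y i * x j) \<le> t * a * L2_set y {..<n} * L2_set x {..<n}"
    using mult_left_mono[OF bmD[where n = n and x = x and y = y, OF assms(1) xy] assms(2)]
    by (simp add: algebra_simps sum_distrib_left)
qed (auto intro: mult_nonneg_nonneg assms bm_nonneg[OF assms(1)])

lemma bm_transpose:
  assumes "bm A a"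
  shows "bm (mat_transpose A) a"
proof (rule bmI)
  fix n and x y :: "nat \<Rightarrow> real" assume xy: "\<And>i. 0 \<le> x i" "\<And>i. 0 \<le> y i"
  have "(\<Sum>i<n. \<Sum>j<n. A j i * y i * x j) = (\<Sum>i<n. \<Sum>j<n. A i j * x i * y j)"
    by (subst sum.swap) (simp add: mult_ac)
  then show "(\<Sum>i<n. \<Sum>j<n. mat_transpose A i j * y i * x j) \<le> a * L2_set y {..<n} * L2_set x {..<n}"
    using bmD[where n = n and x = y and y = x, OF assms xy(2,1)] by (simp add: mat_transpose_def mult_ac)
qed (auto simp: mat_transpose_def bm_nonneg[OF assms])

text \<open>Testing the form with the vector A x itself gives |A x|^2 \<le> c |A x| |x|, and |A x|
  cancels. Rows and columns are cut at different places, so both vectors are padded with zeros to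
  the common length \<open>N\<close>.\<close>

lemma bm_L2:
  assumes A: "bm A c" and x: "\<And>j. 0 \<le> x j"
  shows "L2_set (\<lambda>i. \<Sum>j<n. A i j * x j) {..<m} \<le> c * L2_set x {..<n}"
proof -
  define N where "N = max m n"
  define x' where "x' j = (if j < n then x j else 0)" for j
  define u where "u i = (if i < m then \<Sum>j<n. A i j * x j else 0)" for i
  have u0: "0 \<le> u i" for i
    unfolding u_def using bm_nonneg[OF A] x by (auto intro!: sum_nonneg)
  have x0: "0 \<le> x' i" for i unfolding x'_def using x by auto
  have Lu: "L2_set u {..<N} = L2_set (\<lambda>i. \<Sum>j<n. A i j * x j) {..<m}"
    unfolding L2_set_def
    by (intro arg_cong[where f = sqrt] sum.mono_neutral_cong_right) (auto simp: u_def N_def)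
  have Lx: "L2_set x' {..<N} = L2_set x {..<n}"
    unfolding L2_set_def
    by (intro arg_cong[where f = sqrt] sum.mono_neutral_cong_right) (auto simp: x'_def N_def)
  have row: "(\<Sum>j<N. A i j * u i * x' j) = (u i)\<^sup>2" for i
  proof (cases "i < m")
    case True
    have "(\<Sum>j<N. A i j * u i * x' j) = (\<Sum>j<n. A i j * u i * x j)"
      by (rule sum.mono_neutral_cong_right) (auto simp: x'_def N_def)
    also have "\<dots> = u i * (\<Sum>j<n. A i j * x j)" by (simp add: sum_distrib_left mult_ac)
    finally show ?thesis using True by (simp add: u_def power2_eq_square)
  qed (simp add: u_def)
  have "(L2_set u {..<N})\<^sup>2 = (\<Sum>i<N. \<Sum>j<N. A i j * u i * x' j)"
    by (simp add: row L2_set_power2)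
  also have "\<dots> \<le> c * L2_set u {..<N} * L2_set x' {..<N}" by (rule bmD[OF A x0 u0])
  finally have "L2_set u {..<N} * L2_set u {..<N} \<le> (c * L2_set x' {..<N}) * L2_set u {..<N}"
    by (simp add: power2_eq_square mult_ac)
  then have "L2_set u {..<N} \<le> c * L2_set x' {..<N} \<or> L2_set u {..<N} = 0"
    by (metis L2_set_nonneg mult_le_cancel_right order_less_le)
  moreover have "0 \<le> c * L2_set x' {..<N}" using bm_bound_nonneg[OF A] by simp
  ultimately show ?thesis unfolding Lu Lx by auto
qed

lemma bm_L2I:
  assumes "\<And>i j. 0 \<le> A i j"
    and "\<And>n x. (\<And>j. 0 \<le> x j) \<Longrightarrow> L2_set (\<lambda>i. \<Sum>j<n. A i j * x j) {..<n} \<le> c * L2_set x {..<n}"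
  shows "bm A c"
proof (rule bmI)
  fix n and x y :: "nat \<Rightarrow> real" assume xy: "\<And>i. 0 \<le> x i" "\<And>i. 0 \<le> y i"
  have "(\<Sum>i<n. \<Sum>j<n. A i j * y i * x j) = (\<Sum>i<n. \<bar>y i\<bar> * \<bar>\<Sum>j<n. A i j * x j\<bar>)"
  proof (rule sum.cong)
    fix i
    have "0 \<le> (\<Sum>j<n. A i j * x j)" by (intro sum_nonneg mult_nonneg_nonneg assms xy)
    then show "(\<Sum>j<n. A i j * y i * x j) = \<bar>y i\<bar> * \<bar>\<Sum>j<n. A i j * x j\<bar>"
      using xy(2)[of i] by (simp add: sum_distrib_left mult_ac)
  qed simp
  also have "\<dots> \<le> L2_set y {..<n} * L2_set (\<lambda>i. \<Sum>j<n. A i j * x j) {..<n}"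
    by (rule L2_set_mult_ineq)
  also have "\<dots> \<le> L2_set y {..<n} * (c * L2_set x {..<n})"
    by (intro mult_left_mono assms xy) auto
  finally show "(\<Sum>i<n. \<Sum>j<n. A i j * y i * x j) \<le> c * L2_set y {..<n} * L2_set x {..<n}"
    by (simp add: mult_ac)
qed (rule assms)

lemma bm_row_bound:
  fixes x :: "'b::real_normed_vector sq"
  assumes A: "bm A c"
  shows "(\<Sum>j<n. A i j * norm (co x j)) \<le> c * norm x"
proof -
  have "(\<Sum>j<n. A i j * norm (co x j)) \<le> L2_set (\<lambda>i. \<Sum>j<n. A i j * norm (co x j)) {..<Suc i}"
    by (rule member_le_L2_set) auto
  also have "\<dots> \<le> c * L2_set (\<lambda>j. norm (co x j)) {..<n}" by (rule bm_L2[OF A]) simp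
  also have "\<dots> \<le> c * norm x" by (intro mult_left_mono L2_set_co_le bm_bound_nonneg[OF A])
  finally show ?thesis .
qed

lemma bm_row_summable:
  fixes x :: "'b::real_normed_vector sq"
  assumes A: "bm A c"
  shows "summable (\<lambda>j. A i j * norm (co x j))"
  by (rule summableI_nonneg_bounded[where x = "c * norm x"])
    (auto intro: bm_row_bound[OF A] mult_nonneg_nonneg bm_nonneg[OF A])

lemma bm_row_summable':
  fixes x :: "'b::banach sq"
  assumes A: "bm A c"
  shows "summable (\<lambda>j. A i j *\<^sub>R co x j)"
proof (rule summable_norm_cancel)
  show "summable (\<lambda>j. norm (A i j *\<^sub>R co x j))"
    using bm_row_summable[OF A, of i x] bm_nonneg[OF A] by simp
qed

definition matop :: "mat \<Rightarrow> 'b::real_normed_vector sq \<Rightarrow> 'b sq" where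
  "matop A x = mk (\<lambda>i. \<Sum>j. A i j *\<^sub>R co x j)"

lemma matop_L2:
  fixes x :: "'b::banach sq"
  assumes A: "bm A c"
  shows "L2_set (\<lambda>i. norm (\<Sum>j. A i j *\<^sub>R co x j)) {..<m} \<le> c * norm x"
proof (rule LIMSEQ_le_const2)
  show "(\<lambda>n. L2_set (\<lambda>i. norm (\<Sum>j<n. A i j *\<^sub>R co x j)) {..<m}) \<longlonglongrightarrow>
      L2_set (\<lambda>i. norm (\<Sum>j. A i j *\<^sub>R co x j)) {..<m}"
    unfolding L2_set_def by (intro tendsto_intros summable_LIMSEQ bm_row_summable'[OF A])
  show "\<exists>N. \<forall>n\<ge>N. L2_set (\<lambda>i. norm (\<Sum>j<n. A i j *\<^sub>R co x j)) {..<m} \<le> c * norm x"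
  proof (intro exI[of _ 0] allI impI)
    fix n
    have "L2_set (\<lambda>i. norm (\<Sum>j<n. A i j *\<^sub>R co x j)) {..<m} \<le> L2_set (\<lambda>i. \<Sum>j<n. A i j * norm (co x j)) {..<m}"
      by (intro L2_set_mono norm_ge_zero) (rule order_trans[OF norm_sum], simp add: bm_nonneg[OF A])
    also have "\<dots> \<le> c * L2_set (\<lambda>j. norm (co x j)) {..<n}" by (rule bm_L2[OF A]) simp
    also have "\<dots> \<le> c * norm x" by (intro mult_left_mono L2_set_co_le bm_bound_nonneg[OF A])
    finally show "L2_set (\<lambda>i. norm (\<Sum>j<n. A i j *\<^sub>R co x j)) {..<m} \<le> c * norm x" .
  qed
qed

lemma co_matop:
  fixes x :: "'b::banach sq"
  assumes "bm A c"
  shows "co (matop A x) i = (\<Sum>j. A i j *\<^sub>R co x j)"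
  unfolding matop_def by (subst co_mk[OF matop_L2[OF assms]]) simp

lemma norm_matop_le:
  fixes x :: "'b::banach sq"
  assumes "bm A c"
  shows "norm (matop A x) \<le> c * norm x"
  by (rule norm_sq_leI) (simp add: co_matop[OF assms] matop_L2[OF assms])

lemma bounded_linear_matop:
  assumes "bm A c"
  shows "bounded_linear (matop A :: 'b::banach sq \<Rightarrow> 'b sq)"
proof (rule bounded_linear_intro[where K = c])
  fix x y :: "'b sq" and r :: real
  show "matop A (x + y) = matop A x + matop A y"
    by (rule sq_eqI) (simp add: co_matop[OF assms] scaleR_right_distrib suminf_add
        bm_row_summable'[OF assms])
  show "matop A (r *\<^sub>R x) = r *\<^sub>R matop A x"
    by (rule sq_eqI) (simp add: co_matop[OF assms] suminf_scaleR_right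
        bm_row_summable'[OF assms] mult.commute)
  show "norm (matop A x) \<le> norm x * c"
    using norm_matop_le[OF assms, of x] by (simp add: mult.commute)
qed

lemma co_matop_finite:
  fixes x :: "'b::banach sq"
  assumes "bm A c" "\<And>j. j \<ge> n \<Longrightarrow> co x j = 0"
  shows "co (matop A x) i = (\<Sum>j<n. A i j *\<^sub>R co x j)"
  unfolding co_matop[OF assms(1)] by (rule suminf_finite) (auto simp: assms(2))

text \<open>The constant \<open>c\<close> guarantees that the operator makes sense; the bound
  \<open>d\<close> on nonnegative vectors may be much smaller. This is how small norms of blocks and
  tails return to the language of forms.\<close>

lemma bm_of_matop:
  assumes A: "bm A c" and c: "\<And>x :: real sq. (\<And>i. 0 \<le> co x i) \<Longrightarrow> norm (matop A x) \<le> d * norm x"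
  shows "bm A d"
proof (rule bm_L2I)
  fix n and x :: "nat \<Rightarrow> real" assume x: "\<And>j. 0 \<le> x j"
  have "(\<Sum>j<n. A i j * x j) = co (matop A (rsec n x)) i" for i
    by (subst co_matop_finite[OF A, where n = n]) auto
  then have "L2_set (\<lambda>i. \<Sum>j<n. A i j * x j) {..<n} = L2_set (\<lambda>i. norm (co (matop A (rsec n x)) i)) {..<n}"
    by (simp add: L2_set_def)
  also have "\<dots> \<le> norm (matop A (rsec n x))" by (rule L2_set_co_le)
  also have "\<dots> \<le> d * norm (rsec n x)" by (rule c) (use x in simp)
  finally show "L2_set (\<lambda>i. \<Sum>j<n. A i j * x j) {..<n} \<le> d * L2_set x {..<n}"
    by (simp add: norm_rsec)
qed (rule bm_nonneg[OF A])

lemma co_matop_unt: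
  fixes b :: "'b::banach"
  assumes "bm A c" shows "co (matop A (unt j b)) i = A i j *\<^sub>R b"
  by (subst co_matop_finite[OF assms, where n = "Suc j"]) (auto simp: if_distrib cong: if_cong)

lemma matop_inject:
  assumes "bm A a" "bm B b" "\<And>x :: real sq. matop A x = matop B x"
  shows "A = B"
proof (intro ext)
  fix i j
  show "A i j = B i j"
    using assms(3)[of "unt j 1"] co_matop_unt[OF assms(1), of j "1::real" i]
      co_matop_unt[OF assms(2), of j "1::real" i] by simp
qed

subsection \<open>Products\<close>

text \<open>Column j of B is the image of a unit sequence, hence square summable, so each row of A
  can be summed against it.\<close>

lemma mat_mult_summable:
  assumes "bm A a" "bm B b"
  shows "summable (\<lambda>k. A i k * B k j)"
  using bm_row_summable'[OF assms(1), of i "matop B (unt j (1::real))"]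
  by (simp add: co_matop_unt[OF assms(2)])

lemma mat_mult_nonneg:
  assumes "bm A a" "bm B b"
  shows "0 \<le> mat_mult A B i j"
  unfolding mat_mult_def
  by (intro suminf_nonneg mat_mult_summable[OF assms] mult_nonneg_nonneg
      bm_nonneg[OF assms(1)] bm_nonneg[OF assms(2)])

lemma mat_mult_sec:
  fixes x :: "'b::banach sq"
  assumes A: "bm A a" and B: "bm B b" and x: "\<And>j. j \<ge> n \<Longrightarrow> co x j = 0"
  shows "co (matop A (matop B x)) i = (\<Sum>j<n. mat_mult A B i j *\<^sub>R co x j)"
proof -
  have "co (matop A (matop B x)) i = (\<Sum>k. \<Sum>j<n. (A i k * B k j) *\<^sub>R co x j)"
    by (simp add: co_matop[OF A] co_matop_finite[OF B x] scaleR_sum_right)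
  also have "\<dots> = (\<Sum>j<n. \<Sum>k. (A i k * B k j) *\<^sub>R co x j)"
    by (intro suminf_sum bounded_linear.summable[OF bounded_linear_scaleR_left] mat_mult_summable[OF A B])
  also have "\<dots> = (\<Sum>j<n. mat_mult A B i j *\<^sub>R co x j)"
    unfolding mat_mult_def
    by (intro sum.cong refl bounded_linear.suminf[OF bounded_linear_scaleR_left, symmetric] mat_mult_summable[OF A B])
  finally show ?thesis .
qed

lemma bm_mult:
  assumes A: "bm A a" and B: "bm B b"
  shows "bm (mat_mult A B) (a * b)"
proof (rule bm_L2I)
  fix n and x :: "nat \<Rightarrow> real" assume x: "\<And>j. 0 \<le> x j"
  have "(\<Sum>j<n. mat_mult A B i j * x j) = co (matop A (matop B (rsec n x))) i" for i
    by (subst mat_mult_sec[OF A B, where n = n]) auto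
  then have "L2_set (\<lambda>i. \<Sum>j<n. mat_mult A B i j * x j) {..<n}
      = L2_set (\<lambda>i. norm (co (matop A (matop B (rsec n x))) i)) {..<n}"
    by (simp add: L2_set_def)
  also have "\<dots> \<le> norm (matop A (matop B (rsec n x)))" by (rule L2_set_co_le)
  also have "\<dots> \<le> a * (b * norm (rsec n x))"
    by (rule order_trans[OF norm_matop_le[OF A] mult_left_mono[OF norm_matop_le[OF B] bm_bound_nonneg[OF A]]])
  finally show "L2_set (\<lambda>i. \<Sum>j<n. mat_mult A B i j * x j) {..<n} \<le> a * b * L2_set x {..<n}"
    by (simp add: norm_rsec mult_ac)
qed (rule mat_mult_nonneg[OF A B])

lemma matop_mult:
  fixes x :: "'b::banach sq"
  assumes A: "bm A a" and B: "bm B b"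
  shows "matop (mat_mult A B) x = matop A (matop B x)"
proof -
  have eq: "matop (mat_mult A B) (sec n x) = matop A (matop B (sec n x))" for n
    by (rule sq_eqI) (subst mat_mult_sec[OF A B, where n = n],
        auto simp: co_matop_finite[OF bm_mult[OF A B], where n = n])
  have "(\<lambda>n. matop (mat_mult A B) (sec n x)) \<longlonglongrightarrow> matop (mat_mult A B) x"
    by (rule bounded_linear.tendsto[OF bounded_linear_matop[OF bm_mult[OF A B]] sec_tendsto])
  moreover have "(\<lambda>n. matop A (matop B (sec n x))) \<longlonglongrightarrow> matop A (matop B x)"
    by (intro bounded_linear.tendsto[OF bounded_linear_matop[OF A]]
        bounded_linear.tendsto[OF bounded_linear_matop[OF B]] sec_tendsto)
  ultimately show ?thesis unfolding eq by (rule LIMSEQ_unique)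
qed

text \<open>Composition of operators is associative and an operator determines its matrix, so no
  double series has to be rearranged.\<close>

lemma mat_mult_assoc:
  assumes A: "bm A a" and B: "bm B b" and C: "bm C c"
  shows "mat_mult (mat_mult A B) C = mat_mult A (mat_mult B C)"
  by (rule matop_inject[OF bm_mult[OF bm_mult[OF A B] C] bm_mult[OF A bm_mult[OF B C]]])
    (simp add: matop_mult[OF bm_mult[OF A B] C] matop_mult[OF A B] matop_mult[OF B C]
      matop_mult[OF A bm_mult[OF B C]])

lemma mat_mult_mono:
  assumes "bm A' a" "bm B' b" "bm A c" "bm B d" "\<And>i j. A i j \<le> A' i j" "\<And>i j. B i j \<le> B' i j"
  shows "mat_mult A B i j \<le> mat_mult A' B' i j"
  unfolding mat_mult_def
  by (intro suminf_le mat_mult_summable[OF assms(1,2)] mat_mult_summable[OF assms(3,4)] mult_mono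
      assms bm_nonneg[OF assms(1)] bm_nonneg[OF assms(4)])

lemma bm_id: "bm id_mat 1"
proof (rule bmI)
  fix n and x y :: "nat \<Rightarrow> real" assume xy: "\<And>i. 0 \<le> x i" "\<And>i. 0 \<le> y i"
  have "(\<Sum>i<n. \<Sum>j<n. id_mat i j * y i * x j) = (\<Sum>i<n. \<Sum>j<n. if j = i then y i * x j else 0)"
    by (intro sum.cong) (auto simp: id_mat_def)
  also have "\<dots> = (\<Sum>i<n. \<bar>y i\<bar> * \<bar>x i\<bar>)" using xy by simp
  also have "\<dots> \<le> L2_set y {..<n} * L2_set x {..<n}" by (rule L2_set_mult_ineq)
  finally show "(\<Sum>i<n. \<Sum>j<n. id_mat i j * y i * x j) \<le> 1 * L2_set y {..<n} * L2_set x {..<n}" by simp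
qed (simp add: id_mat_def)

lemma mat_mult_id_right: "mat_mult A id_mat = A"
proof (intro ext)
  fix i j
  have "mat_mult A id_mat i j = (\<Sum>k\<in>{j}. A i k * id_mat k j)"
    unfolding mat_mult_def by (rule suminf_finite) (auto simp: id_mat_def)
  then show "mat_mult A id_mat i j = A i j" by (simp add: id_mat_def)
qed

lemma mat_mult_id_left: "mat_mult id_mat A = A"
proof (intro ext)
  fix i j
  have "mat_mult id_mat A i j = (\<Sum>k\<in>{i}. id_mat i k * A k j)"
    unfolding mat_mult_def by (rule suminf_finite) (auto simp: id_mat_def)
  then show "mat_mult id_mat A i j = A i j" by (simp add: id_mat_def)
qed

lemma transpose_mult: "mat_transpose (mat_mult A B) = mat_mult (mat_transpose B) (mat_transpose A)"
  by (simp add: mat_transpose_def mat_mult_def mult.commute)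

subsection \<open>The essential norm of a nonnegative matrix\<close>

lemma matop_dominated:
  fixes x :: "'b::banach sq" and y :: "real sq"
  assumes A: "bm A a" and B: "bm B b" and AB: "\<And>j. A i j \<le> B i j"
    and xy: "\<And>j. norm (co x j) \<le> co y j"
  shows "norm (co (matop A x) i) \<le> co (matop B y) i"
proof -
  have "norm (co (matop A x) i) \<le> (\<Sum>j. norm (A i j *\<^sub>R co x j))"
    unfolding co_matop[OF A] using bm_row_summable[OF A, of i x] bm_nonneg[OF A]
    by (intro summable_norm) simp
  also have "\<dots> \<le> (\<Sum>j. B i j *\<^sub>R co y j)"
  proof (rule suminf_le)
    show "norm (A i j *\<^sub>R co x j) \<le> B i j *\<^sub>R co y j" for j
      using AB[of j] xy[of j] bm_nonneg[OF A, of i j] by (simp add: mult_mono)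
    show "summable (\<lambda>j. norm (A i j *\<^sub>R co x j))"
      using bm_row_summable[OF A, of i x] bm_nonneg[OF A] by simp
  qed (rule bm_row_summable'[OF B])
  finally show ?thesis by (simp add: co_matop[OF B])
qed

lemma matop_nonneg:
  assumes A: "bm A a" and x: "\<And>j. 0 \<le> co x j"
  shows "0 \<le> co (matop A (x :: real sq)) i"
  using order_trans[OF norm_ge_zero matop_dominated[OF A A, of i x x]] x by simp

definition trunc :: "nat \<Rightarrow> mat \<Rightarrow> mat" where
  "trunc n A = (\<lambda>i j. if n \<le> i \<and> n \<le> j then A i j else 0)"

text \<open>Finitely many columns, seen from row n on. As n grows this corner tends to 0 in norm,
  which takes the place of a compactness argument.\<close>

definition blk :: "nat \<Rightarrow> nat \<Rightarrow> mat \<Rightarrow> mat" where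
  "blk n m A = (\<lambda>i j. if n \<le> i \<and> j < m then A i j else 0)"

lemma bm_trunc:
  assumes "bm A a" shows "bm (trunc n A) a"
  by (rule bm_mono[OF assms]) (auto simp: trunc_def bm_nonneg[OF assms])

lemma bm_blk:
  assumes "bm A a" shows "bm (blk n m A) a"
  by (rule bm_mono[OF assms]) (auto simp: blk_def bm_nonneg[OF assms])

lemma bm_trunc_mono:
  assumes "bm (trunc n A) a" "n \<le> N" shows "bm (trunc N A) a"
proof (rule bm_mono[OF assms(1)])
  fix i j
  have "0 \<le> trunc n A i j" by (rule bm_nonneg[OF assms(1)])
  then show "0 \<le> trunc N A i j" "trunc N A i j \<le> trunc n A i j"
    using assms(2) by (auto simp: trunc_def split: if_splits)
qed simp

lemma matop_blk:
  fixes x :: "'b::banach sq"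
  assumes A: "bm A a"
  shows "matop (blk n m A) x = matop A (sec m x) - sec n (matop A (sec m x))"
proof (rule sq_eqI)
  fix i
  have "co (matop (blk n m A) x) i = (\<Sum>j<m. blk n m A i j *\<^sub>R co x j)"
    unfolding co_matop[OF bm_blk[OF A]] by (rule suminf_finite) (auto simp: blk_def)
  then show "co (matop (blk n m A) x) i = co (matop A (sec m x) - sec n (matop A (sec m x))) i"
    by (auto simp: co_matop_finite[OF A, where n = m] blk_def)
qed

text \<open>The first m columns are square summable. The sum \<open>t N\<close> of the norms of
  their tails beyond N tends to 0, and it bounds the block because every coordinate of x is at most
  norm x.\<close>

lemma blk_small:
  assumes A: "bm A a" and e: "e > 0"
  shows "\<exists>N\<ge>n. bm (blk N m A) e"
proof -
  define t where "t N = (\<Sum>j<m. norm (matop A (unt j (1::real)) - sec N (matop A (unt j 1))))" for N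
  have "t \<longlonglongrightarrow> (\<Sum>j<m. 0)" unfolding t_def by (intro tendsto_sum tail_tendsto)
  then have "\<forall>\<^sub>F N in sequentially. t N < e"
    using e by (intro order_tendstoD(2)[where y = 0]) simp_all
  then obtain N where N: "N \<ge> n" "t N < e"
    by (metis eventually_sequentially nle_le)
  have "bm (blk N m A) e"
  proof (rule bm_of_matop[OF bm_blk[OF A]])
    fix x :: "real sq"
    interpret A: bounded_linear "matop A :: real sq \<Rightarrow> real sq" by (rule bounded_linear_matop[OF A])
    interpret S: bounded_linear "sec N :: real sq \<Rightarrow> real sq" by (rule bounded_linear_sec)
    have u: "unt j (co x j) = co x j *\<^sub>R unt j (1::real)" for j by (rule sq_eqI) simp
    have "matop (blk N m A) x = (\<Sum>j<m. co x j *\<^sub>R (matop A (unt j 1) - sec N (matop A (unt j 1))))"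
      unfolding matop_blk[OF A] sec_eq_sum[of m x] u
      by (simp add: A.sum A.scaleR S.sum S.scaleR sum_subtractf scaleR_diff_right)
    also have "norm \<dots> \<le> (\<Sum>j<m. norm x * norm (matop A (unt j (1::real)) - sec N (matop A (unt j 1))))"
      using norm_co_le[of x] by (intro order_trans[OF norm_sum] sum_mono) (simp add: mult_right_mono)
    also have "\<dots> = t N * norm x" by (simp add: t_def sum_distrib_left mult.commute)
    also have "\<dots> \<le> e * norm x" using N by (intro mult_right_mono) auto
    finally show "norm (matop (blk N m A) x) \<le> e * norm x" .
  qed
  with N show ?thesis by blast
qed

definition ess :: "mat \<Rightarrow> real" where
  "ess A = Inf {c. \<exists>n. bm (trunc n A) c}"

lemma ess_set_bdd: "bdd_below {c. \<exists>n. bm (trunc n A) c}"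
  by (rule bdd_belowI[of _ 0]) (auto dest: bm_bound_nonneg)

lemma ess_le: "bm (trunc n A) c \<Longrightarrow> ess A \<le> c"
  unfolding ess_def by (rule cInf_lower[OF _ ess_set_bdd]) blast

lemma ess_le_bound: "bm A c \<Longrightarrow> ess A \<le> c"
  by (rule ess_le[OF bm_trunc])

lemma ess_nonneg:
  assumes "bm A a" shows "0 \<le> ess A"
  unfolding ess_def
  by (rule cInf_greatest) (use bm_trunc[OF assms] in \<open>auto dest: bm_bound_nonneg\<close>)

lemma ess_lessD:
  assumes A: "bm A a" and "ess A < c"
  obtains n where "bm (trunc n A) c"
proof -
  have "\<exists>c'\<in>{c. \<exists>n. bm (trunc n A) c}. c' < c"
    using assms(2) unfolding ess_def
    by (subst (asm) cInf_less_iff) (use bm_trunc[OF A] ess_set_bdd in auto)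
  then obtain c' n where "bm (trunc n A) c'" "c' < c" by auto
  then show ?thesis using bm_weaken[of "trunc n A" c' c] by (intro that[of n]) auto
qed

lemma ess_leI:
  assumes "\<And>e. e > 0 \<Longrightarrow> \<exists>n. bm (trunc n A) (c + e)"
  shows "ess A \<le> c"
  by (rule field_le_epsilon) (meson assms ess_le)

lemma ess_mono:
  assumes A: "bm A a" and B: "bm B b" and le: "\<And>i j. A i j \<le> B i j"
  shows "ess A \<le> ess B"
proof (rule ess_leI)
  fix e :: real assume "e > 0"
  then have "ess B < ess B + e" by simp
  then obtain n where n: "bm (trunc n B) (ess B + e)" by (rule ess_lessD[OF B])
  have "bm (trunc n A) (ess B + e)"
    by (rule bm_mono[OF n]) (auto simp: trunc_def bm_nonneg[OF A] le)
  then show "\<exists>n. bm (trunc n A) (ess B + e)" ..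
qed

lemma ess_add:
  assumes A: "bm A a" and B: "bm B b"
  shows "ess (\<lambda>i j. A i j + B i j) \<le> ess A + ess B"
proof (rule ess_leI)
  fix e :: real assume e: "e > 0"
  then have "ess A < ess A + e/2" "ess B < ess B + e/2" by auto
  then obtain n m where n: "bm (trunc n A) (ess A + e/2)" and m: "bm (trunc m B) (ess B + e/2)"
    by (metis ess_lessD[OF A] ess_lessD[OF B])
  have "bm (\<lambda>i j. trunc (max n m) A i j + trunc (max n m) B i j) ((ess A + e/2) + (ess B + e/2))"
    by (intro bm_add bm_trunc_mono[OF n] bm_trunc_mono[OF m]) auto
  moreover have "(\<lambda>i j. trunc (max n m) A i j + trunc (max n m) B i j) = trunc (max n m) (\<lambda>i j. A i j + B i j)"
    by (auto simp: trunc_def fun_eq_iff)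
  ultimately show "\<exists>n. bm (trunc n (\<lambda>i j. A i j + B i j)) (ess A + ess B + e)"
    by (auto simp: algebra_simps)
qed

text \<open>The inner summation index is split at n: indices from n on give the product of the
  truncations, the finitely many below n meet only the corner of A with rows from N on.\<close>

lemma trunc_mult_le:
  assumes A: "bm A a" and B: "bm B b" and "n \<le> N"
  shows "trunc N (mat_mult A B) i j \<le> mat_mult (trunc n A) (trunc n B) i j + mat_mult (blk N n A) B i j"
proof (cases "N \<le> i \<and> N \<le> j")
  case True
  have "mat_mult A B i j = (\<Sum>k. trunc n A i k * trunc n B k j + blk N n A i k * B k j)"
    unfolding mat_mult_def using True assms(3)
    by (intro suminf_cong) (auto simp: trunc_def blk_def)
  also have "\<dots> = mat_mult (trunc n A) (trunc n B) i j + mat_mult (blk N n A) B i j"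
    unfolding mat_mult_def
    by (intro suminf_add[symmetric] mat_mult_summable[OF bm_trunc[OF A] bm_trunc[OF B]]
        mat_mult_summable[OF bm_blk[OF A] B])
  finally show ?thesis by (simp add: trunc_def True)
next
  case False
  have "0 \<le> mat_mult (trunc n A) (trunc n B) i j" "0 \<le> mat_mult (blk N n A) B i j"
    by (rule mat_mult_nonneg[OF bm_trunc[OF A] bm_trunc[OF B]], rule mat_mult_nonneg[OF bm_blk[OF A] B])
  then show ?thesis using False by (auto simp: trunc_def)
qed

text \<open>The truncation index k is fixed before N, and N is then taken so far out that the corner
  of A has norm at most e; the corner multiplied by all of B costs \<open>e * b\<close>. As this
  holds for every small e, the limit e -> 0 gives the product.\<close>

lemma ess_mult:
  assumes A: "bm A a" and B: "bm B b"
  shows "ess (mat_mult A B) \<le> ess A * ess B"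
proof (rule tendsto_lowerbound[where F = "at_right 0"])
  have "((\<lambda>e. (ess A + e) * (ess B + e) + e * b) \<longlongrightarrow> (ess A + 0) * (ess B + 0) + 0 * b) (at_right 0)"
    by (intro tendsto_intros)
  then show "((\<lambda>e. (ess A + e) * (ess B + e) + e * b) \<longlongrightarrow> ess A * ess B) (at_right 0)" by simp
  show "\<forall>\<^sub>F e in at_right 0. ess (mat_mult A B) \<le> (ess A + e) * (ess B + e) + e * b"
  proof (rule eventually_at_rightI[of 0 1])
    fix e :: real assume "e \<in> {0<..<1}"
    then have e: "e > 0" by simp
    then have "ess A < ess A + e" "ess B < ess B + e" by auto
    then obtain n m where n: "bm (trunc n A) (ess A + e)" and m: "bm (trunc m B) (ess B + e)"
      by (metis ess_lessD[OF A] ess_lessD[OF B])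
    define k where "k = max n m"
    have kA: "bm (trunc k A) (ess A + e)" and kB: "bm (trunc k B) (ess B + e)"
      using bm_trunc_mono[OF n, of k] bm_trunc_mono[OF m, of k] by (auto simp: k_def)
    obtain N where N: "N \<ge> k" "bm (blk N k A) e" using blk_small[OF A e] by blast
    have "bm (trunc N (mat_mult A B)) ((ess A + e) * (ess B + e) + e * b)"
      by (rule bm_mono[OF bm_add[OF bm_mult[OF kA kB] bm_mult[OF N(2) B]]])
        (auto intro: trunc_mult_le[OF A B N(1)] bm_nonneg[OF bm_trunc[OF bm_mult[OF A B]]])
    then show "ess (mat_mult A B) \<le> (ess A + e) * (ess B + e) + e * b" by (rule ess_le)
  qed simp
qed simp

lemma transpose_transpose: "mat_transpose (mat_transpose A) = A"
  by (simp add: mat_transpose_def)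

lemma ess_transpose: "ess (mat_transpose A) = ess A"
proof -
  have "trunc n (mat_transpose A) = mat_transpose (trunc n A)" for n A
    by (auto simp: trunc_def mat_transpose_def fun_eq_iff)
  then have "bm (trunc n (mat_transpose A)) c \<longleftrightarrow> bm (trunc n A) c" for n c
    using bm_transpose[of "trunc n A" c] bm_transpose[of "mat_transpose (trunc n A)" c]
      transpose_transpose[of "trunc n A"] by metis
  then show ?thesis by (simp add: ess_def)
qed

subsection \<open>The raw sequences of the definitions\<close>

lemma co_in_l2: "co x \<in> l2" for x :: "complex sq"
  using summable_co[of x] by (simp add: l2_def)

lemma co_mk_l2: "x \<in> l2 \<Longrightarrow> co (mk x :: complex sq) = x"
  by (simp add: l2_def mk_inverse)

lemma l2norm_co: "l2norm (co x) = norm x"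
  by (simp add: l2norm_def norm_sq_def)

lemma l2_cases:
  assumes "x \<in> l2" obtains u :: "complex sq" where "x = co u"
  using co_mk_l2[OF assms] by metis

lemma mat_apply_co:
  assumes "bm A c" shows "mat_apply A (co x) = co (matop A x)"
  by (rule ext) (simp add: mat_apply_def co_matop[OF assms] scaleR_conv_of_real)

lemma bm_of_operator:
  assumes A: "nonneg_mat A" "defines_op A"
    and M: "\<And>x. x \<in> l2 \<Longrightarrow> l2norm (mat_apply A x) \<le> M * l2norm x"
  shows "bm A M"
proof (rule bm_L2I)
  show "0 \<le> A i j" for i j using A by (simp add: nonneg_mat_def)
  fix n and x :: "nat \<Rightarrow> real" assume x: "\<And>j. 0 \<le> x j"
  define z :: "complex sq" where "z = (\<Sum>j<n. unt j (of_real (x j)))"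
  have z: "co z i = (if i < n then of_real (x i) else 0)" for i
    by (simp add: z_def if_distrib cong: if_cong)
  have nz: "norm z \<le> L2_set x {..<n}"
  proof (rule norm_sq_leI)
    fix m
    have "L2_set (\<lambda>i. norm (co z i)) {..<m} \<le> L2_set (\<lambda>i. norm (complex_of_real (x i))) {..<n}"
      unfolding z using L2_set_if_lessThan[of n "\<lambda>i. complex_of_real (x i)" m] by simp
    then show "L2_set (\<lambda>i. norm (co z i)) {..<m} \<le> L2_set x {..<n}" using x by simp
  qed
  have Az: "mat_apply A (co z) i = of_real (\<Sum>j<n. A i j * x j)" for i
  proof -
    have "mat_apply A (co z) i = (\<Sum>j<n. complex_of_real (A i j) * co z j)"
      unfolding mat_apply_def by (rule suminf_finite) (auto simp: z)
    then show ?thesis by (simp add: z)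
  qed
  have "mat_apply A (co z) \<in> l2" using A co_in_l2 by (auto simp: defines_op_def)
  then have "L2_set (\<lambda>i. norm (mat_apply A (co z) i)) {..<n} \<le> l2norm (mat_apply A (co z))"
    unfolding l2norm_def l2_def by (intro L2_set_le_sqrt_suminf) simp
  also have "\<dots> \<le> M * norm z" using M[OF co_in_l2, of z] by (simp add: l2norm_co)
  finally have 1: "L2_set (\<lambda>i. \<Sum>j<n. A i j * x j) {..<n} \<le> M * norm z"
    by (simp add: Az L2_set_def norm_of_real del: of_real_sum of_real_mult)
  show "L2_set (\<lambda>i. \<Sum>j<n. A i j * x j) {..<n} \<le> M * L2_set x {..<n}"
  proof (cases "M \<ge> 0")
    case True
    then show ?thesis using 1 mult_left_mono[OF nz True] by linarith
  next
    \<comment> \<open>The constant of a bounded set may formally be negative; a unit sequence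
      refutes that.\<close>
    case False
    have "norm (unt 0 (1::complex)) \<noteq> 0"
      using norm_co_le[of "unt 0 (1::complex)" 0] by auto
    then have "M * norm (unt 0 (1::complex)) < 0" using False by (simp add: mult_less_0_iff)
    moreover have "mat_apply A (co (unt 0 1)) \<in> l2" using A co_in_l2 by (auto simp: defines_op_def)
    then have "0 \<le> l2norm (mat_apply A (co (unt 0 1)))" by (metis l2_cases l2norm_co norm_ge_zero)
    ultimately show ?thesis using M[OF co_in_l2, of "unt 0 1"] by (simp add: l2norm_co)
  qed
qed

definition cx :: "real sq \<Rightarrow> complex sq" where
  "cx x = mk (\<lambda>i. of_real (co x i))"

lemma co_cx [simp]: "co (cx x) i = of_real (co x i)"
  unfolding cx_def by (subst co_mk[where c = "norm x"]) (use L2_set_co_le[of x] in auto)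

lemma norm_cx: "norm (cx x) = norm x"
  by (simp add: norm_sq_def)

lemma matop_cx:
  assumes "bm A c" shows "matop A (cx x) = cx (matop A x)"
proof (rule sq_eqI)
  fix i
  have "co (matop A (cx x)) i = (\<Sum>j. complex_of_real (A i j * co x j))"
    by (simp add: co_matop[OF assms] scaleR_conv_of_real)
  also have "\<dots> = complex_of_real (\<Sum>j. A i j * co x j)"
    using bm_row_summable'[OF assms, of i x] by (intro suminf_of_real[symmetric]) simp
  finally show "co (matop A (cx x)) i = co (cx (matop A x)) i" by (simp add: co_matop[OF assms])
qed

section \<open>Finite covers of the image of the unit ball\<close>

lemma finite_net_cball:
  fixes c :: real assumes "d > 0"
  obtains K :: "complex set" where "finite K" "\<And>z. norm z \<le> c \<Longrightarrow> \<exists>k\<in>K. norm (z - k) < d"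
proof -
  obtain K where K: "finite K" "cball (0::complex) c \<subseteq> (\<Union>k\<in>K. ball k d)"
    using compact_imp_seq_compact[OF compact_cball, of "0::complex" c] assms
    by (metis compact_cball compact_eq_totally_bounded)
  show ?thesis
  proof (rule that[OF K(1)])
    fix z :: complex assume "norm z \<le> c"
    then have "z \<in> (\<Union>k\<in>K. ball k d)" using K(2) by (intro subsetD[OF K(2)]) simp
    then obtain k where "k \<in> K" "dist k z < d" by auto
    then show "\<exists>k\<in>K. norm (z - k) < d" by (auto simp: dist_norm norm_minus_commute)
  qed
qed

lemma hmnc_set_bdd:
  "bdd_below {\<epsilon>. 0 < \<epsilon> \<and> (\<exists>F. finite F \<and> F \<subseteq> l2 \<and> X \<subseteq> (\<Union>c\<in>F. {x\<in>l2. l2norm (\<lambda>i. x i - c i) \<le> \<epsilon>}))}"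
  by (rule bdd_belowI[of _ 0]) auto

text \<open>All rows from N on together have norm at most c + h/2, as truncation plus a small
  corner. The remaining N coordinates of the image of the unit ball are bounded by a, so finitely
  many points approximate them up to h/2.\<close>

lemma cover_of_trunc:
  assumes A: "bm A a" and t: "bm (trunc n A) c" and h: "h > 0"
  shows "\<exists>F. finite F \<and> F \<subseteq> l2 \<and>
    mat_apply A ` {x\<in>l2. l2norm x \<le> 1} \<subseteq> (\<Union>f\<in>F. {x\<in>l2. l2norm (\<lambda>i. x i - f i) \<le> c + h})"
proof -
  obtain N where N: "N \<ge> n" "bm (blk N n A) (h/2)" using blk_small[OF A, of "h/2"] h by auto
  define R where "R = (\<lambda>i j. if N \<le> i then A i j else 0)"
  have R: "bm R (c + h/2)"
    by (rule bm_mono[OF bm_add[OF t N(2)]])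
      (use N(1) in \<open>auto simp: R_def trunc_def blk_def bm_nonneg[OF A]\<close>)
  \<comment> \<open>One net of mesh d in the disc of radius a serves every coordinate, with total
    error at most N d \<le> h/2. The denominator 1 + N also covers N = 0.\<close>
  define d where "d = h / 2 / (1 + real N)"
  have d: "d > 0" using h by (simp add: d_def)
  have "real N * d = h / 2 * (real N / (1 + real N))" by (simp add: d_def)
  also have "\<dots> \<le> h / 2 * 1" using h by (intro mult_left_mono) (auto simp: divide_simps)
  finally have Nd: "real N * d \<le> h / 2" by simp
  obtain K where K: "finite K" "\<And>z::complex. norm z \<le> a \<Longrightarrow> \<exists>k\<in>K. norm (z - k) < d"
    using finite_net_cball[OF d] by metis
  define pt :: "(nat \<Rightarrow> complex) \<Rightarrow> complex sq" where "pt g = (\<Sum>j<N. unt j (g j))" for g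
  have pt: "co (pt g) i = (if i < N then g i else 0)" for g i
    by (simp add: pt_def if_distrib cong: if_cong)
  define F where "F = (\<lambda>g. co (pt g)) ` (PiE {..<N} (\<lambda>_. K))"
  have "finite F" unfolding F_def by (intro finite_imageI finite_PiE) (auto simp: K)
  moreover have "F \<subseteq> l2" by (simp add: F_def image_subset_iff co_in_l2)
  moreover have "mat_apply A ` {x\<in>l2. l2norm x \<le> 1} \<subseteq> (\<Union>f\<in>F. {x\<in>l2. l2norm (\<lambda>i. x i - f i) \<le> c + h})"
  proof clarify
    fix x :: seq assume x: "x \<in> l2" "l2norm x \<le> 1"
    obtain u :: "complex sq" where u: "x = co u" using l2_cases[OF x(1)] .
    have nu: "norm u \<le> 1" using x(2) by (simp add: u l2norm_co)
    define y where "y = matop A u"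
    have "norm (co y i) \<le> a" for i
    proof -
      have "norm (co y i) \<le> a * norm u"
        using norm_co_le[of y i] norm_matop_le[OF A, of u] by (simp add: y_def)
      also have "\<dots> \<le> a * 1" by (intro mult_left_mono nu bm_bound_nonneg[OF A])
      finally show ?thesis by simp
    qed
    then have "\<forall>i. \<exists>k. k \<in> K \<and> norm (co y i - k) < d" using K(2) by blast
    then obtain g where g: "\<And>i. g i \<in> K" "\<And>i. norm (co y i - g i) < d" by metis
    define g' where "g' = restrict g {..<N}"
    have g'F: "co (pt g') \<in> F" unfolding F_def using g(1) by (auto simp: g'_def)
    have yR: "y - sec N y = matop R u"
      by (rule sq_eqI) (simp add: y_def co_matop[OF A] co_matop[OF R], simp add: R_def)
    have "norm (y - sec N y) \<le> (c + h/2) * norm u" unfolding yR by (rule norm_matop_le[OF R])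
    also have "\<dots> \<le> (c + h/2) * 1" by (intro mult_left_mono nu bm_bound_nonneg[OF R])
    finally have 1: "norm (y - sec N y) \<le> c + h/2" by simp
    have "sec N y - pt g' = (\<Sum>j<N. unt j (co y j - g j))"
      by (rule sq_eqI) (auto simp: pt g'_def if_distrib cong: if_cong)
    also have "norm \<dots> \<le> (\<Sum>j<N. d)"
      by (intro order_trans[OF norm_sum] sum_mono order_trans[OF norm_unt] less_imp_le g(2))
    also have "\<dots> \<le> h / 2" using Nd by simp
    finally have 2: "norm (sec N y - pt g') \<le> h / 2" .
    have "norm (y - pt g') \<le> norm (y - sec N y) + norm (sec N y - pt g')"
      using norm_triangle_ineq[of "y - sec N y" "sec N y - pt g'"] by simp
    also have "\<dots> \<le> c + h" using 1 2 by simp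
    finally have "l2norm (co (y - pt g')) \<le> c + h" by (simp add: l2norm_co)
    then show "mat_apply A x \<in> (\<Union>f\<in>F. {x\<in>l2. l2norm (\<lambda>i. x i - f i) \<le> c + h})"
      using g'F by (auto simp: u mat_apply_co[OF A] co_in_l2 y_def co_diff_fun)
  qed
  ultimately show ?thesis by blast
qed

text \<open>Finitely many centres have uniformly small tails, so beyond some N the image of every
  unit vector has tail at most e + h. For nonnegative x the truncated image lies coordinatewise
  below that tail, which is where positivity enters.\<close>

lemma trunc_of_cover:
  assumes A: "bm A a" and e: "e > 0" and F: "finite F" "F \<subseteq> l2"
    and cov: "mat_apply A ` {x\<in>l2. l2norm x \<le> 1} \<subseteq> (\<Union>f\<in>F. {x\<in>l2. l2norm (\<lambda>i. x i - f i) \<le> e})"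
    and h: "h > 0"
  shows "\<exists>N. bm (trunc N A) (e + h)"
proof -
  have "\<forall>f\<in>F. \<forall>\<^sub>F N in sequentially. norm (mk f - sec N (mk f) :: complex sq) < h"
    using order_tendstoD(2)[OF tail_tendsto h] by blast
  then have "\<forall>\<^sub>F N in sequentially. \<forall>f\<in>F. norm (mk f - sec N (mk f) :: complex sq) < h"
    using F(1) by (simp add: eventually_ball_finite)
  then obtain N where "\<forall>n\<ge>N. \<forall>f\<in>F. norm (mk f - sec n (mk f) :: complex sq) < h"
    unfolding eventually_sequentially by blast
  then have N: "\<And>f. f \<in> F \<Longrightarrow> norm (mk f - sec N (mk f) :: complex sq) < h" by simp
  have "bm (trunc N A) (e + h)"
  proof (rule bm_of_matop[OF bm_trunc[OF A]])
    fix x :: "real sq" assume x: "\<And>i. 0 \<le> co x i"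
    show "norm (matop (trunc N A) x) \<le> (e + h) * norm x"
    proof (cases "x = 0")
      case True
      then show ?thesis by (simp add: linear_0 bounded_linear.linear[OF bounded_linear_matop[OF bm_trunc[OF A]]])
    next
      case False
      define u where "u = inverse (norm x) *\<^sub>R x"
      have nu: "norm (cx u) \<le> 1" using False by (simp add: u_def norm_cx)
      have "mat_apply A (co (cx u)) \<in> mat_apply A ` {x\<in>l2. l2norm x \<le> 1}"
        using nu by (auto simp: co_in_l2 l2norm_co)
      then obtain f where f: "f \<in> F" "l2norm (\<lambda>i. mat_apply A (co (cx u)) i - f i) \<le> e"
        using cov by blast
      obtain v :: "complex sq" where v: "f = co v" using f(1) F(2) l2_cases by blast
      define y where "y = cx (matop A u)"
      have "l2norm (co (y - v)) \<le> e"
        using f(2) by (simp add: v y_def mat_apply_co[OF A] matop_cx[OF A] co_diff_fun)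
      then have yv: "norm (y - v) \<le> e" by (simp add: l2norm_co)
      have "mk f = v" by (simp add: v co_inverse)
      then have vt: "norm (v - sec N v) < h" using N[OF f(1)] by simp
      have "y - sec N y = ((y - v) - sec N (y - v)) + (v - sec N v)"
        by (rule sq_eqI) simp
      then have "norm (y - sec N y) \<le> norm ((y - v) - sec N (y - v)) + norm (v - sec N v)"
        by (metis norm_triangle_ineq)
      also have "\<dots> \<le> e + h" using norm_tail_le[of "y - v" N] yv vt by linarith
      finally have yt: "norm (y - sec N y) \<le> e + h" .
      have "y - sec N y = inverse (norm x) *\<^sub>R cx (matop A x - sec N (matop A x))"
        unfolding y_def u_def
        by (rule sq_eqI) (simp add: linear_cmul bounded_linear.linear[OF bounded_linear_matop[OF A]] scaleR_conv_of_real)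
      then have "norm (matop A x - sec N (matop A x)) \<le> (e + h) * norm x"
        using yt False by (simp add: norm_cx divide_simps)
      moreover have "norm (matop (trunc N A) x) \<le> norm (matop A x - sec N (matop A x))"
      proof (rule norm_sq_mono)
        fix i
        have "norm (co (matop (trunc N A) x) i) \<le> co (matop A x) i"
          by (rule matop_dominated[OF bm_trunc[OF A] A]) (use x bm_nonneg[OF A] in \<open>auto simp: trunc_def\<close>)
        moreover have "co (matop (trunc N A) x) i = 0" if "i < N"
          using that by (simp only: co_matop[OF bm_trunc[OF A]]) (simp add: trunc_def)
        ultimately show "norm (co (matop (trunc N A) x) i) \<le> norm (co (matop A x - sec N (matop A x)) i)"
          by auto
      qed
      ultimately show ?thesis by linarith
    qed
  qed
  then show ?thesis ..
qed

lemma gamma_eq_ess: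
  assumes A: "bm A a" shows "gamma A = ess A"
proof (rule antisym)
  let ?X = "mat_apply A ` {x\<in>l2. l2norm x \<le> 1}"
  show "gamma A \<le> ess A"
  proof (rule field_le_epsilon)
    fix e :: real assume e: "e > 0"
    then have "ess A < ess A + e/2" by simp
    then obtain n where "bm (trunc n A) (ess A + e/2)" by (rule ess_lessD[OF A])
    from cover_of_trunc[OF A this, of "e/2"] e
    obtain F where "finite F" "F \<subseteq> l2" "?X \<subseteq> (\<Union>f\<in>F. {x\<in>l2. l2norm (\<lambda>i. x i - f i) \<le> ess A + e})"
      by (auto simp: add.assoc)
    moreover have "0 < ess A + e" using e ess_nonneg[OF A] by simp
    ultimately show "gamma A \<le> ess A + e"
      unfolding gamma_def hmnc_def by (intro cInf_lower[OF _ hmnc_set_bdd]) blast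
  qed
  show "ess A \<le> gamma A"
    unfolding gamma_def hmnc_def
  proof (rule cInf_greatest)
    have "bm (trunc 0 A) a" by (rule bm_trunc[OF A])
    then obtain F where "finite F" "F \<subseteq> l2" "?X \<subseteq> (\<Union>f\<in>F. {x\<in>l2. l2norm (\<lambda>i. x i - f i) \<le> a + 1})"
      using cover_of_trunc[OF A, of 0 a 1] by auto
    moreover have "0 < a + 1" using bm_bound_nonneg[OF A] by simp
    ultimately show "{\<epsilon>. 0 < \<epsilon> \<and> (\<exists>F. finite F \<and> F \<subseteq> l2 \<and> ?X \<subseteq> (\<Union>c\<in>F. {x\<in>l2. l2norm (\<lambda>i. x i - c i) \<le> \<epsilon>}))} \<noteq> {}"
      by blast
  next
    fix e assume "e \<in> {\<epsilon>. 0 < \<epsilon> \<and> (\<exists>F. finite F \<and> F \<subseteq> l2 \<and> ?X \<subseteq> (\<Union>c\<in>F. {x\<in>l2. l2norm (\<lambda>i. x i - c i) \<le> \<epsilon>}))}"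
    then show "ess A \<le> e" using trunc_of_cover[OF A] by (intro ess_leI) blast
  qed
qed

subsection \<open>Submultiplicative sequences\<close>

text \<open>Division with remainder: write j = k a + r with r < k. \<open>C\<close> adds up the
  ratios s r / q^r over the k possible remainders; the extra 1 makes it positive.\<close>

lemma submult_power_bound:
  fixes s :: "nat \<Rightarrow> real"
  assumes s0: "\<And>m. 0 \<le> s m" and sm: "\<And>m n. s (m + n) \<le> s m * s n"
    and k: "k \<ge> 1" "s k \<le> q ^ k" and q: "q > 0"
  shows "\<exists>C>0. \<forall>j. s j \<le> C * q ^ j"
proof -
  define C where "C = (\<Sum>r<k. s r / q ^ r) + 1"
  have C: "C > 0" unfolding C_def using s0 q by (intro add_nonneg_pos sum_nonneg) auto
  have small: "s r \<le> C * q ^ r" if "r < k" for r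
  proof -
    have "s r / q ^ r \<le> (\<Sum>r<k. s r / q ^ r)"
      by (rule member_le_sum) (use that s0 q in auto)
    then have "s r / q ^ r \<le> C" by (simp add: C_def)
    then show ?thesis using q by (simp add: divide_simps)
  qed
  have "s (k * a + r) \<le> C * q ^ (k * a + r)" if "r < k" for a r
  proof (induction a)
    case 0
    then show ?case using small[OF that] by simp
  next
    case (Suc a)
    have "s (k * Suc a + r) \<le> s k * s (k * a + r)"
      using sm[of k "k * a + r"] by (simp add: algebra_simps)
    also have "\<dots> \<le> q ^ k * (C * q ^ (k * a + r))"
      using k(2) Suc s0 q by (intro mult_mono) auto
    finally show ?case by (simp add: power_add mult_ac)
  qed
  from this[of "j mod k" "j div k" for j] k(1) have "s j \<le> C * q ^ j" for j by simp
  with C show ?thesis by blast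
qed

lemma powr_inverse_less_iff:
  fixes x q :: real
  assumes "0 \<le> x" "0 < q" "m \<ge> 1"
  shows "x powr (1 / real m) < q \<longleftrightarrow> x < q ^ m"
proof -
  have m: "0 < real m" using assms(3) by simp
  have eq: "q powr real m = q ^ m" using assms(2) by (simp add: powr_realpow)
  have eq': "(x powr (1 / real m)) powr real m = x" "(q ^ m) powr (1 / real m) = q"
    using assms m by (simp_all add: powr_powr eq[symmetric])
  show ?thesis
    using powr_less_mono2[OF m _ , of "x powr (1 / real m)" q]
      powr_less_mono2[of "1 / real m" x "q ^ m"] assms m by (auto simp: eq eq')
qed

text \<open>Fekete's lemma in multiplicative form, with the infimum as limit. Values may be 0, so
  powers replace logarithms: for q between \<open>L\<close> and the target, s j \<le> C q^j, and the
  roots of C tend to 1.\<close>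

lemma fekete:
  fixes s :: "nat \<Rightarrow> real"
  assumes s0: "\<And>m. 0 \<le> s m" and sm: "\<And>m n. s (m + n) \<le> s m * s n"
  obtains L where "0 \<le> L" "(\<lambda>m. s (Suc m) powr (1 / real (Suc m))) \<longlonglongrightarrow> L"
    "\<And>m. m \<ge> 1 \<Longrightarrow> L \<le> s m powr (1 / real m)"
proof -
  define X where "X = (\<lambda>m. s (Suc m) powr (1 / real (Suc m))) ` UNIV"
  define L where "L = Inf X"
  have bdd: "bdd_below X" unfolding X_def by (rule bdd_belowI[of _ 0]) auto
  have ne: "X \<noteq> {}" by (simp add: X_def)
  have L0: "0 \<le> L" unfolding L_def by (rule cInf_greatest[OF ne]) (auto simp: X_def)
  have Lm: "L \<le> s (Suc m) powr (1 / real (Suc m))" for m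
    unfolding L_def by (rule cInf_lower[OF _ bdd]) (simp add: X_def)
  have "(\<lambda>m. s (Suc m) powr (1 / real (Suc m))) \<longlonglongrightarrow> L"
  proof (rule order_tendstoI)
    fix a assume "a < L"
    then show "\<forall>\<^sub>F m in sequentially. a < s (Suc m) powr (1 / real (Suc m))"
      using Lm by (intro always_eventually allI) (meson less_le_trans)
  next
    fix a assume a: "L < a"
    define q where "q = (L + a) / 2"
    have q: "L < q" "q < a" "0 < q" using a L0 by (auto simp: q_def)
    obtain k where "s (Suc k) powr (1 / real (Suc k)) < q"
      using cInf_lessD[OF ne] q(1) unfolding L_def X_def by auto
    then have "s (Suc k) < q ^ Suc k" using powr_inverse_less_iff[of "s (Suc k)" q "Suc k"] s0 q by simp
    then obtain C where C: "C > 0" "\<And>j. s j \<le> C * q ^ j"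
      using submult_power_bound[of s "Suc k" q] s0 sm q(3) by auto
    have "(\<lambda>m. C powr (1 / real (Suc m)) * q) \<longlonglongrightarrow> C powr 0 * q"
      using C(1) by (intro tendsto_intros LIMSEQ_Suc[OF lim_1_over_n]) auto
    then have "\<forall>\<^sub>F m in sequentially. C powr (1 / real (Suc m)) * q < a"
      using q C(1) by (intro order_tendstoD(2)) auto
    then show "\<forall>\<^sub>F m in sequentially. s (Suc m) powr (1 / real (Suc m)) < a"
    proof (rule eventually_mono)
      fix m assume m: "C powr (1 / real (Suc m)) * q < a"
      have "s (Suc m) powr (1 / real (Suc m)) \<le> (C * q ^ Suc m) powr (1 / real (Suc m))"
        by (intro powr_mono2 s0 C) auto
      also have "\<dots> = C powr (1 / real (Suc m)) * q"
        using C(1) q(3) by (simp add: powr_mult powr_powr powr_realpow[symmetric] del: power_Suc)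
      finally show "s (Suc m) powr (1 / real (Suc m)) < a" using m by simp
    qed
  qed
  moreover have "L \<le> s m powr (1 / real m)" if "m \<ge> 1" for m
    using Lm[of "m - 1"] that by simp
  ultimately show ?thesis using that L0 by blast
qed

subsection \<open>Powers of sets of matrices\<close>

text \<open>Strict positivity of the bound is demanded because Hadamard products are estimated after
  division by it; for the same reason a bound a is later raised to a + 1 or to a maximum with
  1.\<close>

definition bset :: "mat set \<Rightarrow> real \<Rightarrow> bool" where
  "bset \<Sigma> M \<longleftrightarrow> 0 < M \<and> (\<forall>A\<in>\<Sigma>. bm A M)"

lemma bsetD: "bset \<Sigma> M \<Longrightarrow> A \<in> \<Sigma> \<Longrightarrow> bm A M" and bset_pos: "bset \<Sigma> M \<Longrightarrow> 0 < M"
  by (auto simp: bset_def)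

lemma set_pow_bm:
  assumes "bset \<Sigma> M" "A \<in> set_pow \<Sigma> m"
  shows "bm A (M ^ m)"
  using assms(2)
proof (induction m arbitrary: A)
  case 0
  then show ?case by (simp add: bm_id)
next
  case (Suc m)
  then show ?case by (auto intro!: bm_mult bsetD[OF assms(1)])
qed

lemma bset_set_pow: "bset \<Sigma> M \<Longrightarrow> bset (set_pow \<Sigma> m) (M ^ m)"
  by (auto simp: bset_def intro: set_pow_bm[unfolded bset_def])

lemma set_pow_1 [simp]: "set_pow \<Sigma> (Suc 0) = \<Sigma>"
  by (auto simp: mat_mult_id_right)

lemma set_pow_add:
  assumes S: "bset \<Sigma> M"
  shows "set_pow \<Sigma> (m + n) = {mat_mult B C | B C. B \<in> set_pow \<Sigma> m \<and> C \<in> set_pow \<Sigma> n}"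
proof (induction m)
  case 0
  then show ?case by (auto simp: mat_mult_id_left)
next
  case (Suc m)
  have assoc: "mat_mult (mat_mult A B) C = mat_mult A (mat_mult B C)"
    if "A \<in> \<Sigma>" "B \<in> set_pow \<Sigma> m" "C \<in> set_pow \<Sigma> n" for A B C
    by (rule mat_mult_assoc[OF bsetD[OF S that(1)] set_pow_bm[OF S that(2)] set_pow_bm[OF S that(3)]])
  have "set_pow \<Sigma> (Suc m + n) = {mat_mult A X | A X. A \<in> \<Sigma> \<and> X \<in> set_pow \<Sigma> (m + n)}" by simp
  also have "\<dots> = {mat_mult B C | B C. B \<in> set_pow \<Sigma> (Suc m) \<and> C \<in> set_pow \<Sigma> n}"
    unfolding Suc
  proof (intro set_eqI iffI; clarsimp)
    fix A B C assume *: "A \<in> \<Sigma>" "B \<in> set_pow \<Sigma> m" "C \<in> set_pow \<Sigma> n"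
    then show "\<exists>B' C'. mat_mult A (mat_mult B C) = mat_mult B' C' \<and>
        (\<exists>A B. B' = mat_mult A B \<and> A \<in> \<Sigma> \<and> B \<in> set_pow \<Sigma> m) \<and> C' \<in> set_pow \<Sigma> n"
      using assoc[OF *] by metis
  next
    fix A B C assume *: "A \<in> \<Sigma>" "B \<in> set_pow \<Sigma> m" "C \<in> set_pow \<Sigma> n"
    then show "\<exists>A' X. mat_mult (mat_mult A B) C = mat_mult A' X \<and> A' \<in> \<Sigma> \<and>
        (\<exists>B C. X = mat_mult B C \<and> B \<in> set_pow \<Sigma> m \<and> C \<in> set_pow \<Sigma> n)"
      using assoc[OF *] by metis
  qed
  finally show ?case .
qed

lemma set_pow_mult:
  assumes S: "bset \<Sigma> M"
  shows "set_pow (set_pow \<Sigma> p) m = set_pow \<Sigma> (p * m)"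
proof (induction m)
  case (Suc m)
  then show ?case using set_pow_add[OF S, of p "p * m"] by simp
qed simp

definition gsup :: "mat set \<Rightarrow> nat \<Rightarrow> real" where
  "gsup \<Sigma> m = Sup (insert 0 (ess ` set_pow \<Sigma> m))"

lemma gsup_bdd:
  assumes "bset \<Sigma> M" shows "bdd_above (insert 0 (ess ` set_pow \<Sigma> m))"
proof (rule bdd_aboveI[of _ "M ^ m"])
  fix x assume "x \<in> insert 0 (ess ` set_pow \<Sigma> m)"
  then show "x \<le> M ^ m" using bset_pos[OF assms] set_pow_bm[OF assms] ess_le_bound by auto
qed

lemma gsup_nonneg: "bset \<Sigma> M \<Longrightarrow> 0 \<le> gsup \<Sigma> m"
  unfolding gsup_def by (rule cSup_upper[OF _ gsup_bdd]) auto

lemma ess_le_gsup: "bset \<Sigma> M \<Longrightarrow> A \<in> set_pow \<Sigma> m \<Longrightarrow> ess A \<le> gsup \<Sigma> m"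
  unfolding gsup_def by (rule cSup_upper[OF _ gsup_bdd]) auto

lemma gsup_leI: "0 \<le> c \<Longrightarrow> (\<And>A. A \<in> set_pow \<Sigma> m \<Longrightarrow> ess A \<le> c) \<Longrightarrow> gsup \<Sigma> m \<le> c"
  unfolding gsup_def by (rule cSup_least) auto

lemma gsup_submult:
  assumes S: "bset \<Sigma> M" shows "gsup \<Sigma> (m + n) \<le> gsup \<Sigma> m * gsup \<Sigma> n"
proof (rule gsup_leI)
  show "0 \<le> gsup \<Sigma> m * gsup \<Sigma> n" by (intro mult_nonneg_nonneg gsup_nonneg[OF S])
  fix A assume "A \<in> set_pow \<Sigma> (m + n)"
  then obtain B C where A: "A = mat_mult B C" and B: "B \<in> set_pow \<Sigma> m" and C: "C \<in> set_pow \<Sigma> n"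
    unfolding set_pow_add[OF S] by auto
  have "ess A \<le> ess B * ess C" unfolding A by (rule ess_mult[OF set_pow_bm[OF S B] set_pow_bm[OF S C]])
  also have "\<dots> \<le> gsup \<Sigma> m * gsup \<Sigma> n"
    by (intro mult_mono ess_le_gsup[OF S] B C gsup_nonneg[OF S] ess_nonneg[OF set_pow_bm[OF S C]])
  finally show "ess A \<le> gsup \<Sigma> m * gsup \<Sigma> n" .
qed

text \<open>\<open>lim\<close> merely describes the limit; existence comes from Fekete's lemma after
  \<open>gamma\<close> has been replaced by \<open>ess\<close> on every power.\<close>

lemma hat_props:
  assumes S: "bset \<Sigma> M"
  shows hat_nonneg: "0 \<le> ess_rad_hat \<Sigma>"
    and hat_tendsto: "(\<lambda>m. gsup \<Sigma> (Suc m) powr (1 / real (Suc m))) \<longlonglongrightarrow> ess_rad_hat \<Sigma>"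
    and hat_le: "\<And>m. m \<ge> 1 \<Longrightarrow> ess_rad_hat \<Sigma> \<le> gsup \<Sigma> m powr (1 / real m)"
proof -
  obtain L where L: "0 \<le> L" "(\<lambda>m. gsup \<Sigma> (Suc m) powr (1 / real (Suc m))) \<longlonglongrightarrow> L"
    "\<And>m. m \<ge> 1 \<Longrightarrow> L \<le> gsup \<Sigma> m powr (1 / real m)"
    using fekete[of "gsup \<Sigma>"] gsup_nonneg[OF S] gsup_submult[OF S] by blast
  have "gamma ` set_pow \<Sigma> m = ess ` set_pow \<Sigma> m" for m
    by (intro image_cong refl) (rule gamma_eq_ess[OF set_pow_bm[OF S]])
  then have "ess_rad_hat \<Sigma> = lim (\<lambda>m. gsup \<Sigma> (Suc m) powr (1 / real (Suc m)))"
    by (simp only: ess_rad_hat_def gsup_def)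
  then have "ess_rad_hat \<Sigma> = L" using limI[OF L(2)] by simp
  with L show "0 \<le> ess_rad_hat \<Sigma>"
    "(\<lambda>m. gsup \<Sigma> (Suc m) powr (1 / real (Suc m))) \<longlonglongrightarrow> ess_rad_hat \<Sigma>"
    "\<And>m. m \<ge> 1 \<Longrightarrow> ess_rad_hat \<Sigma> \<le> gsup \<Sigma> m powr (1 / real m)" by auto
qed

lemma hat_lessD:
  assumes S: "bset \<Sigma> M" and "ess_rad_hat \<Sigma> < q"
  obtains m where "m \<ge> 1" "gsup \<Sigma> m < q ^ m"
proof -
  have q: "0 < q" using hat_nonneg[OF S] assms(2) by linarith
  have "\<forall>\<^sub>F m in sequentially. gsup \<Sigma> (Suc m) powr (1 / real (Suc m)) < q"
    by (rule order_tendstoD(2)[OF hat_tendsto[OF S] assms(2)])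
  then obtain m where "gsup \<Sigma> (Suc m) powr (1 / real (Suc m)) < q"
    by (auto simp: eventually_sequentially)
  then have "gsup \<Sigma> (Suc m) < q ^ Suc m"
    using powr_inverse_less_iff[of "gsup \<Sigma> (Suc m)" q "Suc m"] gsup_nonneg[OF S] q by simp
  then show ?thesis by (intro that[of "Suc m"]) auto
qed

lemma hat_pow_le:
  assumes S: "bset \<Sigma> M" and m: "m \<ge> 1"
  shows "ess_rad_hat \<Sigma> ^ m \<le> gsup \<Sigma> m"
proof (cases "ess_rad_hat \<Sigma> = 0")
  case True
  then show ?thesis using gsup_nonneg[OF S] m by (simp add: power_0_left)
next
  case False
  then have "0 < ess_rad_hat \<Sigma>" using hat_nonneg[OF S] by simp
  then show ?thesis
    using powr_inverse_less_iff[of "gsup \<Sigma> m" "ess_rad_hat \<Sigma>" m] gsup_nonneg[OF S] m hat_le[OF S m]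
    by fastforce
qed

lemma powr_inverse_mult_power:
  fixes x :: real
  assumes "0 \<le> x" "p \<ge> 1"
  shows "(x powr (1 / real (p * m))) ^ p = x powr (1 / real m)"
proof (cases "x = 0")
  case False
  then show ?thesis using assms by (simp add: powr_realpow[symmetric] powr_powr)
qed (use assms in auto)

lemma hat_set_pow:
  assumes S: "bset \<Sigma> M" and p: "p \<ge> 1"
  shows "ess_rad_hat (set_pow \<Sigma> p) = ess_rad_hat \<Sigma> ^ p"
proof (rule LIMSEQ_unique)
  show "(\<lambda>m. gsup (set_pow \<Sigma> p) (Suc m) powr (1 / real (Suc m))) \<longlonglongrightarrow> ess_rad_hat (set_pow \<Sigma> p)"
    by (rule hat_tendsto[OF bset_set_pow[OF S]])
  \<comment> \<open>The sequence in the definition starts with exponent 1 at position 0, so exponent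
    p * Suc m stands at position p * Suc m - 1.\<close>
  define f where "f m = p * Suc m - 1" for m
  have f: "Suc (f m) = p * Suc m" for m using p by (simp add: f_def)
  have "strict_mono f" using p by (intro strict_monoI) (simp add: f_def diff_less_mono)
  from LIMSEQ_subseq_LIMSEQ[OF hat_tendsto[OF S] this]
  have "(\<lambda>m. (gsup \<Sigma> (p * Suc m) powr (1 / real (p * Suc m))) ^ p) \<longlonglongrightarrow> ess_rad_hat \<Sigma> ^ p"
    unfolding o_def f by (rule tendsto_power)
  then show "(\<lambda>m. gsup (set_pow \<Sigma> p) (Suc m) powr (1 / real (Suc m))) \<longlonglongrightarrow> ess_rad_hat \<Sigma> ^ p"
    by (simp only: powr_inverse_mult_power[OF gsup_nonneg[OF S] p]) (simp only: gsup_def set_pow_mult[OF S])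
qed

definition dominated :: "mat set \<Rightarrow> mat set \<Rightarrow> bool" where
  "dominated \<Sigma> \<Sigma>' \<longleftrightarrow> (\<forall>A\<in>\<Sigma>. \<exists>B\<in>\<Sigma>'. \<forall>i j. A i j \<le> B i j)"

lemma dominated_set_pow:
  assumes S: "bset \<Sigma> M" and S': "bset \<Sigma>' M'" and d: "dominated \<Sigma> \<Sigma>'"
  shows "dominated (set_pow \<Sigma> m) (set_pow \<Sigma>' m)"
proof (induction m)
  case 0
  then show ?case by (simp add: dominated_def)
next
  case (Suc m)
  show ?case unfolding dominated_def
  proof
    fix X assume "X \<in> set_pow \<Sigma> (Suc m)"
    then obtain A B where X: "X = mat_mult A B" and A: "A \<in> \<Sigma>" and B: "B \<in> set_pow \<Sigma> m" by auto
    obtain A' where A': "A' \<in> \<Sigma>'" "\<And>i j. A i j \<le> A' i j" using d A unfolding dominated_def by blast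
    obtain B' where B': "B' \<in> set_pow \<Sigma>' m" "\<And>i j. B i j \<le> B' i j" using Suc B unfolding dominated_def by blast
    have "mat_mult A B i j \<le> mat_mult A' B' i j" for i j
      by (rule mat_mult_mono[OF bsetD[OF S' A'(1)] set_pow_bm[OF S' B'(1)] bsetD[OF S A] set_pow_bm[OF S B] A'(2) B'(2)])
    then show "\<exists>B\<in>set_pow \<Sigma>' (Suc m). \<forall>i j. X i j \<le> B i j" using X A'(1) B'(1) by auto
  qed
qed

lemma hat_mono:
  assumes S: "bset \<Sigma> M" and S': "bset \<Sigma>' M'" and d: "dominated \<Sigma> \<Sigma>'"
  shows "ess_rad_hat \<Sigma> \<le> ess_rad_hat \<Sigma>'"
proof (rule LIMSEQ_le[OF hat_tendsto[OF S] hat_tendsto[OF S']], intro exI allI impI)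
  fix m
  have "gsup \<Sigma> (Suc m) \<le> gsup \<Sigma>' (Suc m)"
  proof (rule gsup_leI[OF gsup_nonneg[OF S']])
    fix A assume A: "A \<in> set_pow \<Sigma> (Suc m)"
    then obtain B where B: "B \<in> set_pow \<Sigma>' (Suc m)" "\<And>i j. A i j \<le> B i j"
      using dominated_set_pow[OF S S' d, of "Suc m"] unfolding dominated_def by blast
    have "ess A \<le> ess B" by (rule ess_mono[OF set_pow_bm[OF S A] set_pow_bm[OF S' B(1)] B(2)])
    also have "\<dots> \<le> gsup \<Sigma>' (Suc m)" by (rule ess_le_gsup[OF S' B(1)])
    finally show "ess A \<le> gsup \<Sigma>' (Suc m)" .
  qed
  then show "gsup \<Sigma> (Suc m) powr (1 / real (Suc m)) \<le> gsup \<Sigma>' (Suc m) powr (1 / real (Suc m))"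
    by (intro powr_mono2 gsup_nonneg[OF S]) auto
qed

subsection \<open>Hadamard products of powers\<close>

text \<open>The power with value 1 at exponent 0 also for base 0, where \<open>powr\<close> gives 0.
  This is the convention of the omitted factor, and it lets monotonicity, multiplicativity and
  continuity in the base hold uniformly for exponents \<ge> 0.\<close>

definition pw :: "real \<Rightarrow> real \<Rightarrow> real" where
  "pw x t = (if t = 0 then 1 else x powr t)"

lemma pw_nonneg [simp]: "0 \<le> pw x t" by (simp add: pw_def)

lemma pw_mono: "0 \<le> x \<Longrightarrow> x \<le> y \<Longrightarrow> 0 \<le> t \<Longrightarrow> pw x t \<le> pw y t"
  by (simp add: pw_def powr_mono2)

lemma pw_mult: "0 \<le> x \<Longrightarrow> 0 \<le> y \<Longrightarrow> pw (x * y) t = pw x t * pw y t"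
  by (simp add: pw_def powr_mult)

lemma pw_pos: "0 < x \<Longrightarrow> pw x t = x powr t"
  by (simp add: pw_def)

lemma pw_powr: "0 \<le> x \<Longrightarrow> pw x t powr u = pw (x powr u) t"
  by (simp add: pw_def powr_powr mult.commute)

lemma pw_add: "0 \<le> x \<Longrightarrow> 0 < s + t \<Longrightarrow> pw x s * pw x t = x powr (s + t)"
  by (simp add: pw_def powr_add)

lemma tendsto_pw:
  assumes "(f \<longlongrightarrow> a) F" "\<And>x. 0 \<le> f x" "0 \<le> t"
  shows "((\<lambda>x. pw (f x) t) \<longlongrightarrow> pw a t) F"
  using assms by (cases "t = 0") (auto simp: pw_def intro!: tendsto_powr')

lemma pw_young:
  assumes x: "0 \<le> x" "x \<le> 1" and y: "0 \<le> y" "y \<le> 1"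
    and ab: "0 \<le> \<alpha>" "0 \<le> \<beta>" "1 \<le> \<alpha> + \<beta>"
  shows "pw x \<alpha> * pw y \<beta> \<le> \<alpha> / (\<alpha> + \<beta>) * x + \<beta> / (\<alpha> + \<beta>) * y"
proof -
  define s where "s = \<alpha> + \<beta>"
  have s: "1 \<le> s" "s > 0" using ab by (auto simp: s_def)
  \<comment> \<open>For bases at most 1 the smaller exponent t / s gives the larger power.\<close>
  have le: "pw u t \<le> pw u (t / s)" if "0 \<le> u" "u \<le> 1" "0 \<le> t" for u t
  proof (cases "t = 0 \<or> u = 0")
    case False
    have "t / s \<le> t" using s that(3) by (simp add: divide_le_eq_1 divide_le_eq mult_le_cancel_left1)
    then show ?thesis using that False s by (auto simp: pw_def intro!: powr_mono')
  qed (use s in \<open>auto simp: pw_def\<close>)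
  have sum1: "\<alpha> / s + \<beta> / s = 1" using s by (simp add: s_def add_divide_distrib[symmetric])
  have "pw x \<alpha> * pw y \<beta> \<le> pw x (\<alpha> / s) * pw y (\<beta> / s)"
    by (intro mult_mono le x y ab) auto
  also have "\<dots> \<le> \<alpha> / s * x + \<beta> / s * y"
  proof -
    consider "\<alpha> = 0" | "\<beta> = 0" | "\<alpha> > 0" "\<beta> > 0" "x = 0 \<or> y = 0" | "x > 0" "y > 0"
      using ab x y by linarith
    then show ?thesis
    proof cases
      case 1
      then show ?thesis using sum1 y by (simp add: pw_def)
    next
      case 2
      then show ?thesis using sum1 x by (simp add: pw_def)
    next
      case 3
      then have "pw x (\<alpha> / s) * pw y (\<beta> / s) = 0" using s by (auto simp: pw_def)
      then show ?thesis using ab x y s by (metis add_nonneg_nonneg divide_nonneg_pos mult_nonneg_nonneg)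
    next
      case 4
      then show ?thesis using Youngs_inequality_0[of "\<alpha> / s" "\<beta> / s" x y] ab s sum1 by (simp add: pw_pos)
    qed
  qed
  finally show ?thesis by (simp add: s_def)
qed

text \<open>After division by the two sums every term is at most 1, so Young's inequality applies
  term by term, and the resulting bounds add up to at most \<alpha>/s + \<beta>/s = 1.\<close>

lemma pw_holder:
  fixes f g :: "nat \<Rightarrow> real"
  assumes f: "summable f" "\<And>k. 0 \<le> f k" and g: "summable g" "\<And>k. 0 \<le> g k"
    and ab: "0 \<le> \<alpha>" "0 \<le> \<beta>" "1 \<le> \<alpha> + \<beta>"
    and sm: "summable (\<lambda>k. pw (f k) \<alpha> * pw (g k) \<beta>)"
  shows "(\<Sum>k. pw (f k) \<alpha> * pw (g k) \<beta>) \<le> pw (suminf f) \<alpha> * pw (suminf g) \<beta>"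
proof (cases "(\<alpha> > 0 \<and> suminf f = 0) \<or> (\<beta> > 0 \<and> suminf g = 0)")
  case True
  have "pw (f k) \<alpha> * pw (g k) \<beta> = 0" for k
    using True suminf_eq_zero_iff[OF f(1)] suminf_eq_zero_iff[OF g(1)] f(2) g(2) by (auto simp: pw_def)
  then show ?thesis by (simp only: suminf_zero) simp
next
  case False
  define s where "s = \<alpha> + \<beta>"
  have s: "1 \<le> s" "s > 0" using ab by (auto simp: s_def)
  \<comment> \<open>A sum that is 0 in this case has exponent 0; replacing it by 1 then changes
    nothing and permits the division.\<close>
  define a where "a = (if suminf f = 0 then 1 else suminf f)"
  define b where "b = (if suminf g = 0 then 1 else suminf g)"
  have f0: "0 \<le> suminf f" and g0: "0 \<le> suminf g" by (intro suminf_nonneg f g)+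
  have a: "a > 0" "suminf f \<le> a" and b: "b > 0" "suminf g \<le> b" using f0 g0 by (auto simp: a_def b_def)
  have fk: "f k \<le> a" and gk: "g k \<le> b" for k
  proof -
    have "f k \<le> suminf f" "g k \<le> suminf g"
      using sum_le_suminf[OF f(1), of "{k}"] sum_le_suminf[OF g(1), of "{k}"] f(2) g(2) by auto
    then show "f k \<le> a" "g k \<le> b" using a b by auto
  qed
  have pa: "pw (suminf f) \<alpha> = pw a \<alpha>" and pb: "pw (suminf g) \<beta> = pw b \<beta>"
    using False ab by (auto simp: pw_def a_def b_def)
  have fg_le: "pw (f k) \<alpha> * pw (g k) \<beta> \<le> pw a \<alpha> * pw b \<beta> * (\<alpha> / s * (f k / a) + \<beta> / s * (g k / b))" for k
  proof -
    have "pw (f k) \<alpha> * pw (g k) \<beta> = pw (a * (f k / a)) \<alpha> * pw (b * (g k / b)) \<beta>"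
      using a b by simp
    also have "\<dots> = pw a \<alpha> * pw b \<beta> * (pw (f k / a) \<alpha> * pw (g k / b) \<beta>)"
      using a b f(2)[of k] g(2)[of k] by (subst (1 2) pw_mult) auto
    also have "\<dots> \<le> pw a \<alpha> * pw b \<beta> * (\<alpha> / s * (f k / a) + \<beta> / s * (g k / b))"
      unfolding s_def using a b f(2)[of k] g(2)[of k] fk[of k] gk[of k]
      by (intro mult_left_mono pw_young ab) auto
    finally show ?thesis .
  qed
  have sf: "summable (\<lambda>k. \<alpha> / s * (f k / a))" and sg: "summable (\<lambda>k. \<beta> / s * (g k / b))"
    by (intro summable_mult summable_divide f g)+
  have "(\<Sum>k. pw (f k) \<alpha> * pw (g k) \<beta>)
      \<le> (\<Sum>k. pw a \<alpha> * pw b \<beta> * (\<alpha> / s * (f k / a) + \<beta> / s * (g k / b)))"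
    by (intro suminf_le fg_le sm summable_mult summable_add sf sg)
  also have "\<dots> = pw a \<alpha> * pw b \<beta> * (\<alpha> / s * (suminf f / a) + \<beta> / s * (suminf g / b))"
  proof -
    have "(\<Sum>k. \<alpha> / s * (f k / a)) = \<alpha> / s * (suminf f / a)"
      using suminf_mult[OF summable_divide[OF f(1), of a], of "\<alpha> / s"] suminf_divide[OF f(1), of a] by simp
    moreover have "(\<Sum>k. \<beta> / s * (g k / b)) = \<beta> / s * (suminf g / b)"
      using suminf_mult[OF summable_divide[OF g(1), of b], of "\<beta> / s"] suminf_divide[OF g(1), of b] by simp
    ultimately show ?thesis
      by (simp only: suminf_mult[OF summable_add[OF sf sg]] suminf_add[OF sf sg, symmetric])
  qed
  also have "\<dots> \<le> pw a \<alpha> * pw b \<beta> * (\<alpha> / s * 1 + \<beta> / s * 1)"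
    using a b s ab by (intro mult_left_mono add_mono) auto
  also have "\<alpha> / s * 1 + \<beta> / s * 1 = 1" using s by (simp add: s_def add_divide_distrib[symmetric])
  finally show ?thesis by (simp add: pa pb)
qed

lemma bm_entry_le:
  assumes "bm A a" shows "A i j \<le> a"
  using norm_co_le[of "matop A (unt j (1::real))" i] norm_matop_le[OF assms, of "unt j (1::real)"]
    mult_left_mono[OF norm_unt[of j "1::real"] bm_bound_nonneg[OF assms]] bm_nonneg[OF assms, of i j]
  by (simp add: co_matop_unt[OF assms])

section \<open>Bounds for Hadamard products and for their matrix products\<close>

locale exponents =
  fixes \<alpha> \<beta> :: real
  assumes \<alpha>_nonneg: "0 \<le> \<alpha>" and \<beta>_nonneg: "0 \<le> \<beta>" and sum_ge_1: "1 \<le> \<alpha> + \<beta>"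
begin

definition had :: "mat \<Rightarrow> mat \<Rightarrow> mat" where
  "had A B = hprod (hpow A \<alpha>) (hpow (mat_transpose B) \<beta>)"

lemma had_entry: "had A B i j = pw (A i j) \<alpha> * pw (B j i) \<beta>"
  by (simp add: had_def hprod_def hpow_def mat_transpose_def pw_def)

text \<open>Dividing by the bounds makes all entries at most 1, where exponents of sum at least 1 may be
  lowered to exponents of sum 1, so that Young's inequality applies entry by entry.\<close>
lemma bm_had:
  assumes A: "bm A a" and B: "bm B b" and pos: "a > 0" "b > 0"
  shows "bm (had A B) (pw a \<alpha> * pw b \<beta>)"
proof -
  define s where "s = \<alpha> + \<beta>"
  define c where "c = pw a \<alpha> * pw b \<beta>"
  have s: "s > 0" using sum_ge_1 by (simp add: s_def)
  have c: "0 \<le> c" by (simp add: c_def)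
  define D where "D = (\<lambda>i j. c * (\<alpha> / s / a * A i j + \<beta> / s / b * mat_transpose B i j))"
  have "bm D (c * (\<alpha> / s / a * a + \<beta> / s / b * b))"
    unfolding D_def
    by (intro bm_scale bm_add A bm_transpose[OF B] c) (use pos s \<alpha>_nonneg \<beta>_nonneg in auto)
  moreover have "\<alpha> / s / a * a + \<beta> / s / b * b = 1"
    using pos s by (simp add: s_def add_divide_distrib[symmetric])
  ultimately have D: "bm D c" by simp
  have "had A B i j \<le> D i j" for i j
  proof -
    have "had A B i j = pw (a * (A i j / a)) \<alpha> * pw (b * (B j i / b)) \<beta>"
      using pos by (simp add: had_entry)
    also have "\<dots> = c * (pw (A i j / a) \<alpha> * pw (B j i / b) \<beta>)"
      unfolding c_def using pos bm_nonneg[OF A, of i j] bm_nonneg[OF B, of j i]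
      by (subst (1 2) pw_mult) auto
    also have "\<dots> \<le> c * (\<alpha> / s * (A i j / a) + \<beta> / s * (B j i / b))"
      unfolding s_def
      using pos bm_nonneg[OF A, of i j] bm_nonneg[OF B, of j i] bm_entry_le[OF A, of i j] bm_entry_le[OF B, of j i]
      by (intro mult_left_mono pw_young c \<alpha>_nonneg \<beta>_nonneg sum_ge_1) auto
    finally show ?thesis by (simp add: D_def mat_transpose_def)
  qed
  then show ?thesis
    using bm_mono[OF D, of "had A B" c] by (simp add: c_def had_entry)
qed

lemma bm_had_ex:
  assumes A: "bm A a" and B: "bm B b"
  shows "bm (had A B) (pw (a + 1) \<alpha> * pw (b + 1) \<beta>)"
proof (rule bm_had)
  show "bm A (a + 1)" by (rule bm_weaken[OF A]) simp
  show "bm B (b + 1)" by (rule bm_weaken[OF B]) simp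
qed (use bm_bound_nonneg[OF A] bm_bound_nonneg[OF B] in auto)

lemma trunc_had: "trunc n (had A B) = had (trunc n A) (trunc n B)"
proof (intro ext)
  fix i j
  \<comment> \<open>Off the corner both truncated entries are 0. One positive exponent makes their
    product 0; with both exponents 0 it would be 1.\<close>
  have "\<alpha> > 0 \<or> \<beta> > 0" using \<alpha>_nonneg \<beta>_nonneg sum_ge_1 by linarith
  then show "trunc n (had A B) i j = had (trunc n A) (trunc n B) i j"
    by (auto simp: trunc_def had_entry pw_def)
qed

text \<open>The bounds \<open>ess A + e k\<close> are strictly positive even when
  \<open>ess A\<close> is 0, as the division by them requires; continuity of \<open>pw\<close> then
  removes \<open>e k\<close>.\<close>

lemma ess_had:
  assumes A: "bm A a" and B: "bm B b"
  shows "ess (had A B) \<le> pw (ess A) \<alpha> * pw (ess B) \<beta>"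
proof (rule LIMSEQ_le_const)
  define e where "e k = 1 / real (Suc k)" for k
  have e: "e \<longlonglongrightarrow> 0" "\<And>k. e k > 0" unfolding e_def by (rule LIMSEQ_Suc[OF lim_1_over_n], simp)
  have "(\<lambda>k. ess A + e k) \<longlonglongrightarrow> ess A + 0" "(\<lambda>k. ess B + e k) \<longlonglongrightarrow> ess B + 0"
    by (intro tendsto_intros e)+
  then show "(\<lambda>k. pw (ess A + e k) \<alpha> * pw (ess B + e k) \<beta>) \<longlonglongrightarrow> pw (ess A) \<alpha> * pw (ess B) \<beta>"
    using ess_nonneg[OF A] ess_nonneg[OF B] e(2)
    by (intro tendsto_mult tendsto_pw \<alpha>_nonneg \<beta>_nonneg) (auto intro: add_nonneg_nonneg less_imp_le)
  show "\<exists>N. \<forall>k\<ge>N. ess (had A B) \<le> pw (ess A + e k) \<alpha> * pw (ess B + e k) \<beta>"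
  proof (intro exI allI impI)
    fix k
    have "ess A < ess A + e k" "ess B < ess B + e k" using e(2) by auto
    then obtain n m where n: "bm (trunc n A) (ess A + e k)" and m: "bm (trunc m B) (ess B + e k)"
      by (metis ess_lessD[OF A] ess_lessD[OF B])
    have "bm (trunc (max n m) (had A B)) (pw (ess A + e k) \<alpha> * pw (ess B + e k) \<beta>)"
      unfolding trunc_had
      by (intro bm_had bm_trunc_mono[OF n] bm_trunc_mono[OF m] add_nonneg_pos ess_nonneg[OF A] ess_nonneg[OF B] e) auto
    then show "ess (had A B) \<le> pw (ess A + e k) \<alpha> * pw (ess B + e k) \<beta>" by (rule ess_le)
  qed
qed

text \<open>Entry (i, j) of the left side is the sum over k of (A1 i k A2 k j)^\<alpha> (B2 j k B1 k
  i)^\<beta>, to which Hoelder's inequality applies. Since B enters transposed, its factors come out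
  in reversed order. Convergence of the sum is that of a product of bounded matrices.\<close>

lemma had_mult_le:
  assumes A1: "bm A1 a1" and B1: "bm B1 b1" and A2: "bm A2 a2" and B2: "bm B2 b2"
  shows "mat_mult (had A1 B1) (had A2 B2) i j \<le> had (mat_mult A1 A2) (mat_mult B2 B1) i j"
proof -
  have eq: "had A1 B1 i k * had A2 B2 k j = pw (A1 i k * A2 k j) \<alpha> * pw (B2 j k * B1 k i) \<beta>" for k
    unfolding had_entry
    by (subst (1 2) pw_mult) (auto simp: bm_nonneg[OF A1] bm_nonneg[OF A2] bm_nonneg[OF B1] bm_nonneg[OF B2])
  have "summable (\<lambda>k. had A1 B1 i k * had A2 B2 k j)"
    by (rule mat_mult_summable[OF bm_had_ex[OF A1 B1] bm_had_ex[OF A2 B2]])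
  then show ?thesis
    unfolding had_entry[of "mat_mult A1 A2"] unfolding mat_mult_def eq
    by (intro pw_holder mat_mult_summable[OF A1 A2] mat_mult_summable[OF B2 B1] \<alpha>_nonneg \<beta>_nonneg sum_ge_1
        mult_nonneg_nonneg bm_nonneg[OF A1] bm_nonneg[OF A2] bm_nonneg[OF B1] bm_nonneg[OF B2])
qed

text \<open>Two independent families: equal ones give \<open>S_ab\<close>, while the singletons
  \<open>{A}\<close> and \<open>{B}\<close> give the single matrix \<open>had A B\<close>, whose
  radius is needed for the joint spectral radius.\<close>

definition S2 :: "mat set \<Rightarrow> mat set \<Rightarrow> mat set" where
  "S2 \<Phi> \<Phi>' = {had A B | A B. A \<in> \<Phi> \<and> B \<in> \<Phi>'}"

lemma S_ab_eq_S2: "S_ab \<alpha> \<beta> \<Phi> = S2 \<Phi> \<Phi>"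
  by (simp add: S_ab_def S2_def had_def)

lemma bset_S2:
  assumes "bset \<Phi> M" "bset \<Phi>' M'"
  shows "bset (S2 \<Phi> \<Phi>') (pw M \<alpha> * pw M' \<beta>)"
proof -
  have "bm (had A B) (pw M \<alpha> * pw M' \<beta>)" if "A \<in> \<Phi>" "B \<in> \<Phi>'" for A B
    using that assms by (intro bm_had) (simp_all add: bset_def)
  moreover have "0 < pw M \<alpha> * pw M' \<beta>" using assms by (simp add: bset_def pw_def)
  ultimately show ?thesis unfolding bset_def S2_def by blast
qed

lemma S2_set_pow_dominated:
  assumes P: "bset \<Phi> M" and P': "bset \<Phi>' M'" and m: "m \<ge> 1"
  shows "dominated (set_pow (S2 \<Phi> \<Phi>') m) (S2 (set_pow \<Phi> m) (set_pow \<Phi>' m))"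
  using m
proof (induction m rule: nat_induct_at_least)
  case base
  show ?case unfolding One_nat_def set_pow_1 by (auto simp: dominated_def)
next
  case (Suc m)
  show ?case unfolding dominated_def
  proof
    fix X assume "X \<in> set_pow (S2 \<Phi> \<Phi>') (Suc m)"
    then obtain A1 B1 Y where X: "X = mat_mult (had A1 B1) Y" and A1: "A1 \<in> \<Phi>" and B1: "B1 \<in> \<Phi>'"
      and Y: "Y \<in> set_pow (S2 \<Phi> \<Phi>') m" unfolding S2_def by auto
    obtain A2 B2 where A2: "A2 \<in> set_pow \<Phi> m" and B2: "B2 \<in> set_pow \<Phi>' m"
      and le: "\<And>i j. Y i j \<le> had A2 B2 i j"
      using Suc.IH Y unfolding dominated_def S2_def by blast
    note bs = bsetD[OF P A1] bsetD[OF P' B1] set_pow_bm[OF P A2] set_pow_bm[OF P' B2]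
    have bmY: "bm Y ((pw M \<alpha> * pw M' \<beta>) ^ m)" by (rule set_pow_bm[OF bset_S2[OF P P'] Y])
    have "X i j \<le> had (mat_mult A1 A2) (mat_mult B2 B1) i j" for i j
    proof -
      have "X i j \<le> mat_mult (had A1 B1) (had A2 B2) i j"
        unfolding X by (rule mat_mult_mono[OF bm_had_ex[OF bs(1,2)] bm_had_ex[OF bs(3,4)]
              bm_had_ex[OF bs(1,2)] bmY order_refl le])
      also have "\<dots> \<le> had (mat_mult A1 A2) (mat_mult B2 B1) i j" by (rule had_mult_le[OF bs])
      finally show ?thesis .
    qed
    moreover have "mat_mult A1 A2 \<in> set_pow \<Phi> (Suc m)" using A1 A2 by auto
    \<comment> \<open>The new factor \<open>B1\<close> arrives on the right, whereas
      \<open>set_pow\<close> prepends on the left, so the power is split as m + 1.\<close>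
    moreover have "mat_mult B2 B1 \<in> set_pow \<Phi>' (Suc m)"
      using set_pow_add[OF P', of m "Suc 0"] B1 B2 unfolding set_pow_1 by auto
    ultimately have "had (mat_mult A1 A2) (mat_mult B2 B1) \<in> S2 (set_pow \<Phi> (Suc m)) (set_pow \<Phi>' (Suc m))"
      "\<forall>i j. X i j \<le> had (mat_mult A1 A2) (mat_mult B2 B1) i j"
      unfolding S2_def by blast+
    then show "\<exists>B\<in>S2 (set_pow \<Phi> (Suc m)) (set_pow \<Phi>' (Suc m)). \<forall>i j. X i j \<le> B i j"
      by (intro bexI)
  qed
qed

lemma hat_S2_le:
  assumes P: "bset \<Phi> M" and P': "bset \<Phi>' M'"
  shows "ess_rad_hat (S2 \<Phi> \<Phi>') \<le> pw (ess_rad_hat \<Phi>) \<alpha> * pw (ess_rad_hat \<Phi>') \<beta>"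
proof (rule LIMSEQ_le[OF hat_tendsto[OF bset_S2[OF P P']]])
  show "(\<lambda>m. pw (gsup \<Phi> (Suc m) powr (1 / real (Suc m))) \<alpha> * pw (gsup \<Phi>' (Suc m) powr (1 / real (Suc m))) \<beta>)
      \<longlonglongrightarrow> pw (ess_rad_hat \<Phi>) \<alpha> * pw (ess_rad_hat \<Phi>') \<beta>"
    by (intro tendsto_mult tendsto_pw hat_tendsto[OF P] hat_tendsto[OF P'] \<alpha>_nonneg \<beta>_nonneg) auto
  show "\<exists>N. \<forall>m\<ge>N. gsup (S2 \<Phi> \<Phi>') (Suc m) powr (1 / real (Suc m))
      \<le> pw (gsup \<Phi> (Suc m) powr (1 / real (Suc m))) \<alpha> * pw (gsup \<Phi>' (Suc m) powr (1 / real (Suc m))) \<beta>"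
  proof (intro exI allI impI)
    fix m
    have "gsup (S2 \<Phi> \<Phi>') (Suc m) \<le> pw (gsup \<Phi> (Suc m)) \<alpha> * pw (gsup \<Phi>' (Suc m)) \<beta>"
    proof (rule gsup_leI)
      fix X assume X: "X \<in> set_pow (S2 \<Phi> \<Phi>') (Suc m)"
      then obtain A B where A: "A \<in> set_pow \<Phi> (Suc m)" and B: "B \<in> set_pow \<Phi>' (Suc m)"
        and le: "\<And>i j. X i j \<le> had A B i j"
        using S2_set_pow_dominated[OF P P', of "Suc m"] unfolding dominated_def S2_def by fastforce
      note bs = set_pow_bm[OF P A] set_pow_bm[OF P' B]
      have "ess X \<le> ess (had A B)"
        by (rule ess_mono[OF set_pow_bm[OF bset_S2[OF P P'] X] bm_had_ex[OF bs] le])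
      also have "\<dots> \<le> pw (ess A) \<alpha> * pw (ess B) \<beta>" by (rule ess_had[OF bs])
      also have "\<dots> \<le> pw (gsup \<Phi> (Suc m)) \<alpha> * pw (gsup \<Phi>' (Suc m)) \<beta>"
        by (intro mult_mono pw_mono ess_le_gsup[OF P A] ess_le_gsup[OF P' B] ess_nonneg[OF bs(1)]
            ess_nonneg[OF bs(2)] \<alpha>_nonneg \<beta>_nonneg) auto
      finally show "ess X \<le> pw (gsup \<Phi> (Suc m)) \<alpha> * pw (gsup \<Phi>' (Suc m)) \<beta>" .
    qed simp
    then have "gsup (S2 \<Phi> \<Phi>') (Suc m) powr (1 / real (Suc m))
        \<le> (pw (gsup \<Phi> (Suc m)) \<alpha> * pw (gsup \<Phi>' (Suc m)) \<beta>) powr (1 / real (Suc m))"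
      by (intro powr_mono2 gsup_nonneg[OF bset_S2[OF P P']]) auto
    also have "\<dots> = pw (gsup \<Phi> (Suc m) powr (1 / real (Suc m))) \<alpha> * pw (gsup \<Phi>' (Suc m) powr (1 / real (Suc m))) \<beta>"
      by (simp only: powr_mult pw_nonneg pw_powr[OF gsup_nonneg[OF P]] pw_powr[OF gsup_nonneg[OF P']])
    finally show "gsup (S2 \<Phi> \<Phi>') (Suc m) powr (1 / real (Suc m))
      \<le> pw (gsup \<Phi> (Suc m) powr (1 / real (Suc m))) \<alpha> * pw (gsup \<Phi>' (Suc m) powr (1 / real (Suc m))) \<beta>" .
  qed
qed

end

subsection \<open>Neumann series\<close>

lemma bounded_linear_funpow:
  fixes V :: "'a::real_normed_vector \<Rightarrow> 'a"
  assumes "bounded_linear V" shows "bounded_linear (V ^^ k)"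
proof (induction k)
  case 0
  then show ?case by (simp add: id_def bounded_linear_ident)
next
  case (Suc k)
  then show ?case using bounded_linear_compose[OF assms Suc] by (simp add: o_def)
qed

text \<open>What a set needs for the Neumann series of a map preserving it to stay inside. Applied
  to the nonnegative sequences, it makes resolvents positive.\<close>

definition closed_monoid :: "'a::real_normed_vector set \<Rightarrow> bool" where
  "closed_monoid K \<longleftrightarrow> closed K \<and> 0 \<in> K \<and> (\<forall>x\<in>K. \<forall>y\<in>K. x + y \<in> K)"

lemma closed_monoid_sum:
  assumes "closed_monoid K" "\<And>i. f i \<in> K" shows "(\<Sum>i<n::nat. f i) \<in> K"
  using assms by (induction n) (auto simp: closed_monoid_def)

lemma neumann:
  fixes U :: "'a::banach \<Rightarrow> 'a"
  assumes U: "bounded_linear U" and q: "\<And>x. norm (U x) \<le> q * norm x" "0 \<le> q" "q < 1"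
  obtains W where "bounded_linear W" "\<And>y. W y - U (W y) = y" "\<And>y. norm (W y) \<le> norm y / (1 - q)"
    "\<And>K. closed_monoid K \<Longrightarrow> U ` K \<subseteq> K \<Longrightarrow> W ` K \<subseteq> K"
proof -
  interpret U: bounded_linear U by (rule U)
  have pw: "bounded_linear (U ^^ j)" for j by (rule bounded_linear_funpow[OF U])
  have bd: "norm ((U ^^ j) y) \<le> q ^ j * norm y" for j y
  proof (induction j)
    case (Suc j)
    have "norm ((U ^^ Suc j) y) \<le> q * norm ((U ^^ j) y)" using q(1) by simp
    also have "\<dots> \<le> q * (q ^ j * norm y)" by (intro mult_left_mono Suc q)
    finally show ?case by (simp add: mult_ac)
  qed simp
  have geo: "summable (\<lambda>j. q ^ j * norm y)" for y
    using q by (intro summable_mult2 summable_geometric) simp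
  have sm: "summable (\<lambda>j. norm ((U ^^ j) y))" for y
    by (rule summable_comparison_test'[OF geo[of y], of 0]) (simp add: bd)
  define W where "W y = (\<Sum>j. (U ^^ j) y)" for y
  have sm': "summable (\<lambda>j. (U ^^ j) y)" for y by (rule summable_norm_cancel[OF sm])
  have nW: "norm (W y) \<le> norm y / (1 - q)" for y
  proof -
    have "norm (W y) \<le> (\<Sum>j. q ^ j * norm y)"
      unfolding W_def by (rule order_trans[OF summable_norm[OF sm] suminf_le[OF bd sm geo]])
    also have "\<dots> = norm y / (1 - q)"
      using q suminf_geometric[of q] suminf_mult2[OF summable_geometric[of q], of "norm y"] by simp
    finally show ?thesis .
  qed
  show ?thesis
  proof (rule that[of W])
    show "bounded_linear W"
    proof (rule bounded_linear_intro[where K = "1 / (1 - q)"])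
      show "W (x + y) = W x + W y" for x y
        unfolding W_def by (simp add: linear_add[OF bounded_linear.linear[OF pw]] suminf_add[OF sm' sm'])
      show "W (r *\<^sub>R x) = r *\<^sub>R W x" for r x
        unfolding W_def by (simp add: linear_cmul[OF bounded_linear.linear[OF pw]] suminf_scaleR_right[OF sm'])
      show "norm (W x) \<le> norm x * (1 / (1 - q))" for x using nW[of x] by simp
    qed
    show "W y - U (W y) = y" for y
    proof -
      have "U (W y) = (\<Sum>j. (U ^^ Suc j) y)" unfolding W_def by (simp add: U.suminf[OF sm'])
      also have "\<dots> = W y - y" unfolding W_def by (subst suminf_split_head[OF sm']) simp
      finally show ?thesis by simp
    qed
    show "norm (W y) \<le> norm y / (1 - q)" for y by (rule nW)
    fix K :: "'a set" assume K: "closed_monoid K" "U ` K \<subseteq> K"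
    have "W y \<in> K" if "y \<in> K" for y
    proof -
      have "(U ^^ j) y \<in> K" for j by (induction j) (use K(2) that in auto)
      then have "(\<Sum>j<n. (U ^^ j) y) \<in> K" for n by (rule closed_monoid_sum[OF K(1)])
      moreover have "closed K" using K(1) by (simp add: closed_monoid_def)
      ultimately show "W y \<in> K"
        unfolding W_def using closed_sequentially[OF _ _ summable_LIMSEQ[OF sm'[of y]]] by blast
    qed
    then show "W ` K \<subseteq> K" by blast
  qed
qed

text \<open>Only the k-th power of V contracts. The inverse of 1 - V is the sum of V^i (1 - V^k)^-1
  over i < k: telescoping shows that it is a right inverse, and injectivity of 1 - V, again from the
  power, makes it two-sided.\<close>

lemma resolvent:
  fixes V :: "'a::banach \<Rightarrow> 'a"
  assumes V: "bounded_linear V" and q: "\<And>x. norm ((V ^^ k) x) \<le> q * norm x" "0 \<le> q" "q < 1"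
  obtains G where "bounded_linear G" "\<And>y. G y - V (G y) = y" "\<And>x. G (x - V x) = x"
    "\<And>K. closed_monoid K \<Longrightarrow> V ` K \<subseteq> K \<Longrightarrow> G ` K \<subseteq> K"
proof -
  interpret V: bounded_linear V by (rule V)
  obtain W where W: "bounded_linear W" "\<And>y. W y - (V ^^ k) (W y) = y" "\<And>y. norm (W y) \<le> norm y / (1 - q)"
    and WK: "\<And>K. closed_monoid K \<Longrightarrow> (V ^^ k) ` K \<subseteq> K \<Longrightarrow> W ` K \<subseteq> K"
    using neumann[OF bounded_linear_funpow[OF V] q] by metis
  define G where "G y = (\<Sum>i<k. (V ^^ i) (W y))" for y
  have tel: "(\<Sum>i<n. (V ^^ i) x) - V (\<Sum>i<n. (V ^^ i) x) = x - (V ^^ n) x" for n x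
    unfolding V.sum by (induction n) (simp_all add: algebra_simps)
  have GV: "G y - V (G y) = y" for y
    unfolding G_def tel by (rule W)
  have inj: "x = y" if "x - V x = y - V y" for x y
  proof -
    have "V (x - y) = x - y" using that by (simp add: V.diff algebra_simps)
    then have "(V ^^ k) (x - y) = x - y" by (induction k) simp_all
    then have "norm (x - y) \<le> q * norm (x - y)" using q(1)[of "x - y"] by simp
    then have "(1 - q) * norm (x - y) \<le> 0" by (simp add: algebra_simps)
    then show ?thesis using q(3) by (simp add: mult_le_0_iff)
  qed
  show ?thesis
  proof (rule that[of G])
    show "bounded_linear G"
      unfolding G_def by (intro bounded_linear_sum bounded_linear_compose[OF bounded_linear_funpow[OF V] W(1)])
    show "G y - V (G y) = y" for y by (rule GV)
    show "G (x - V x) = x" for x by (rule inj) (rule GV)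
    fix K :: "'a set" assume K: "closed_monoid K" "V ` K \<subseteq> K"
    have pw: "(V ^^ j) x \<in> K" if "x \<in> K" for j x by (induction j) (use K(2) that in auto)
    then have "W ` K \<subseteq> K" by (intro WK K(1)) blast
    then show "G ` K \<subseteq> K" unfolding G_def by (auto intro!: closed_monoid_sum[OF K(1)] pw)
  qed
qed

subsection \<open>Finite rank perturbations have closed range\<close>

text \<open>If v has distance d > 0 from S, then |c| d \<le> |s + c v|. Along a convergent sequence
  the coefficients c are therefore Cauchy, and what is left converges in S.\<close>

lemma closed_add_line:
  fixes S :: "'a::real_normed_vector set"
  assumes S: "subspace S" "closed S"
  shows "closed {s + c *\<^sub>R v | s c. s \<in> S}"
proof (cases "v \<in> S")
  case True
  have "{s + c *\<^sub>R v | s c. s \<in> S} = S"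
  proof safe
    fix s c assume "s \<in> S"
    then show "s + c *\<^sub>R v \<in> S" using True S(1) by (simp add: subspace_add subspace_scale)
  next
    fix s assume "s \<in> S"
    then show "\<exists>s' c. s = s' + c *\<^sub>R v \<and> s' \<in> S" by (intro exI[of _ s] exI[of _ 0]) simp
  qed
  then show ?thesis using S by simp
next
  case False
  define d where "d = infdist v S"
  have ne: "S \<noteq> {}" using subspace_0[OF S(1)] by auto
  have d: "d > 0"
    using False S ne in_closed_iff_infdist_zero[of S v] infdist_nonneg[of v S] unfolding d_def by fastforce
  have low: "\<bar>c\<bar> * d \<le> norm (s + c *\<^sub>R v)" if "s \<in> S" for s c
  proof (cases "c = 0")
    case False
    have "- (1 / c) *\<^sub>R s \<in> S" by (rule subspace_scale[OF S(1) that])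
    then have "d \<le> dist v (- (1 / c) *\<^sub>R s)" unfolding d_def by (rule infdist_le)
    also have "\<dots> = norm (v + (1 / c) *\<^sub>R s)" by (simp add: dist_norm)
    finally have "\<bar>c\<bar> * d \<le> \<bar>c\<bar> * norm (v + (1 / c) *\<^sub>R s)" by (intro mult_left_mono) auto
    also have "\<dots> = norm (c *\<^sub>R (v + (1 / c) *\<^sub>R s))" by simp
    also have "c *\<^sub>R (v + (1 / c) *\<^sub>R s) = s + c *\<^sub>R v" using False by (simp add: scaleR_right_distrib)
    finally show ?thesis .
  qed simp
  show ?thesis
    unfolding closed_sequential_limits
  proof (intro allI impI, elim conjE)
    fix x l assume x: "\<forall>n. x n \<in> {s + c *\<^sub>R v | s c. s \<in> S}" and l: "x \<longlonglongrightarrow> l"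
    then have "\<forall>n. \<exists>s c. s \<in> S \<and> x n = s + c *\<^sub>R v" by blast
    then obtain s c where s: "\<And>n. s n \<in> S" and xn: "\<And>n. x n = s n + c n *\<^sub>R v" by metis
    have "Cauchy c"
      unfolding Cauchy_def
    proof (intro allI impI)
      fix e :: real assume "e > 0"
      then have "e * d > 0" using d by simp
      then obtain M where M: "\<And>m n. m \<ge> M \<Longrightarrow> n \<ge> M \<Longrightarrow> dist (x m) (x n) < e * d"
        using LIMSEQ_imp_Cauchy[OF l] unfolding Cauchy_def by blast
      have "dist (c m) (c n) < e" if "m \<ge> M" "n \<ge> M" for m n
      proof -
        have "\<bar>c m - c n\<bar> * d \<le> norm ((s m - s n) + (c m - c n) *\<^sub>R v)"
          by (rule low) (use s S(1) in \<open>simp add: subspace_diff\<close>)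
        also have "(s m - s n) + (c m - c n) *\<^sub>R v = x m - x n" by (simp add: xn algebra_simps)
        also have "norm (x m - x n) < e * d" using M[OF that] by (simp add: dist_norm)
        finally show ?thesis using d by (simp add: dist_norm)
      qed
      then show "\<exists>M. \<forall>m\<ge>M. \<forall>n\<ge>M. dist (c m) (c n) < e" by blast
    qed
    then obtain c0 where c0: "c \<longlonglongrightarrow> c0" using Cauchy_convergent_iff convergent_def by blast
    have "(\<lambda>n. x n - c n *\<^sub>R v) \<longlonglongrightarrow> l - c0 *\<^sub>R v" by (intro tendsto_intros l c0)
    moreover have "x n - c n *\<^sub>R v \<in> S" for n using s by (simp add: xn)
    ultimately have "l - c0 *\<^sub>R v \<in> S" using closed_sequentially[OF S(2), of "\<lambda>n. x n - c n *\<^sub>R v"] by simp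
    then have "(l - c0 *\<^sub>R v) + c0 *\<^sub>R v \<in> {s + c *\<^sub>R v | s c. s \<in> S}" by blast
    then show "l \<in> {s + c *\<^sub>R v | s c. s \<in> S}" by simp
  qed
qed

text \<open>Each functional cuts W down by at most one dimension, so the image loses at most a line;
  closedness is carried back from the common kernel one line at a time.\<close>

lemma closed_image_finite_codim:
  fixes T :: "'a::real_normed_vector \<Rightarrow> 'b::real_normed_vector" and fs :: "('a \<Rightarrow> real) list"
  assumes T: "linear T" and fs: "\<And>f. f \<in> set fs \<Longrightarrow> linear f"
    and W: "subspace W" and cl: "closed (T ` {x\<in>W. \<forall>f\<in>set fs. f x = 0})"
  shows "closed (T ` W)"
  using fs W cl
proof (induction fs arbitrary: W)
  case Nil
  then show ?case by simp
next
  case (Cons f fs)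
  define W' where "W' = {x\<in>W. f x = 0}"
  have lf: "linear f" using Cons.prems(1) by simp
  have W': "subspace W'"
    unfolding W'_def subspace_def
    using Cons.prems(2) by (auto simp: linear_0[OF lf] linear_add[OF lf] linear_cmul[OF lf]
        subspace_0 subspace_add subspace_scale)
  have "{x\<in>W'. \<forall>f\<in>set fs. f x = 0} = {x\<in>W. \<forall>f\<in>set (f # fs). f x = 0}"
    by (auto simp: W'_def)
  then have cl': "closed (T ` W')" using Cons.IH[OF _ W'] Cons.prems by simp
  show ?case
  proof (cases "\<exists>u\<in>W. f u \<noteq> 0")
    case False
    then have "W' = W" by (auto simp: W'_def)
    then show ?thesis using cl' by simp
  next
    case True
    then obtain u where u: "u \<in> W" "f u \<noteq> 0" by blast
    have "T ` W = {s + c *\<^sub>R T u | s c. s \<in> T ` W'}"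
    proof safe
      fix x assume x: "x \<in> W"
      define c where "c = f x / f u"
      have "x - c *\<^sub>R u \<in> W'"
        using x u Cons.prems(2)
        by (auto simp: W'_def c_def linear_diff[OF lf] linear_cmul[OF lf] subspace_diff subspace_scale)
      moreover have "T x = T (x - c *\<^sub>R u) + c *\<^sub>R T u"
        by (simp add: linear_diff[OF T] linear_cmul[OF T])
      ultimately show "\<exists>s c. T x = s + c *\<^sub>R T u \<and> s \<in> T ` W'" by blast
    next
      fix c x assume "x \<in> W'"
      then have "x + c *\<^sub>R u \<in> W" using u Cons.prems(2) by (auto simp: W'_def subspace_add subspace_scale)
      moreover have "T x + c *\<^sub>R T u = T (x + c *\<^sub>R u)" by (simp add: linear_add[OF T] linear_cmul[OF T])
      ultimately show "T x + c *\<^sub>R T u \<in> T ` W" by blast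
    qed
    moreover have "subspace (T ` W')" by (rule linear_subspace_image[OF T W'])
    ultimately show ?thesis using closed_add_line[OF _ cl'] by simp
  qed
qed

subsection \<open>Powers of a matrix and of its truncations\<close>

fun mpow :: "mat \<Rightarrow> nat \<Rightarrow> mat" where
  "mpow A 0 = id_mat"
| "mpow A (Suc n) = mat_mult A (mpow A n)"

lemma set_pow_singleton: "set_pow {A} n = {mpow A n}"
  by (induction n) auto

lemma bset_singleton:
  assumes "bm A a" shows "bset {A} (a + 1)"
  using bm_bound_nonneg[OF assms] bm_weaken[OF assms, of "a + 1"] by (simp add: bset_def)

lemma bm_mpow:
  assumes "bm A a" shows "bm (mpow A n) (a ^ n)"
  by (induction n) (auto intro: bm_id bm_mult assms)

lemma mpow_Suc_right:
  assumes "bm A a" shows "mpow A (Suc n) = mat_mult (mpow A n) A"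
proof -
  have "set_pow {A} (n + Suc 0) = {mat_mult (mpow A n) A}"
    unfolding set_pow_add[OF bset_singleton[OF assms]] set_pow_1 by (simp add: set_pow_singleton)
  then show ?thesis by (simp add: set_pow_singleton)
qed

lemma gsup_singleton:
  assumes "bm A a" shows "gsup {A} m = ess (mpow A m)"
  unfolding gsup_def set_pow_singleton using ess_nonneg[OF bm_mpow[OF assms]]
  by (simp add: cSup_eq_Max)

lemma hat_transpose:
  assumes A: "bm A a" shows "ess_rad_hat {mat_transpose A} = ess_rad_hat {A}"
proof -
  have tp: "mpow (mat_transpose A) n = mat_transpose (mpow A n)" for n
  proof (induction n)
    case 0
    then show ?case by (auto simp: id_mat_def mat_transpose_def fun_eq_iff)
  next
    case (Suc n)
    then show ?case unfolding mpow_Suc_right[OF A] by (simp add: transpose_mult)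
  qed
  have "gsup {mat_transpose A} m = gsup {A} m" for m
    by (simp add: gsup_singleton[OF A] gsup_singleton[OF bm_transpose[OF A]] tp ess_transpose)
  then show ?thesis
    using LIMSEQ_unique[OF hat_tendsto[OF bset_singleton[OF A]]]
      hat_tendsto[OF bset_singleton[OF bm_transpose[OF A]]] by simp
qed

text \<open>Expanding the power over paths of indices, the left side keeps those that stay at
  indices \<ge> n throughout, the right side constrains just the two ends. The exponent is positive
  since the zeroth power of the truncation is the full identity matrix.\<close>

lemma mpow_trunc_le:
  assumes A: "bm A a"
  shows "mpow (trunc n A) (Suc m) i j \<le> trunc n (mpow A (Suc m)) i j"
proof -
  have le: "mpow (trunc n A) m i j \<le> mpow A m i j" for m i j
  proof (induction m arbitrary: i j)
    case (Suc m)
    show ?case unfolding mpow.simps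
      by (rule mat_mult_mono[OF A bm_mpow[OF A] bm_trunc[OF A] bm_mpow[OF bm_trunc[OF A]] _ Suc])
        (simp add: trunc_def bm_nonneg[OF A])
  qed simp
  have zero: "mpow (trunc n A) (Suc m) i j = 0" if "\<not> (n \<le> i \<and> n \<le> j)"
  proof (cases "n \<le> i")
    case True
    then have "mat_mult (mpow (trunc n A) m) (trunc n A) i j = 0"
      using that by (simp add: mat_mult_def trunc_def)
    then show ?thesis by (simp only: mpow_Suc_right[OF bm_trunc[OF A]])
  next
    case False
    then show ?thesis by (simp add: mat_mult_def trunc_def)
  qed
  show ?thesis using le[of "Suc m" i j] zero by (auto simp: trunc_def)
qed

text \<open>For some m the power A^m has \<open>ess\<close> below q^m, so one of its truncations has
  a bound c < q^m; it dominates the m-th power of the truncated matrix. Truncating further keeps the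
  bound, which leaves M free to be large.\<close>

lemma trunc_power_contraction:
  assumes A: "bm A a" and q: "ess_rad_hat {A} < q"
  obtains M m c where "M \<ge> N" "bm (mpow (trunc M A) m) c" "c < q ^ m"
proof -
  obtain m where m: "m \<ge> 1" "gsup {A} m < q ^ m" using hat_lessD[OF bset_singleton[OF A] q] .
  then obtain c where c: "ess (mpow A m) < c" "c < q ^ m"
    using dense gsup_singleton[OF A] by metis
  obtain n where n: "bm (trunc n (mpow A m)) c" using ess_lessD[OF bm_mpow[OF A] c(1)] .
  obtain m' where m': "m = Suc m'" using m(1) by (cases m) auto
  have "bm (mpow (trunc (max n N) A) m) c"
    by (rule bm_mono[OF bm_trunc_mono[OF n, of "max n N"]])
      (use bm_nonneg[OF bm_mpow[OF bm_trunc[OF A]]] mpow_trunc_le[OF A] in \<open>auto simp only: m' order_refl max.cobounded1\<close>)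
  then show ?thesis using c(2) by (intro that) auto
qed

lemma matop_funpow:
  fixes x :: "'b::banach sq"
  assumes A: "bm A a" shows "(matop A ^^ m) x = matop (mpow A m) x"
proof (induction m)
  case 0
  have "matop id_mat x = x"
  proof (rule sq_eqI)
    fix i
    have "co (matop id_mat x) i = (\<Sum>j\<in>{i}. id_mat i j *\<^sub>R co x j)"
      unfolding co_matop[OF bm_id] by (rule suminf_finite) (auto simp: id_mat_def)
    then show "co (matop id_mat x) i = co x i" by (simp add: id_mat_def)
  qed
  then show ?case by simp
next
  case (Suc m)
  then show ?case by (simp add: matop_mult[OF A bm_mpow[OF A]])
qed

lemma mat_mult_add_left:
  assumes "bm A a" "bm B b" "bm C c"
  shows "mat_mult (\<lambda>i j. A i j + B i j) C = (\<lambda>i j. mat_mult A C i j + mat_mult B C i j)"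
  by (intro ext) (simp add: mat_mult_def distrib_right suminf_add mat_mult_summable[OF assms(1,3)]
      mat_mult_summable[OF assms(2,3)])

lemma mat_mult_add_right:
  assumes "bm A a" "bm B b" "bm C c"
  shows "mat_mult C (\<lambda>i j. A i j + B i j) = (\<lambda>i j. mat_mult C A i j + mat_mult C B i j)"
  by (intro ext) (simp add: mat_mult_def distrib_left suminf_add mat_mult_summable[OF assms(3,1)]
      mat_mult_summable[OF assms(3,2)])

text \<open>The bounded matrices with \<open>ess\<close> equal to 0 absorb multiplication, like
  compact operators. Removing a truncation leaves such a matrix \<open>F\<close>, and by induction
  the powers of A and of the truncation differ by another one.\<close>

lemma ess_mpow_trunc:
  assumes A: "bm A a"
  shows "ess (mpow A k) \<le> ess (mpow (trunc M A) k)"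
proof -
  let ?B = "trunc M A"
  define F where "F = (\<lambda>i j. if M \<le> i \<and> M \<le> j then 0 else A i j)"
  have B: "bm ?B a" by (rule bm_trunc[OF A])
  have F: "bm F a" by (rule bm_mono[OF A]) (auto simp: F_def bm_nonneg[OF A])
  have AF: "A = (\<lambda>i j. ?B i j + F i j)" by (auto simp: F_def trunc_def fun_eq_iff)
  have zero: "bm (\<lambda>i j. 0) 0" by (rule bmI) auto
  have "trunc M F = (\<lambda>i j. 0)" by (auto simp: F_def trunc_def fun_eq_iff)
  then have eF: "ess F \<le> 0" using ess_le[of M F 0] zero by simp
  have "\<exists>D d. bm D d \<and> ess D \<le> 0 \<and> mpow A k = (\<lambda>i j. mpow ?B k i j + D i j)"
  proof (induction k)
    case 0
    show ?case by (intro exI[of _ "\<lambda>i j. 0"] exI[of _ 0]) (simp add: zero ess_le_bound[OF zero])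
  next
    case (Suc k)
    then obtain D d where D: "bm D d" "ess D \<le> 0" and eq: "mpow A k = (\<lambda>i j. mpow ?B k i j + D i j)" by blast
    have P: "bm (mpow ?B k) (a ^ k)" by (rule bm_mpow[OF B])
    define D' where "D' = (\<lambda>i j. mat_mult F (mpow ?B k) i j + mat_mult A D i j)"
    have D': "bm D' (a * a ^ k + a * d)" unfolding D'_def by (intro bm_add bm_mult F P A D)
    have "ess D' \<le> ess (mat_mult F (mpow ?B k)) + ess (mat_mult A D)"
      unfolding D'_def by (rule ess_add[OF bm_mult[OF F P] bm_mult[OF A D(1)]])
    also have "\<dots> \<le> ess F * ess (mpow ?B k) + ess A * ess D"
      by (intro add_mono ess_mult[OF F P] ess_mult[OF A D(1)])
    also have "\<dots> \<le> 0"
      using eF D(2) ess_nonneg[OF P] ess_nonneg[OF A]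
      by (intro add_nonpos_nonpos mult_nonpos_nonneg mult_nonneg_nonpos) auto
    finally have "ess D' \<le> 0" .
    moreover have "mpow A (Suc k) = (\<lambda>i j. mpow ?B (Suc k) i j + D' i j)"
    proof -
      have "mpow A (Suc k) = (\<lambda>i j. mat_mult A (mpow ?B k) i j + mat_mult A D i j)"
        by (simp add: eq mat_mult_add_right[OF P D(1) A])
      also have "mat_mult A (mpow ?B k) = (\<lambda>i j. mat_mult ?B (mpow ?B k) i j + mat_mult F (mpow ?B k) i j)"
        by (subst AF) (rule mat_mult_add_left[OF B F P])
      finally show ?thesis by (simp add: D'_def add.assoc)
    qed
    ultimately show ?case using D' by blast
  qed
  then obtain D d where D: "bm D d" "ess D \<le> 0" and eq: "mpow A k = (\<lambda>i j. mpow ?B k i j + D i j)" by blast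
  show ?thesis unfolding eq using ess_add[OF bm_mpow[OF B] D(1), of k] D(2) by simp
qed

subsection \<open>Points outside the essential disc are Fredholm\<close>

definition csc :: "complex \<Rightarrow> complex sq \<Rightarrow> complex sq" where
  "csc w x = mk (\<lambda>i. w * co x i)"

lemma co_csc [simp]: "co (csc w x) i = w * co x i"
proof -
  have "L2_set (\<lambda>i. norm (w * co x i)) {..<n} \<le> norm w * norm x" for n
    by (simp add: norm_mult L2_set_right_distrib[symmetric] mult_left_mono L2_set_co_le)
  then show ?thesis unfolding csc_def by (subst co_mk) auto
qed

lemma norm_csc: "norm (csc w x) = norm w * norm x"
  unfolding norm_sq_def
  by (simp add: norm_mult power_mult_distrib suminf_mult[OF summable_co] real_sqrt_mult)

lemma bounded_linear_csc: "bounded_linear (csc w)"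
  by (rule bounded_linear_intro[where K = "norm w"])
    (auto intro!: sq_eqI simp: norm_csc algebra_simps)

lemma matop_csc:
  assumes "bm A a" shows "matop A (csc w x) = csc w (matop A x)"
proof (rule sq_eqI)
  fix i
  have "co (matop A (csc w x)) i = (\<Sum>j. w * (A i j *\<^sub>R co x j))"
    by (simp add: co_matop[OF assms])
  also have "\<dots> = w * (\<Sum>j. A i j *\<^sub>R co x j)" by (rule suminf_mult[OF bm_row_summable'[OF assms]])
  finally show "co (matop A (csc w x)) i = co (csc w (matop A x)) i" by (simp add: co_matop[OF assms])
qed

definition lcomb :: "(nat \<Rightarrow> complex) \<Rightarrow> complex sq list \<Rightarrow> complex sq" where
  "lcomb c vs = (\<Sum>k<length vs. csc (c k) (vs ! k))"

lemma co_lcomb: "co (lcomb c vs) i = (\<Sum>k<length vs. c k * (map co vs ! k) i)"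
  by (simp add: lcomb_def)

lemma fredholmI:
  assumes T: "\<And>x i. co (T x) i = S (co x) i"
    and ker: "\<And>x. T x = 0 \<Longrightarrow> \<exists>c. x = lcomb c vs"
    and cl: "closed (range T)"
    and codim: "\<And>y. \<exists>x c. y = T x + lcomb c ws"
  shows "fredholm_l2 S"
proof -
  have S: "S (co x) = co (T x)" for x by (rule ext) (simp add: T)
  have 1: "\<exists>vs. set vs \<subseteq> l2 \<and> (\<forall>x\<in>l2. S x = (\<lambda>i. 0) \<longrightarrow> (\<exists>c. x = (\<lambda>i. \<Sum>k<length vs. c k * (vs ! k) i)))"
  proof (intro exI[of _ "map co vs"] conjI ballI impI)
    show "set (map co vs) \<subseteq> l2" using co_in_l2 by auto
    fix x :: seq assume x: "x \<in> l2" "S x = (\<lambda>i. 0)"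
    obtain u where u: "x = co u" using l2_cases[OF x(1)] .
    have "T u = 0" using x(2) by (intro sq_eqI) (simp add: u S fun_eq_iff)
    then obtain c where "u = lcomb c vs" using ker by blast
    then show "\<exists>c. x = (\<lambda>i. \<Sum>k<length (map co vs). c k * (map co vs ! k) i)"
      by (intro exI[of _ c] ext) (simp only: u co_lcomb length_map)
  qed
  have 2: "\<forall>y\<in>l2. (\<forall>\<epsilon>>0. \<exists>x\<in>l2. l2norm (\<lambda>i. S x i - y i) < \<epsilon>) \<longrightarrow> (\<exists>x\<in>l2. S x = y)"
  proof (intro ballI impI)
    fix y :: seq assume y: "y \<in> l2" "\<forall>\<epsilon>>0. \<exists>x\<in>l2. l2norm (\<lambda>i. S x i - y i) < \<epsilon>"
    obtain v where v: "y = co v" using l2_cases[OF y(1)] .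
    have "v \<in> closure (range T)"
      unfolding closure_approachable
    proof (intro allI impI)
      fix e :: real assume "e > 0"
      then obtain x where x: "x \<in> l2" "l2norm (\<lambda>i. S x i - y i) < e" using y(2) by blast
      obtain u where u: "x = co u" using l2_cases[OF x(1)] .
      have "l2norm (\<lambda>i. S x i - y i) = norm (T u - v)"
        unfolding l2norm_co[symmetric] by (simp add: u v S co_diff_fun)
      then show "\<exists>z\<in>range T. dist z v < e" using x(2) by (auto simp: dist_norm)
    qed
    then obtain u where "v = T u" using cl by auto
    then show "\<exists>x\<in>l2. S x = y" by (intro bexI[of _ "co u"]) (simp_all add: v S co_in_l2)
  qed
  have 3: "\<exists>ws. set ws \<subseteq> l2 \<and> (\<forall>y\<in>l2. \<exists>x\<in>l2. \<exists>c. y = (\<lambda>i. S x i + (\<Sum>k<length ws. c k * (ws ! k) i)))"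
  proof (intro exI[of _ "map co ws"] conjI ballI)
    show "set (map co ws) \<subseteq> l2" using co_in_l2 by auto
    fix y :: seq assume y: "y \<in> l2"
    obtain v where v: "y = co v" using l2_cases[OF y] .
    obtain x c where "v = T x + lcomb c ws" using codim by blast
    then have "y = (\<lambda>i. S (co x) i + (\<Sum>k<length (map co ws). c k * (map co ws ! k) i))"
      by (intro ext) (simp only: v co_add T co_lcomb length_map)
    then show "\<exists>x\<in>l2. \<exists>c. y = (\<lambda>i. S x i + (\<Sum>k<length (map co ws). c k * (map co ws ! k) i))"
      using co_in_l2[of x] by blast
  qed
  from 1 2 3 show ?thesis unfolding fredholm_l2_def by (intro conjI)
qed

text \<open>With G the inverse of D, a kernel vector satisfies x = - G (F x), and y differs from the
  value of D + F at G y by an element of the range of F. On the common kernel of the functionals D +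
  F agrees with D, whose image of it is closed as a preimage under G; finitely many lines are then
  added back.\<close>

lemma fredholm_perturbation:
  fixes D F G :: "complex sq \<Rightarrow> complex sq" and fs :: "(complex sq \<Rightarrow> real) list"
  assumes D: "bounded_linear D" and F: "bounded_linear F" and G: "bounded_linear G"
    and DG: "\<And>y. D (G y) = y" and GD: "\<And>x. G (D x) = x"
    and Gc: "\<And>w x. G (csc w x) = csc w (G x)"
    and rank: "\<And>x. F x = lcomb (c x) ws"
    and fs: "\<And>f. f \<in> set fs \<Longrightarrow> bounded_linear f" "\<And>x. (\<forall>f\<in>set fs. f x = 0) \<Longrightarrow> F x = 0"
    and S: "\<And>x i. co (D x + F x) i = S (co x) i"
  shows "fredholm_l2 S"
proof (rule fredholmI[where T = "\<lambda>x. D x + F x" and vs = "map G ws" and ws = ws])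
  interpret D: bounded_linear D by (rule D)
  interpret F: bounded_linear F by (rule F)
  interpret G: bounded_linear G by (rule G)
  show "co (D x + F x) i = S (co x) i" for x i by (rule S)
  have neg: "- lcomb c vs = lcomb (\<lambda>k. - c k) vs" for c vs
    by (rule sq_eqI) (simp add: co_lcomb sum_negf)
  have Gl: "G (lcomb c vs) = lcomb c (map G vs)" for c vs
    by (simp add: lcomb_def G.sum Gc)
  show "\<exists>c. x = lcomb c (map G ws)" if "D x + F x = 0" for x
  proof -
    have "D x = - F x" using that by (simp add: add_eq_0_iff2)
    then have "x = G (- lcomb (c x) ws)" using GD[of x] rank[of x] by simp
    then show ?thesis unfolding neg Gl by blast
  qed
  show "\<exists>x c. y = D x + F x + lcomb c ws" for y
  proof -
    have "y = D (G y) + F (G y) + (- lcomb (c (G y)) ws)" by (simp add: DG rank)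
    then show ?thesis unfolding neg by blast
  qed
  let ?K = "{x. \<forall>f\<in>set fs. f x = 0}"
  have "(\<lambda>x. D x + F x) ` ?K = D ` ?K" by (intro image_cong refl) (simp add: fs(2))
  also have "\<dots> = {y. \<forall>f\<in>set fs. f (G y) = 0}"
  proof safe
    fix y assume "\<forall>f\<in>set fs. f (G y) = 0"
    then show "y \<in> D ` ?K" by (intro image_eqI[of _ _ "G y"]) (simp_all add: DG)
  qed (simp add: GD)
  also have "closed \<dots>"
  proof -
    have "closed {y. f (G y) = 0}" if "f \<in> set fs" for f
      using linear_continuous_on[OF bounded_linear_compose[OF fs(1)[OF that] G], of UNIV]
      by (intro closed_Collect_eq) (auto simp: o_def)
    moreover have "{y. \<forall>f\<in>set fs. f (G y) = 0} = (\<Inter>f\<in>set fs. {y. f (G y) = 0})" by auto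
    ultimately show ?thesis by (simp add: closed_INT)
  qed
  finally have cl: "closed ((\<lambda>x. D x + F x) ` {x\<in>UNIV. \<forall>f\<in>set fs. f x = 0})" by simp
  show "closed (range (\<lambda>x. D x + F x))"
  proof (rule closed_image_finite_codim[OF _ _ _ cl])
    show "linear (\<lambda>x. D x + F x)" by (rule bounded_linear.linear[OF bounded_linear_add[OF D F]])
    show "linear f" if "f \<in> set fs" for f by (rule bounded_linear.linear[OF fs(1)[OF that]])
  qed simp
qed

lemma sum_lessThan_add:
  fixes f :: "nat \<Rightarrow> 'a::comm_monoid_add"
  shows "(\<Sum>k<m + n. f k) = (\<Sum>k<m. f k) + (\<Sum>k<n. f (m + k))"
  by (induction n) (auto simp: add.assoc)

lemma fredholm_outside:
  assumes A: "bm A a" and z: "ess_rad_hat {A} < cmod z"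
  shows "fredholm_l2 (\<lambda>x i. mat_apply A x i - z * x i)"
proof -
  obtain n m c where c: "bm (mpow (trunc n A) m) c" "c < cmod z ^ m"
    by (rule trunc_power_contraction[OF A z, of 0])
  let ?B = "trunc n A"
  have B: "bm ?B a" by (rule bm_trunc[OF A])
  have z0: "z \<noteq> 0" using z hat_nonneg[OF bset_singleton[OF A]] by auto
  define V :: "complex sq \<Rightarrow> complex sq" where "V x = csc (1 / z) (matop ?B x)" for x
  have V: "bounded_linear V"
    unfolding V_def by (rule bounded_linear_compose[OF bounded_linear_csc bounded_linear_matop[OF B]])
  have Vp: "(V ^^ k) x = csc (1 / z ^ k) (matop (mpow ?B k) x)" for k x
  proof (induction k)
    case 0
    show ?case unfolding matop_funpow[OF B, symmetric] by (rule sq_eqI) simp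
  next
    case (Suc k)
    have "(V ^^ Suc k) x = csc (1 / z) (csc (1 / z ^ k) (matop ?B (matop (mpow ?B k) x)))"
      by (simp add: Suc V_def matop_csc[OF B])
    also have "\<dots> = csc (1 / z ^ Suc k) (matop (mpow ?B (Suc k)) x)"
      by (rule sq_eqI) (simp add: matop_mult[OF B bm_mpow[OF B]])
    finally show ?case .
  qed
  have q: "norm ((V ^^ m) x) \<le> c / cmod z ^ m * norm x" for x
    using norm_matop_le[OF c(1), of x] z0
    by (simp add: Vp norm_csc norm_divide norm_power divide_simps)
  have q1: "0 \<le> c / cmod z ^ m" "c / cmod z ^ m < 1"
    using bm_bound_nonneg[OF c(1)] c(2) z0 by auto
  obtain G0 where G0: "bounded_linear G0" "\<And>y. G0 y - V (G0 y) = y" "\<And>x. G0 (x - V x) = x"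
    using resolvent[OF V q q1] by metis
  interpret V: bounded_linear V by (rule V)
  interpret G0: bounded_linear G0 by (rule G0)
  have Vc: "V (csc w x) = csc w (V x)" for w x
    unfolding V_def matop_csc[OF B] by (rule sq_eqI) simp
  have G0c: "G0 (csc w x) = csc w (G0 x)" for w x
  proof -
    have "csc w (G0 x) - V (csc w (G0 x)) = csc w (G0 x - V (G0 x))"
      unfolding Vc by (rule sq_eqI) (simp add: algebra_simps)
    then have "csc w (G0 x) - V (csc w (G0 x)) = csc w x" by (simp add: G0)
    then show ?thesis using G0(3)[of "csc w (G0 x)"] by simp
  qed
  \<comment> \<open>\<open>D\<close> is the truncated matrix minus z, written as - z (1 -
    V).\<close>
  define D where "D x = csc (- z) (x - V x)" for x
  define G where "G y = G0 (csc (- 1 / z) y)" for y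
  define E where "E = (\<lambda>i j. if n \<le> i \<and> n \<le> j then 0 else A i j)"
  have E: "bm E a" by (rule bm_mono[OF A]) (auto simp: E_def bm_nonneg[OF A])
  define F :: "complex sq \<Rightarrow> complex sq" where "F = matop E"
  have F: "bounded_linear F" unfolding F_def by (rule bounded_linear_matop[OF E])
  have csc_csc: "csc u (csc w x) = csc (u * w) x" for u w x by (rule sq_eqI) simp
  have csc_1: "csc 1 x = x" for x by (rule sq_eqI) simp
  \<comment> \<open>The rows of E below n are stored through the coordinates of F x. The other rows
    see only the first n coordinates of x, through columns of E whose top n entries are removed so
    that nothing is counted twice.\<close>
  define col where "col j = matop E (unt j 1) - sec n (matop E (unt j (1::complex)))" for j
  define ws where "ws = map (\<lambda>k. if k < n then unt k 1 else col (k - n)) [0..<n + n]"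
  define cf where "cf x k = (if k < n then co (F x) k else co x (k - n))" for x k
  \<comment> \<open>The 2 n coefficients taken from \<open>cf\<close> vanish exactly when these 4 n
    functionals do; real and imaginary parts are separated because the functionals are real
    valued.\<close>
  define fs where "fs = map (\<lambda>i x. Re (co (F x) i)) [0..<n] @ map (\<lambda>i x. Im (co (F x) i)) [0..<n]
    @ map (\<lambda>i x. Re (co x i)) [0..<n] @ map (\<lambda>i x. Im (co x i)) [0..<n]"
  have rank: "F x = lcomb (cf x) ws" for x
  proof (rule sq_eqI)
    fix i
    have "co (lcomb (cf x) ws) i = (\<Sum>k<n + n. cf x k * co (ws ! k) i)"
      by (simp add: lcomb_def ws_def)
    also have "\<dots> = (\<Sum>k<n. co (F x) k * (if i = k then 1 else 0)) + (\<Sum>k<n. co x k * co (col k) i)"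
      unfolding sum_lessThan_add by (intro arg_cong2[where f = "(+)"] sum.cong refl) (auto simp: ws_def cf_def)
    also have "(\<Sum>k<n. co (F x) k * (if i = k then 1 else 0)) = (if i < n then co (F x) i else 0)"
      by (simp add: if_distrib cong: if_cong)
    also have "(\<Sum>k<n. co x k * co (col k) i) = (if i < n then 0 else co (F x) i)"
    proof (cases "i < n")
      case False
      have "co (F x) i = (\<Sum>j<n. E i j *\<^sub>R co x j)"
        unfolding F_def co_matop[OF E] using False by (intro suminf_finite) (auto simp: E_def)
      then show ?thesis
        using False by (simp add: col_def co_matop_unt[OF E] scaleR_conv_of_real mult.commute)
    qed (simp add: col_def)
    finally show "co (F x) i = co (lcomb (cf x) ws) i" by simp
  qed
  show ?thesis
  proof (rule fredholm_perturbation[where D = D and F = F and G = G and ws = ws and c = cf and fs = fs])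
    show "bounded_linear D"
      unfolding D_def
      by (rule bounded_linear_compose[OF bounded_linear_csc bounded_linear_sub[OF bounded_linear_ident V]])
    show "bounded_linear G"
      unfolding G_def by (rule bounded_linear_compose[OF G0(1) bounded_linear_csc])
    show "bounded_linear F" by (rule F)
    show "D (G y) = y" for y unfolding D_def G_def G0(2) csc_csc using z0 by (simp add: csc_1)
    show "G (D x) = x" for x unfolding D_def G_def csc_csc using z0 by (simp add: csc_1 G0(3))
    show "G (csc w x) = csc w (G x)" for w x unfolding G_def G0c csc_csc by (simp add: mult.commute)
    show "F x = lcomb (cf x) ws" for x by (rule rank)
    show "bounded_linear f" if "f \<in> set fs" for f
      using that bounded_linear_compose[OF bounded_linear_co F]
      by (auto simp: fs_def intro: bounded_linear_compose[OF bounded_linear_Re] bounded_linear_compose[OF bounded_linear_Im]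
          bounded_linear_co)
    show "F x = 0" if "\<forall>f\<in>set fs. f x = 0" for x
    proof -
      have "cf x k = 0" if "k < n + n" for k
        using \<open>\<forall>f\<in>set fs. f x = 0\<close> that by (auto simp: fs_def cf_def complex_eq_iff)
      then show ?thesis unfolding rank by (intro sq_eqI) (simp add: lcomb_def ws_def)
    qed
    fix x i
    have "co (D x) i = co (matop ?B x) i - z * co x i"
      using z0 by (simp add: D_def V_def algebra_simps)
    moreover have "co (matop A x) i = co (matop ?B x) i + co (F x) i"
    proof -
      have "(\<Sum>j. A i j *\<^sub>R co x j) = (\<Sum>j. ?B i j *\<^sub>R co x j + E i j *\<^sub>R co x j)"
        by (rule suminf_cong) (simp add: trunc_def E_def)
      also have "\<dots> = (\<Sum>j. ?B i j *\<^sub>R co x j) + (\<Sum>j. E i j *\<^sub>R co x j)"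
        by (intro suminf_add[symmetric] bm_row_summable'[OF B] bm_row_summable'[OF E])
      finally show ?thesis by (simp only: F_def co_matop[OF A] co_matop[OF B] co_matop[OF E])
    qed
    ultimately show "co (D x + F x) i = mat_apply A (co x) i - z * co x i"
      by (simp add: mat_apply_co[OF A])
  qed
qed

subsection \<open>The essential radius belongs to the essential spectrum\<close>

definition pair :: "nat \<Rightarrow> real sq \<Rightarrow> complex sq \<Rightarrow> complex" where
  "pair n w v = (\<Sum>i<n. complex_of_real (co w i) * co v i)"

lemma norm_pair_le: "norm (pair n w v) \<le> norm w * norm v"
proof -
  have "norm (pair n w v) \<le> (\<Sum>i<n. \<bar>norm (co w i)\<bar> * \<bar>norm (co v i)\<bar>)"
    unfolding pair_def by (rule order_trans[OF norm_sum]) (simp add: norm_mult)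
  also have "\<dots> \<le> L2_set (\<lambda>i. norm (co w i)) {..<n} * L2_set (\<lambda>i. norm (co v i)) {..<n}"
    by (rule L2_set_mult_ineq)
  also have "\<dots> \<le> norm w * norm v" by (intro mult_mono L2_set_co_le) auto
  finally show ?thesis .
qed

lemma pair_add: "pair n w (u + v) = pair n w u + pair n w v"
  by (simp add: pair_def algebra_simps sum.distrib)

lemma pair_lcomb: "pair n w (lcomb c vs) = (\<Sum>k<length vs. c k * pair n w (vs ! k))"
  unfolding pair_def lcomb_def by (simp add: sum_distrib_left mult_ac) (rule sum.swap)

text \<open>The pairing is bilinear, without conjugation, so A passes to its real transpose on w.
  Since w has finite support, finite sums are exchanged on the sections of x, and continuity gives
  all x.\<close>

lemma pair_adjoint:
  assumes A: "bm A a" and w: "\<And>i. n \<le> i \<Longrightarrow> co w i = 0"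
  shows "norm (pair n w (matop A x - csc (of_real t) x))
    \<le> norm (matop (mat_transpose A) w - t *\<^sub>R w) * norm x"
proof -
  let ?R = "matop (mat_transpose A) w - t *\<^sub>R w"
  let ?T = "\<lambda>x. matop A x - csc (of_real t) x"
  have Aw: "co (matop (mat_transpose A) w) j = (\<Sum>i<n. A i j * co w i)" for j
    by (subst co_matop_finite[OF bm_transpose[OF A] w]) (simp_all add: mat_transpose_def)
  have fin: "pair n w (?T (sec m x)) = pair m ?R x" if "n \<le> m" for m
  proof -
    have "pair n w (?T (sec m x)) = (\<Sum>i<n. \<Sum>j<m. of_real (co w i) * (of_real (A i j) * co x j))
        - (\<Sum>i<n. of_real (co w i) * (of_real t * co x i))"
      unfolding pair_def using that
      by (simp add: co_matop_finite[OF A, where n = m] scaleR_conv_of_real algebra_simps sum_subtractf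
          sum_distrib_left)
    also have "(\<Sum>i<n. of_real (co w i) * (of_real t * co x i)) = (\<Sum>i<m. of_real (co w i) * (of_real t * co x i))"
      by (rule sum.mono_neutral_left) (use that w in auto)
    also have "(\<Sum>i<n. \<Sum>j<m. of_real (co w i) * (of_real (A i j) * co x j))
        = (\<Sum>j<m. of_real (co (matop (mat_transpose A) w) j) * co x j)"
      by (subst sum.swap) (simp add: Aw sum_distrib_left sum_distrib_right mult_ac)
    finally show ?thesis by (simp add: pair_def algebra_simps sum_subtractf)
  qed
  have T: "bounded_linear ?T" by (rule bounded_linear_sub[OF bounded_linear_matop[OF A] bounded_linear_csc])
  have "(\<lambda>m. norm (pair n w (?T (sec m x)))) \<longlonglongrightarrow> norm (pair n w (?T x))"
    unfolding pair_def
    by (intro tendsto_intros bounded_linear.tendsto[OF bounded_linear_co] bounded_linear.tendsto[OF T] sec_tendsto)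
  then show ?thesis
  proof (rule LIMSEQ_le_const2)
    show "\<exists>N. \<forall>m\<ge>N. norm (pair n w (?T (sec m x))) \<le> norm ?R * norm x"
      using norm_pair_le[of _ ?R x] by (intro exI[of _ n]) (simp add: fin)
  qed
qed

lemma fredholm_codim:
  assumes A: "bm A a" and fr: "fredholm_l2 (\<lambda>x i. mat_apply A x i - z * x i)"
  obtains ws where "\<And>y. \<exists>x c. y = matop A x - csc z x + lcomb c ws"
proof -
  obtain ws where ws: "set ws \<subseteq> l2" "\<And>y. y \<in> l2 \<Longrightarrow> \<exists>x\<in>l2. \<exists>c.
            y = (\<lambda>i. (mat_apply A x i - z * x i) + (\<Sum>k<length ws. c k * (ws ! k) i))"
    using fr unfolding fredholm_l2_def by (elim conjE exE) blast
  have wsk: "co (mk (ws ! k) :: complex sq) = ws ! k" if "k < length ws" for k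
    using ws(1) that by (intro co_mk_l2) auto
  show ?thesis
  proof (rule that[of "map mk ws"])
    fix y :: "complex sq"
    obtain x c where x: "x \<in> l2"
      and y: "co y = (\<lambda>i. (mat_apply A x i - z * x i) + (\<Sum>k<length ws. c k * (ws ! k) i))"
      using ws(2)[OF co_in_l2[of y]] by blast
    obtain u where u: "x = co u" using l2_cases[OF x] .
    have "y = matop A u - csc z u + lcomb c (map mk ws)"
      by (rule sq_eqI) (simp add: y u mat_apply_co[OF A] lcomb_def wsk)
    then show "\<exists>x c. y = matop A x - csc z x + lcomb c (map mk ws)" by blast
  qed
qed

text \<open>Gliding hump: normalised finitely supported approximate eigenvectors of the transpose with
  disjoint supports are summed with weights \<open>2\<^sup>-\<^sup>k\<close>.  Pairing the sum, written as an element of the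
  range plus a combination of finitely many vectors, with the \<open>k\<close>-th vector gives
  \<open>2\<^sup>-\<^sup>k \<le> 4\<^sup>-\<^sup>k C\<close>.\<close>
lemma fredholm_tail_lower_bound:
  assumes A: "bm A a" and fr: "fredholm_l2 (\<lambda>x i. mat_apply A x i - complex_of_real t * x i)"
  shows "\<exists>c>0. \<exists>N. \<forall>w :: real sq. (\<forall>i<N. co w i = 0) \<longrightarrow> c * norm w \<le> norm (matop (mat_transpose A) w - t *\<^sub>R w)"
proof (rule ccontr)
  assume neg: "\<not> ?thesis"
  define R where "R w = matop (mat_transpose A) w - t *\<^sub>R w" for w :: "real sq"
  have Rbl: "bounded_linear R"
    unfolding R_def
    by (rule bounded_linear_sub[OF bounded_linear_matop[OF bm_transpose[OF A]] bounded_linear_scaleR_right])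
  interpret R: bounded_linear R by (rule Rbl)
  obtain ws where ws: "\<And>y. \<exists>x c. y = matop A x - csc (complex_of_real t) x + lcomb c ws"
    using fredholm_codim[OF A fr] by blast
  have step: "\<exists>N' w. N \<le> N' \<and> (\<forall>i<N. co w i = 0) \<and> (\<forall>i\<ge>N'. co w i = 0) \<and> norm w = 1 \<and> norm (R w) < c
      \<and> (\<forall>v\<in>set ws. norm (pair N' w v) \<le> c)" if c: "c > 0" for N c
  proof -
    have "\<forall>v\<in>set ws. \<forall>\<^sub>F m in sequentially. norm (v - sec m v) < c"
      using order_tendstoD(2)[OF tail_tendsto c] by blast
    then have "\<forall>\<^sub>F m in sequentially. \<forall>v\<in>set ws. norm (v - sec m v) < c"
      by (simp add: eventually_ball_finite)
    then obtain M where "\<forall>m\<ge>M. \<forall>v\<in>set ws. norm (v - sec m v) < c"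
      unfolding eventually_sequentially by blast
    then have M: "norm (v - sec (max N M) v) < c" if "v \<in> set ws" for v using that by simp
    \<comment> \<open>The vector has to vanish below N for disjoint supports, and below M so that
      only the small tails of the vectors in \<open>ws\<close> pair with it.\<close>
    have "\<not> (\<forall>w. (\<forall>i<max N M. co w i = 0) \<longrightarrow> c * norm w \<le> norm (R w))"
      using neg c unfolding R_def by blast
    then obtain w where w: "\<forall>i<max N M. co w i = 0" "norm (R w) < c * norm w"
      by (auto simp: not_le)
    have "(\<lambda>n. c * norm (sec n w) - norm (R (sec n w))) \<longlonglongrightarrow> c * norm w - norm (R w)"
      by (intro tendsto_intros sec_tendsto R.tendsto)
    then have "\<forall>\<^sub>F n in sequentially. 0 < c * norm (sec n w) - norm (R (sec n w))"
      using w(2) by (intro order_tendstoD(1)) auto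
    then obtain K where K: "\<forall>n\<ge>K. 0 < c * norm (sec n w) - norm (R (sec n w))"
      unfolding eventually_sequentially by blast
    define N' where "N' = max N K"
    define s where "s = sec N' w"
    have s: "norm (R s) < c * norm s" using K unfolding s_def N'_def by auto
    then have "s \<noteq> 0" using R.zero by auto
    then have s0: "norm s > 0" by simp
    define u where "u = inverse (norm s) *\<^sub>R s"
    have nu: "norm u = 1" using s0 by (simp add: u_def)
    have uz: "co u i = 0" if "i < max N M \<or> N' \<le> i" for i
      using that w(1) by (auto simp: u_def s_def)
    have "norm (R u) < c"
      using s s0 by (simp add: u_def R.scaleR field_simps)
    moreover have "norm (pair N' u v) \<le> c" if "v \<in> set ws" for v
    proof -
      have "pair N' u v = pair N' u (v - sec (max N M) v)"
        unfolding pair_def by (rule sum.cong) (use uz in auto)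
      then have "norm (pair N' u v) \<le> norm u * norm (v - sec (max N M) v)"
        using norm_pair_le[of N' u "v - sec (max N M) v"] by simp
      then show ?thesis using M[OF that] nu by simp
    qed
    ultimately show ?thesis using nu uz by (intro exI[of _ N'] exI[of _ u]) (auto simp: N'_def)
  qed
  define P where "P N c N' w \<longleftrightarrow> N \<le> N' \<and> (\<forall>i<N. co w i = 0) \<and> (\<forall>i\<ge>N'. co w i = 0) \<and> norm w = 1
      \<and> norm (R w) < c \<and> (\<forall>v\<in>set ws. norm (pair N' w v) \<le> c)" for N c N' w
  have "\<forall>N c. \<exists>N' w. c > 0 \<longrightarrow> P N c N' w" using step unfolding P_def by blast
  then obtain NN WW where NW: "\<And>N c. c > 0 \<Longrightarrow> P N c (NN N c) (WW N c)" by metis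
  \<comment> \<open>The cut points: \<open>w k\<close> is supported from \<open>p k\<close> up to,
    but not including, \<open>p (Suc k)\<close>. Its tolerance (1/4)^k shrinks faster than its
    weight (1/2)^k in the sum.\<close>
  define p where "p = rec_nat 0 (\<lambda>k N. NN N ((1/4) ^ k))"
  have p0: "p 0 = 0" and pS: "p (Suc k) = NN (p k) ((1/4) ^ k)" for k by (simp_all add: p_def)
  define w where "w k = WW (p k) ((1/4) ^ k)" for k
  have "P (p k) ((1/4) ^ k) (p (Suc k)) (w k)" for k unfolding pS w_def by (rule NW) simp
  then have pm: "p k \<le> p (Suc k)" and wl: "\<And>i. i < p k \<Longrightarrow> co (w k) i = 0"
    and wu: "\<And>i. p (Suc k) \<le> i \<Longrightarrow> co (w k) i = 0" and wn: "norm (w k) = 1"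
    and wR: "norm (R (w k)) < (1/4) ^ k" and wp: "\<And>v. v \<in> set ws \<Longrightarrow> norm (pair (p (Suc k)) (w k) v) \<le> (1/4) ^ k"
    for k unfolding P_def by blast+
  have mono: "p i \<le> p j" if "i \<le> j" for i j by (rule lift_Suc_mono_le[where f = p, OF pm that])
  have disj: "co (w j) i = 0" if "p k \<le> i" "i < p (Suc k)" "j \<noteq> k" for i j k
  proof (cases "j < k")
    case True
    then show ?thesis using mono[of "Suc j" k] that by (intro wu) auto
  next
    case False
    then show ?thesis using mono[of "Suc k" j] that by (intro wl) auto
  qed
  define f where "f k = (1/2) ^ k *\<^sub>R cx (w k)" for k
  have nf: "norm (f k) = (1/2) ^ k" for k by (simp add: f_def norm_cx wn)
  have sf: "summable f"
    by (rule summable_norm_cancel) (simp add: nf summable_geometric)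
  define y where "y = (\<Sum>k. f k)"
  have yk: "co y i = of_real ((1/2) ^ k * co (w k) i)" if "p k \<le> i" "i < p (Suc k)" for i k
  proof -
    have "co y i = (\<Sum>j. co (f j) i)" unfolding y_def by (rule bounded_linear.suminf[OF bounded_linear_co sf])
    also have "\<dots> = (\<Sum>j\<in>{k}. co (f j) i)"
      by (rule suminf_finite) (use disj[OF that] in \<open>auto simp: f_def\<close>)
    finally show ?thesis by (simp add: f_def scaleR_conv_of_real)
  qed
  have pairy: "pair (p (Suc k)) (w k) y = of_real ((1/2) ^ k)" for k
  proof -
    have "pair (p (Suc k)) (w k) y = (\<Sum>i<p (Suc k). of_real ((1/2) ^ k * (co (w k) i)\<^sup>2))"
      unfolding pair_def
    proof (rule sum.cong)
      fix i assume i: "i \<in> {..<p (Suc k)}"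
      show "complex_of_real (co (w k) i) * co y i = of_real ((1/2) ^ k * (co (w k) i)\<^sup>2)"
      proof (cases "i < p k")
        case True
        then show ?thesis by (simp add: wl)
      next
        case False
        then show ?thesis using i yk[of k i] by (simp add: power2_eq_square)
      qed
    qed simp
    also have "\<dots> = of_real ((1/2) ^ k * (\<Sum>i<p (Suc k). (co (w k) i)\<^sup>2))"
      by (simp add: sum_distrib_left)
    also have "(\<Sum>i<p (Suc k). (co (w k) i)\<^sup>2) = (norm (rsec (p (Suc k)) (co (w k))))\<^sup>2"
      by (simp add: norm_rsec L2_set_power2)
    also have "rsec (p (Suc k)) (co (w k)) = w k" by (rule sq_eqI) (use wu in auto)
    finally show ?thesis by (simp add: wn)
  qed
  obtain x c where y: "y = matop A x - csc (complex_of_real t) x + lcomb c ws" using ws by blast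
  \<comment> \<open>x and the coefficients c belong to one decomposition of y, so this constant does
    not depend on k.\<close>
  define C where "C = norm x + (\<Sum>l<length ws. norm (c l))"
  have "(2::real) ^ k \<le> C" for k
  proof -
    have "(1/2) ^ k = norm (pair (p (Suc k)) (w k) y)" by (simp add: pairy norm_power)
    also have "\<dots> \<le> norm (pair (p (Suc k)) (w k) (matop A x - csc (complex_of_real t) x))
        + norm (\<Sum>l<length ws. c l * pair (p (Suc k)) (w k) (ws ! l))"
      unfolding y pair_add pair_lcomb by (rule norm_triangle_ineq)
    also have "\<dots> \<le> norm (R (w k)) * norm x + (\<Sum>l<length ws. norm (c l) * (1/4) ^ k)"
      unfolding R_def
      by (intro add_mono pair_adjoint[OF A wu] order_trans[OF norm_sum] sum_mono)
        (auto simp: norm_mult intro!: mult_left_mono wp)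
    also have "\<dots> \<le> (1/4) ^ k * norm x + (\<Sum>l<length ws. norm (c l) * (1/4) ^ k)"
      using wR[of k] by (intro add_right_mono mult_right_mono) auto
    also have "\<dots> = (1/4) ^ k * C" by (simp add: C_def algebra_simps sum_distrib_right)
    finally have "(1/2) ^ k * 4 ^ k \<le> (1/4) ^ k * C * 4 ^ k" by (intro mult_right_mono) auto
    moreover have "(1/2) ^ k * 4 ^ k = (2::real) ^ k" by (simp add: power_mult_distrib[symmetric])
    moreover have "(1/4) ^ k * C * 4 ^ k = C" by (simp add: power_divide)
    ultimately show ?thesis by simp
  qed
  moreover obtain k where "C < 2 ^ k" using real_arch_pow[of 2 C] by auto
  ultimately show False by (meson not_le)
qed

text \<open>The Riesz representation: evaluating f at the first n of its own coefficients bounds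
  their norm by that of f, so they form an element of the space. Its tails tend to 0, and
  Cauchy-Schwarz applies to the tail.\<close>

lemma functional_tail_small:
  fixes f :: "real sq \<Rightarrow> real"
  assumes f: "bounded_linear f" and e: "e > 0"
  shows "\<exists>n. \<forall>x. (\<forall>i<n. co x i = 0) \<longrightarrow> \<bar>f x\<bar> \<le> e * norm x"
proof -
  interpret f: bounded_linear f by (rule f)
  define a where "a j = f (unt j 1)" for j
  have fr: "f (rsec n g) = (\<Sum>j<n. a j * g j)" for n g
  proof -
    have "unt j (g j) = g j *\<^sub>R unt j (1::real)" for j by (rule sq_eqI) simp
    then show ?thesis by (simp add: rsec_def f.sum f.scaleR a_def mult.commute)
  qed
  obtain K where K: "K \<ge> 0" "\<And>x. norm (f x) \<le> norm x * K" using f.nonneg_bounded by blast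
  have aK: "L2_set (\<lambda>i. norm (a i)) {..<n} \<le> K" for n
  proof -
    let ?L = "L2_set a {..<n}"
    have "?L * ?L = f (rsec n a)"
      unfolding fr power2_eq_square[symmetric] by (rule L2_set_power2)
    also have "\<dots> \<le> ?L * K" using K(2)[of "rsec n a"] by (simp add: norm_rsec)
    finally have "?L \<le> K \<or> ?L = 0" by (metis L2_set_nonneg mult_le_cancel_left order_less_le)
    then show ?thesis using K(1) by (auto simp: L2_set_def)
  qed
  define \<alpha> where "\<alpha> = mk a"
  have \<alpha>: "co \<alpha> = a" unfolding \<alpha>_def by (rule co_mk[OF aK])
  have "\<forall>\<^sub>F n in sequentially. norm (\<alpha> - sec n \<alpha>) < e" by (rule order_tendstoD(2)[OF tail_tendsto e])
  then obtain n where "norm (\<alpha> - sec n \<alpha>) < e" by (auto simp: eventually_sequentially)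
  then have n: "norm (\<alpha> - sec n \<alpha>) \<le> e" by simp
  have "\<bar>f x\<bar> \<le> e * norm x" if x: "\<forall>i<n. co x i = 0" for x
  proof (rule LIMSEQ_le_const2)
    show "(\<lambda>m. \<bar>f (sec m x)\<bar>) \<longlonglongrightarrow> \<bar>f x\<bar>" by (intro tendsto_intros f.tendsto sec_tendsto)
    show "\<exists>N. \<forall>m\<ge>N. \<bar>f (sec m x)\<bar> \<le> e * norm x"
    proof (intro exI allI impI)
      fix m
      have "sec m x = rsec m (co x)" by (rule sq_eqI) simp
      then have "\<bar>f (sec m x)\<bar> = \<bar>\<Sum>j<m. a j * co x j\<bar>" by (simp add: fr)
      also have "(\<Sum>j<m. a j * co x j) = (\<Sum>j<m. co (\<alpha> - sec n \<alpha>) j * co x j)"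
        by (rule sum.cong) (use x in \<open>auto simp: \<alpha>\<close>)
      also have "\<bar>\<dots>\<bar> \<le> (\<Sum>j<m. \<bar>norm (co (\<alpha> - sec n \<alpha>) j)\<bar> * \<bar>norm (co x j)\<bar>)"
        by (rule order_trans[OF sum_abs]) (simp add: abs_mult)
      also have "\<dots> \<le> L2_set (\<lambda>i. norm (co (\<alpha> - sec n \<alpha>) i)) {..<m} * L2_set (\<lambda>i. norm (co x i)) {..<m}"
        by (rule L2_set_mult_ineq)
      also have "\<dots> \<le> e * norm x"
        by (intro mult_mono order_trans[OF L2_set_co_le n] L2_set_co_le) (use e in auto)
      finally show "\<bar>f (sec m x)\<bar> \<le> e * norm x" .
    qed
  qed
  then show ?thesis by blast
qed

text \<open>The first M coordinates of T x are finitely many functionals, each made at most norm x /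
  (1 + M) far out. The sum of their thresholds serves as a common one.\<close>

lemma functionals_tail_small:
  fixes T :: "real sq \<Rightarrow> real sq"
  assumes T: "bounded_linear T"
  shows "\<exists>n. \<forall>x. (\<forall>i<n. co x i = 0) \<longrightarrow> norm (sec M (T x)) \<le> norm x"
proof -
  have "\<forall>i. \<exists>n. \<forall>x. (\<forall>i<n. co x i = 0) \<longrightarrow> \<bar>co (T x) i\<bar> \<le> 1 / (1 + real M) * norm x"
    using functional_tail_small[OF bounded_linear_compose[OF bounded_linear_co T], of "1 / (1 + real M)"]
    by simp
  then obtain n where n: "\<And>i x. (\<forall>j<n i. co x j = 0) \<Longrightarrow> \<bar>co (T x) i\<bar> \<le> 1 / (1 + real M) * norm x"
    by metis
  have "norm (sec M (T x)) \<le> norm x" if x: "\<forall>j<(\<Sum>i<M. n i). co x j = 0" for x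
  proof -
    have "norm (sec M (T x)) \<le> (\<Sum>i<M. norm (unt i (co (T x) i)))"
      unfolding sec_eq_sum by (rule norm_sum)
    also have "\<dots> \<le> (\<Sum>i<M. 1 / (1 + real M) * norm x)"
    proof (rule sum_mono)
      fix i assume i: "i \<in> {..<M}"
      have "n i \<le> (\<Sum>i<M. n i)" by (rule member_le_sum) (use i in auto)
      then have "\<bar>co (T x) i\<bar> \<le> 1 / (1 + real M) * norm x" using x by (intro n) auto
      then show "norm (unt i (co (T x) i)) \<le> 1 / (1 + real M) * norm x"
        using norm_unt[of i "co (T x) i"] by simp
    qed
    also have "\<dots> = real M / (1 + real M) * norm x" by simp
    also have "\<dots> \<le> 1 * norm x" by (intro mult_right_mono) (auto simp: divide_simps)
    finally show ?thesis by simp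
  qed
  then show ?thesis by blast
qed

section \<open>Positive resolvents and their continuation below the radius\<close>

lemma closed_monoid_nonneg: "closed_monoid {x :: real sq. \<forall>i. 0 \<le> co x i}"
proof -
  have "closed {x :: real sq. 0 \<le> co x i}" for i
    using linear_continuous_on[OF bounded_linear_co, of UNIV i] by (intro closed_Collect_le) auto
  then have "closed {x :: real sq. \<forall>i. 0 \<le> co x i}" by (rule closed_Collect_all)
  then show ?thesis by (auto simp: closed_monoid_def)
qed

text \<open>A nonnegative v with x + B v \<le> z v controls the orbit of x: x \<le> z v, and each
  application of B costs a factor z. It stands in for the resolvent at a point z where none is known
  to exist.\<close>

lemma mpow_le_supersolution:
  fixes x v :: "real sq"
  assumes B: "bm B b" and x: "\<And>i. 0 \<le> co x i" and v: "\<And>i. 0 \<le> co v i" and z: "0 \<le> z"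
    and super: "\<And>i. co x i + co (matop B v) i \<le> z * co v i"
  shows "co (matop (mpow B k) x) i \<le> z ^ Suc k * co v i"
proof (induction k arbitrary: i)
  case 0
  have "co x i \<le> z * co v i" using super[of i] matop_nonneg[OF B v, of i] by linarith
  then show ?case using matop_funpow[OF B, of 0 x] by simp
next
  case (Suc k)
  have nn: "0 \<le> co (matop (mpow B k) x) j" for j by (rule matop_nonneg[OF bm_mpow[OF B] x])
  have "co (matop (mpow B (Suc k)) x) i = co (matop B (matop (mpow B k) x)) i"
    by (simp add: matop_mult[OF B bm_mpow[OF B]])
  also have "\<dots> \<le> norm (co (matop B (matop (mpow B k) x)) i)" by simp
  also have "\<dots> \<le> co (matop B (z ^ Suc k *\<^sub>R v)) i"
    by (rule matop_dominated[OF B B order_refl]) (use Suc nn in \<open>simp del: power_Suc\<close>)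
  also have "\<dots> = z ^ Suc k * co (matop B v) i"
    using linear_cmul[OF bounded_linear.linear[OF bounded_linear_matop[OF B]], of "z ^ Suc k" v] by simp
  also have "\<dots> \<le> z ^ Suc k * (z * co v i)"
    using super[of i] x[of i] z by (intro mult_left_mono) auto
  finally show ?case by (simp add: mult_ac)
qed

text \<open>If \<open>B - t\<close> is bounded below on tails, then the resolvents at points slightly above \<open>t\<close>, compressed
  to far tails, are bounded by a fixed constant, so that a Neumann series continues them below \<open>t\<close>.\<close>
lemma tail_bounded_below_imp_less:
  assumes B: "bm B b" and t: "0 < t" and hat: "ess_rad_hat {B} \<le> t" and c: "c > 0"
    and low: "\<And>w :: real sq. (\<forall>i<N. co w i = 0) \<Longrightarrow> c * norm w \<le> norm (matop B w - t *\<^sub>R w)"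
  shows "ess_rad_hat {B} < t"
proof -
  \<comment> \<open>The compressed resolvent H will have norm at most 4 / c, so d \<le> c / 8 makes
    the norm of d H at most 1/2; d \<le> t keeps z' = t - d/2 positive. The points z and z' lie at
    distance d/2 above and below t.\<close>
  define d where "d = min (c / 8) t"
  define z where "z = t + d / 2"
  define z' where "z' = z - d"
  have d: "0 < d" "d \<le> c / 8" "d \<le> t" using c t by (auto simp: d_def)
  have z: "t < z" "z - t \<le> c / 16" "0 < z'" "z' < t" "0 < z" using d t by (auto simp: z_def z'_def)
  have "ess_rad_hat {B} < z" using hat z by simp
  then obtain M m e where M: "M \<ge> N" "bm (mpow (trunc M B) m) e" "e < z ^ m"
    by (rule trunc_power_contraction[OF B])
  let ?B = "trunc M B"
  have BM: "bm ?B b" by (rule bm_trunc[OF B])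
  define V :: "real sq \<Rightarrow> real sq" where "V x = (1 / z) *\<^sub>R matop ?B x" for x
  have V: "bounded_linear V"
    unfolding V_def by (rule bounded_linear_compose[OF bounded_linear_scaleR_right bounded_linear_matop[OF BM]])
  have Vp: "(V ^^ k) x = (1 / z ^ k) *\<^sub>R matop (mpow ?B k) x" for k x
  proof (induction k)
    case 0
    then show ?case using matop_funpow[OF BM, of 0 x] by simp
  next
    case (Suc k)
    then show ?case
      by (simp add: V_def matop_mult[OF BM bm_mpow[OF BM]]
          linear_cmul[OF bounded_linear.linear[OF bounded_linear_matop[OF BM]]])
  qed
  have q: "norm ((V ^^ m) x) \<le> e / z ^ m * norm x" for x
    using norm_matop_le[OF M(2), of x] z by (simp add: Vp divide_simps)
  have q1: "0 \<le> e / z ^ m" "e / z ^ m < 1" using bm_bound_nonneg[OF M(2)] M(3) z by auto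
  obtain G0 where G0: "bounded_linear G0" "\<And>y. G0 y - V (G0 y) = y"
    and G0K: "\<And>K. closed_monoid K \<Longrightarrow> V ` K \<subseteq> K \<Longrightarrow> G0 ` K \<subseteq> K"
    using resolvent[OF V q q1] by metis
  let ?K = "{x :: real sq. \<forall>i. 0 \<le> co x i}"
  have "V ` ?K \<subseteq> ?K" using z matop_nonneg[OF BM] by (auto simp: V_def)
  then have "G0 ` ?K \<subseteq> ?K" by (intro G0K closed_monoid_nonneg)
  then have G0nn: "0 \<le> co (G0 x) i" if "\<And>i. 0 \<le> co x i" for x i using that by blast
  \<comment> \<open>The inverse of z - \<open>?B\<close>, as V is \<open>?B\<close> divided by
    z.\<close>
  define G where "G x = G0 ((1 / z) *\<^sub>R x)" for x
  have G: "bounded_linear G"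
    unfolding G_def by (rule bounded_linear_compose[OF G0(1) bounded_linear_scaleR_right])
  have Gnn: "0 \<le> co (G x) i" if "\<And>i. 0 \<le> co x i" for x i
    unfolding G_def using that z by (intro G0nn) simp
  have Geq: "z * co (G x) i = co x i + co (matop ?B (G x)) i" for x i
  proof -
    have "co (G x) i - co (V (G x)) i = co ((1 / z) *\<^sub>R x) i"
      unfolding G_def co_diff[symmetric] G0(2) ..
    then show ?thesis using z by (simp add: V_def field_simps)
  qed
  have Bz: "co (matop ?B x) i = 0" if "i < M" for x :: "real sq" and i
    unfolding co_matop[OF BM] using that by (simp add: trunc_def)
  have GM: "co (G x) i = 0" if "i < M" "co x i = 0" for x i
    using Geq[of x i] Bz[OF that(1)] that(2) z by simp
  \<comment> \<open>If x vanishes below M, so does G x, and B (G x) differs from \<open>?B\<close>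
    (G x) only in the first M rows. For x supported far enough out these contribute at most norm x,
    hence (B - z) G x has norm at most 2 norm x.\<close>
  obtain n0 where n0: "\<And>x. (\<forall>i<n0. co x i = 0) \<Longrightarrow> norm (sec M (matop B (G x))) \<le> norm x"
    using functionals_tail_small[OF bounded_linear_compose[OF bounded_linear_matop[OF B] G]] by blast
  define L where "L = max M n0"
  have Gbd: "norm (G x) \<le> 4 / c * norm x" if x: "\<forall>i<L. co x i = 0" for x
  proof -
    let ?s = "G x"
    have s0: "co ?s i = 0" if "i < M" for i using that x by (intro GM) (auto simp: L_def)
    have eq: "matop B ?s - z *\<^sub>R ?s = sec M (matop B ?s) - x"
    proof (rule sq_eqI)
      fix i
      show "co (matop B ?s - z *\<^sub>R ?s) i = co (sec M (matop B ?s) - x) i"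
      proof (cases "i < M")
        case True
        then show ?thesis using s0[OF True] x by (simp add: L_def)
      next
        case False
        have "co (matop B ?s) i = co (matop ?B ?s) i"
          unfolding co_matop[OF B] co_matop[OF BM]
          by (rule suminf_cong) (use False s0 in \<open>auto simp: trunc_def\<close>)
        then show ?thesis using False Geq[of x i] by simp
      qed
    qed
    have "norm (sec M (matop B ?s)) \<le> norm x" using x by (intro n0) (auto simp: L_def)
    then have 1: "norm (matop B ?s - z *\<^sub>R ?s) \<le> 2 * norm x"
      unfolding eq using norm_triangle_ineq4[of "sec M (matop B ?s)" x] by linarith
    have "c * norm ?s \<le> norm (matop B ?s - t *\<^sub>R ?s)" using s0 M(1) by (intro low) auto
    also have "matop B ?s - t *\<^sub>R ?s = (matop B ?s - z *\<^sub>R ?s) + (z - t) *\<^sub>R ?s"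
      by (simp add: algebra_simps)
    also have "norm \<dots> \<le> 2 * norm x + (z - t) * norm ?s"
      using norm_triangle_ineq[of "matop B ?s - z *\<^sub>R ?s" "(z - t) *\<^sub>R ?s"] 1 z by simp
    \<comment> \<open>Since z - t \<le> c / 16, the last term is absorbed on the left, with room to
      spare in the constant 4 / c.\<close>
    also have "\<dots> \<le> 2 * norm x + c / 16 * norm ?s" using z by (intro add_left_mono mult_right_mono) auto
    finally have "c * norm ?s \<le> 2 * norm x + c * norm ?s / 16" by simp
    moreover have "0 \<le> c * norm ?s" using c by simp
    ultimately have "c * norm ?s \<le> 4 * norm x" by linarith
    then show ?thesis using c by (simp add: field_simps)
  qed
  define Q where "Q x = x - sec L x" for x :: "real sq"
  have Q: "bounded_linear Q" unfolding Q_def by (rule bounded_linear_sub[OF bounded_linear_ident bounded_linear_sec])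
  have coQ: "co (Q x) i = (if i < L then 0 else co x i)" for x i by (simp add: Q_def)
  have Qn: "norm (Q x) \<le> norm x" for x unfolding Q_def by (rule norm_tail_le)
  \<comment> \<open>Compression to the indices \<ge> \<open>L\<close>, where \<open>Gbd\<close>
    applies; it preserves nonnegativity.\<close>
  define H where "H x = Q (G (Q x))" for x
  have H: "bounded_linear H"
    unfolding H_def by (intro bounded_linear_compose[OF Q] bounded_linear_compose[OF G] Q)
  have Hbd: "norm (H x) \<le> 4 / c * norm x" for x
  proof -
    have "norm (H x) \<le> norm (G (Q x))" unfolding H_def by (rule Qn)
    also have "\<dots> \<le> 4 / c * norm (Q x)" by (rule Gbd) (simp add: coQ)
    also have "\<dots> \<le> 4 / c * norm x" using c by (intro mult_left_mono Qn) auto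
    finally show ?thesis .
  qed
  have U: "bounded_linear (\<lambda>x. d *\<^sub>R H x)" by (rule bounded_linear_compose[OF bounded_linear_scaleR_right H])
  have Ubd: "norm (d *\<^sub>R H x) \<le> 1/2 * norm x" for x
  proof -
    have "d * norm (H x) \<le> c / 8 * (4 / c * norm x)" using d c by (intro mult_mono Hbd) auto
    then show ?thesis using d c by simp
  qed
  have half: "(0::real) \<le> 1/2" "(1/2::real) < 1" by auto
  \<comment> \<open>The resolvent identity suggests H (1 - d H)^-1 as resolvent at z - d. As H is a
    compression, v = H (W (Q x)) need not solve the equation at z' exactly, but nonnegativity makes
    it a supersolution.\<close>
  obtain W where W: "bounded_linear W" "\<And>y. W y - d *\<^sub>R H (W y) = y" "\<And>y. norm (W y) \<le> norm y / (1 - 1/2)"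
    and WK: "\<And>K. closed_monoid K \<Longrightarrow> (\<lambda>x. d *\<^sub>R H x) ` K \<subseteq> K \<Longrightarrow> W ` K \<subseteq> K"
    using neumann[OF U Ubd half] by metis
  have Hnn: "0 \<le> co (H x) i" if "\<And>i. 0 \<le> co x i" for x i
    unfolding H_def coQ using that by (auto intro!: Gnn simp: coQ)
  then have "(\<lambda>x. d *\<^sub>R H x) ` ?K \<subseteq> ?K" using d by auto
  then have "W ` ?K \<subseteq> ?K" by (intro WK closed_monoid_nonneg)
  then have Wnn: "0 \<le> co (W x) i" if "\<And>i. 0 \<le> co x i" for x i using that by blast
  let ?L = "trunc L B"
  have BL: "bm ?L b" by (rule bm_trunc[OF B])
  have key: "norm (matop (mpow ?L k) (Q x)) \<le> z' ^ Suc k * (8 / c) * norm x"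
    if x: "\<And>i. 0 \<le> co x i" for x k
  proof -
    define u where "u = W (Q x)"
    define v where "v = H u"
    define s where "s = G (Q u)"
    have Qx: "0 \<le> co (Q x) i" for i using x by (simp add: coQ)
    have u: "0 \<le> co u i" for i unfolding u_def by (rule Wnn[OF Qx])
    have v: "0 \<le> co v i" for i unfolding v_def by (rule Hnn[OF u])
    have s: "0 \<le> co s i" for i unfolding s_def by (rule Gnn) (simp add: coQ u)
    have vs: "co v i = (if i < L then 0 else co s i)" for i by (simp add: v_def H_def coQ s_def)
    have ux: "co u i = co (Q x) i + d * co v i" for i
    proof -
      have "co (u - d *\<^sub>R v) i = co (Q x) i" unfolding u_def v_def W(2) ..
      then show ?thesis by simp
    qed
    \<comment> \<open>At indices \<ge> \<open>L\<close>, \<open>?L\<close> applied to v drops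
      nonnegative terms from \<open>?B\<close> applied to s; substituting z s = Q u +
      \<open>?B\<close> s and Q u = Q x + d v turns z into z' = z - d.\<close>
    have super: "co (Q x) i + co (matop ?L v) i \<le> z' * co v i" for i
    proof (cases "i < L")
      case True
      have "co (matop ?L v) i = 0" unfolding co_matop[OF BL] using True by (simp add: trunc_def)
      then show ?thesis using True by (simp add: vs coQ)
    next
      case False
      have "co (matop ?L v) i \<le> norm (co (matop ?L v) i)" by simp
      also have "\<dots> \<le> co (matop ?B s) i"
        by (rule matop_dominated[OF BL BM]) (auto simp: trunc_def L_def vs s bm_nonneg[OF B])
      finally have "co (matop ?L v) i \<le> co (matop ?B s) i" .
      moreover have "z * co s i = co (Q u) i + co (matop ?B s) i" unfolding s_def by (rule Geq)
      moreover have "co (Q u) i = co (Q x) i + d * co v i" using False ux[of i] by (simp add: coQ)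
      ultimately show ?thesis using False by (simp add: vs z'_def algebra_simps)
    qed
    have "norm (matop (mpow ?L k) (Q x)) \<le> norm (z' ^ Suc k *\<^sub>R v)"
    proof (rule norm_sq_mono)
      fix i
      show "norm (co (matop (mpow ?L k) (Q x)) i) \<le> norm (co (z' ^ Suc k *\<^sub>R v) i)"
        using mpow_le_supersolution[OF BL Qx v _ super, of k i] matop_nonneg[OF bm_mpow[OF BL] Qx, of k i] z
        by (simp del: power_Suc)
    qed
    also have "\<dots> = z' ^ Suc k * norm v" using z by simp
    also have "\<dots> \<le> z' ^ Suc k * (4 / c * (2 * norm x))"
    proof (intro mult_left_mono)
      have "norm v \<le> 4 / c * norm u" unfolding v_def by (rule Hbd)
      also have "\<dots> \<le> 4 / c * (2 * norm x)"
        using W(3)[of "Q x"] Qn[of x] c by (intro mult_left_mono) (simp_all add: u_def)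
      finally show "norm v \<le> 4 / c * (2 * norm x)" .
    qed (use z in simp)
    finally show ?thesis by (simp add: mult_ac)
  qed
  \<comment> \<open>The value of \<open>ess\<close> at a power of B is at most that at the same
    power of \<open>?L\<close>, so the orbit bound at z' limits the growth.\<close>
  have bound: "ess_rad_hat {B} ^ k \<le> 8 * z' / c * z' ^ k" if k: "k \<ge> 1" for k
  proof -
    let ?P = "mpow ?L k"
    have P: "bm ?P (b ^ k)" by (rule bm_mpow[OF BL])
    have "bm (trunc L ?P) (8 * z' / c * z' ^ k)"
    proof (rule bm_of_matop[OF bm_trunc[OF P]])
      fix x :: "real sq" assume x: "\<And>i. 0 \<le> co x i"
      have "norm (matop (trunc L ?P) x) \<le> norm (matop ?P (Q x))"
      proof (rule norm_sq_mono)
        fix i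
        have "co (matop (trunc L ?P) x) i = co (matop (trunc L ?P) (Q x)) i"
          unfolding co_matop[OF bm_trunc[OF P]] by (rule suminf_cong) (simp add: trunc_def coQ)
        moreover have "norm (co (matop (trunc L ?P) (Q x)) i) \<le> co (matop ?P (Q x)) i"
          by (rule matop_dominated[OF bm_trunc[OF P] P]) (use bm_nonneg[OF P] in \<open>simp_all add: trunc_def[of L ?P] coQ x\<close>)
        ultimately show "norm (co (matop (trunc L ?P) x) i) \<le> norm (co (matop ?P (Q x)) i)" by simp
      qed
      also have "\<dots> \<le> z' ^ Suc k * (8 / c) * norm x" by (rule key[OF x])
      finally show "norm (matop (trunc L ?P) x) \<le> 8 * z' / c * z' ^ k * norm x" by (simp add: mult_ac)
    qed
    then have "ess ?P \<le> 8 * z' / c * z' ^ k" by (rule ess_le)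
    moreover have "ess_rad_hat {B} ^ k \<le> ess (mpow B k)"
      using hat_pow_le[OF bset_singleton[OF B] k] by (simp add: gsup_singleton[OF B])
    ultimately show ?thesis using ess_mpow_trunc[OF B, of k L] by linarith
  qed
  show ?thesis
  proof (rule ccontr)
    assume "\<not> ?thesis"
    then have eq: "ess_rad_hat {B} = t" using hat by simp
    obtain k where k: "8 * z' / c < (t / z') ^ k" using real_arch_pow[of "t / z'" "8 * z' / c"] z by auto
    have "(t / z') ^ Suc k \<le> 8 * z' / c"
      using bound[of "Suc k"] z by (simp add: eq power_divide divide_le_eq del: power_Suc)
    moreover have "(t / z') ^ k \<le> (t / z') ^ Suc k"
      using z by (intro power_increasing) auto
    ultimately show False using k by simp
  qed
qed

lemma fredholm_fails_at_radius:
  assumes A: "bm A a" and pos: "0 < ess_rad_hat {A}"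
  shows "\<not> fredholm_l2 (\<lambda>x i. mat_apply A x i - complex_of_real (ess_rad_hat {A}) * x i)"
proof
  let ?t = "ess_rad_hat {A}"
  assume "fredholm_l2 (\<lambda>x i. mat_apply A x i - complex_of_real ?t * x i)"
  from fredholm_tail_lower_bound[OF A this] obtain c N where c: "c > 0"
    and low: "\<And>w :: real sq. (\<forall>i<N. co w i = 0) \<Longrightarrow> c * norm w \<le> norm (matop (mat_transpose A) w - ?t *\<^sub>R w)"
    by blast
  have "ess_rad_hat {mat_transpose A} < ?t"
    by (rule tail_bounded_below_imp_less[OF bm_transpose[OF A] pos _ c low]) (simp add: hat_transpose[OF A])
  then show False by (simp add: hat_transpose[OF A])
qed

text \<open>The supremum is attained: either the number itself is in the essential spectrum, or it
  is 0 and is supplied by the inserted 0.\<close>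

theorem ess_rad_eq_hat:
  assumes A: "bm A a" shows "ess_rad A = ess_rad_hat {A}"
  unfolding ess_rad_def
proof (rule cSup_eq_maximum)
  let ?t = "ess_rad_hat {A}"
  have t0: "0 \<le> ?t" by (rule hat_nonneg[OF bset_singleton[OF A]])
  show "?t \<in> insert 0 (cmod ` ess_spectrum A)"
  proof (cases "?t = 0")
    case False
    then have "complex_of_real ?t \<in> ess_spectrum A"
      using fredholm_fails_at_radius[OF A] t0 by (simp add: ess_spectrum_def)
    then have "cmod (complex_of_real ?t) \<in> cmod ` ess_spectrum A" by (rule imageI)
    then show ?thesis using t0 by simp
  qed simp
  fix x assume x: "x \<in> insert 0 (cmod ` ess_spectrum A)"
  show "x \<le> ?t"
  proof (cases "x = 0")
    case False
    then obtain z where "x = cmod z" "z \<in> ess_spectrum A" using x by auto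
    then show ?thesis using fredholm_outside[OF A, of z] by (auto simp: ess_spectrum_def not_less[symmetric])
  qed (simp add: t0)
qed

subsection \<open>The joint essential spectral radius\<close>

lemma power_powr:
  fixes x :: real
  assumes "0 \<le> x" "p \<ge> 1"
  shows "(x ^ p) powr u = x powr (real p * u)"
proof (cases "x = 0")
  case False
  then have "x ^ p = x powr real p" using assms(1) by (simp add: powr_realpow)
  then show ?thesis by (simp add: powr_powr)
qed (use assms in \<open>simp add: power_0_left\<close>)

lemma powr_power_eq:
  fixes x :: real
  assumes "m \<ge> 1" shows "(x powr u) ^ m = x powr (u * real m)"
proof (cases "x = 0")
  case False
  then show ?thesis by (simp add: powr_realpow[symmetric] powr_powr)
qed (use assms in \<open>simp add: power_0_left\<close>)

lemma ess_rad_nonneg: "bm A a \<Longrightarrow> 0 \<le> ess_rad A"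
  by (simp add: ess_rad_eq_hat hat_nonneg[OF bset_singleton])

lemma ess_rad_le_bound:
  assumes A: "bm A a" shows "ess_rad A \<le> a"
proof -
  have "ess_rad A ^ 1 \<le> gsup {A} 1"
    unfolding ess_rad_eq_hat[OF A] by (rule hat_pow_le[OF bset_singleton[OF A]]) simp
  also have "\<dots> \<le> a ^ 1" unfolding gsup_singleton[OF A] by (rule ess_le_bound[OF bm_mpow[OF A]])
  finally show ?thesis by simp
qed

lemma ess_rad_mono:
  assumes A: "bm A a" and B: "bm B b" and le: "\<And>i j. A i j \<le> B i j"
  shows "ess_rad A \<le> ess_rad B"
  unfolding ess_rad_eq_hat[OF A] ess_rad_eq_hat[OF B]
  by (rule hat_mono[OF bset_singleton[OF A] bset_singleton[OF B]]) (simp add: dominated_def le)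

lemma ess_rad_square:
  assumes A: "bm A a" shows "ess_rad (mat_mult A A) = ess_rad A ^ 2"
proof -
  have "set_pow {A} 2 = {mat_mult A A}"
    by (simp add: set_pow_singleton numeral_2_eq_2 mat_mult_id_right)
  then show ?thesis
    using hat_set_pow[OF bset_singleton[OF A], of 2]
    by (simp add: ess_rad_eq_hat[OF A] ess_rad_eq_hat[OF bm_mult[OF A A]])
qed

definition lsup :: "mat set \<Rightarrow> nat \<Rightarrow> real" where
  "lsup \<Sigma> m = Sup (insert 0 (ess_rad ` set_pow \<Sigma> m))"

lemma lsup_bdd:
  assumes "bset \<Sigma> M" shows "bdd_above (insert 0 (ess_rad ` set_pow \<Sigma> m))"
proof (rule bdd_aboveI[of _ "M ^ m"])
  fix x assume "x \<in> insert 0 (ess_rad ` set_pow \<Sigma> m)"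
  then show "x \<le> M ^ m" using bset_pos[OF assms] set_pow_bm[OF assms] ess_rad_le_bound by auto
qed

lemma lsup_nonneg: "bset \<Sigma> M \<Longrightarrow> 0 \<le> lsup \<Sigma> m"
  unfolding lsup_def by (rule cSup_upper[OF _ lsup_bdd]) auto

lemma lsup_powr_le:
  assumes S: "bset \<Sigma> M" and m: "m \<ge> 1" and c: "0 \<le> c"
    and le: "\<And>A. A \<in> set_pow \<Sigma> m \<Longrightarrow> ess_rad A \<le> c ^ m"
  shows "lsup \<Sigma> m powr (1 / real m) \<le> c"
proof -
  have "lsup \<Sigma> m \<le> c ^ m" unfolding lsup_def by (rule cSup_least) (use le c in auto)
  then have "lsup \<Sigma> m powr (1 / real m) \<le> (c ^ m) powr (1 / real m)"
    by (intro powr_mono2 lsup_nonneg[OF S]) auto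
  also have "\<dots> = c"
    using c m by (cases "c = 0") (auto simp: powr_realpow[symmetric] powr_powr)
  finally show ?thesis .
qed

lemma ess_rad_set_eq: "ess_rad_set \<Sigma> = Sup (insert 0 {lsup \<Sigma> m powr (1 / real m) | m. m \<ge> 1})"
  by (simp add: ess_rad_set_def lsup_def)

text \<open>Together with \<open>ess_rad_le_set\<close> this describes the joint radius as the least
  c \<ge> 0 with \<open>ess_rad A \<le> c ^ m\<close> for all m-fold products, so that suprema and
  roots need not be touched again.\<close>

lemma ess_rad_set_leI:
  assumes S: "bset \<Sigma> M" and c: "0 \<le> c"
    and le: "\<And>m A. m \<ge> 1 \<Longrightarrow> A \<in> set_pow \<Sigma> m \<Longrightarrow> ess_rad A \<le> c ^ m"
  shows "ess_rad_set \<Sigma> \<le> c"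
proof -
  have "lsup \<Sigma> m powr (1 / real m) \<le> c" if "m \<ge> 1" for m
    by (rule lsup_powr_le[OF S that c le[OF that]])
  then show ?thesis unfolding ess_rad_set_eq by (intro cSup_least) (auto simp: c)
qed

lemma ess_rad_set_bdd:
  assumes S: "bset \<Sigma> M"
  shows "bdd_above (insert 0 {lsup \<Sigma> m powr (1 / real m) | m. m \<ge> 1})"
  using bset_pos[OF S] lsup_powr_le[OF S, of _ M] ess_rad_le_bound[OF set_pow_bm[OF S]]
  by (intro bdd_aboveI[of _ M]) auto

lemma ess_rad_set_nonneg: "bset \<Sigma> M \<Longrightarrow> 0 \<le> ess_rad_set \<Sigma>"
  unfolding ess_rad_set_eq by (rule cSup_upper[OF _ ess_rad_set_bdd]) auto

lemma ess_rad_le_set: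
  assumes S: "bset \<Sigma> M" and m: "m \<ge> 1" and A: "A \<in> set_pow \<Sigma> m"
  shows "ess_rad A \<le> ess_rad_set \<Sigma> ^ m"
proof -
  have "ess_rad A \<le> lsup \<Sigma> m"
    unfolding lsup_def using A by (intro cSup_upper[OF _ lsup_bdd[OF S]]) auto
  also have "\<dots> = (lsup \<Sigma> m powr (1 / real m)) ^ m"
    using powr_inverse_mult_power[OF lsup_nonneg[OF S] m, of m 1] lsup_nonneg[OF S, of m] by simp
  also have "lsup \<Sigma> m powr (1 / real m) \<le> ess_rad_set \<Sigma>"
    unfolding ess_rad_set_eq using m by (intro cSup_upper[OF _ ess_rad_set_bdd[OF S]]) auto
  then have "(lsup \<Sigma> m powr (1 / real m)) ^ m \<le> ess_rad_set \<Sigma> ^ m" by (intro power_mono) auto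
  finally show ?thesis .
qed

section \<open>The chain of inequalities for both radii\<close>

context exponents
begin

lemma bset_S_ab: "bset \<Phi> M \<Longrightarrow> bset (S_ab \<alpha> \<beta> \<Phi>) (pw M \<alpha> * pw M \<beta>)"
  unfolding S_ab_eq_S2 by (rule bset_S2)

lemma S_ab_square_dominated:
  assumes "bset \<Phi> M"
  shows "dominated (set_pow (S_ab \<alpha> \<beta> \<Phi>) 2) (S_ab \<alpha> \<beta> (set_pow \<Phi> 2))"
  unfolding S_ab_eq_S2 by (rule S2_set_pow_dominated[OF assms assms]) simp

text \<open>The bound for sets, applied to the singletons \<open>{A}\<close> and \<open>{B}\<close>;
  here the two families have to be allowed to differ.\<close>

lemma ess_rad_had_le:
  assumes A: "bm A a" and B: "bm B b"
  shows "ess_rad (had A B) \<le> pw (ess_rad A) \<alpha> * pw (ess_rad B) \<beta>"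
proof -
  have "S2 {A} {B} = {had A B}" by (auto simp: S2_def)
  then show ?thesis
    using hat_S2_le[OF bset_singleton[OF A] bset_singleton[OF B]]
    by (simp add: ess_rad_eq_hat[OF A] ess_rad_eq_hat[OF B] ess_rad_eq_hat[OF bm_had_ex[OF A B]])
qed

text \<open>Each step is \<open>square\<close> for the set \<Psi>^(2^k), under a root of order
  2^(k+1); the end of the chain is \<open>upper\<close> for \<Psi>^(2^n) followed by
  \<open>power\<close>. Both radii have these four properties.\<close>

lemma chain_of_radius:
  fixes r :: "mat set \<Rightarrow> real"
  assumes nonneg: "\<And>\<Phi> M. bset \<Phi> M \<Longrightarrow> 0 \<le> r \<Phi>"
    and square: "\<And>\<Phi> M. bset \<Phi> M \<Longrightarrow> r (S_ab \<alpha> \<beta> \<Phi>) ^ 2 \<le> r (S_ab \<alpha> \<beta> (set_pow \<Phi> 2))"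
    and upper: "\<And>\<Phi> M. bset \<Phi> M \<Longrightarrow> r (S_ab \<alpha> \<beta> \<Phi>) \<le> r \<Phi> powr (\<alpha> + \<beta>)"
    and power: "\<And>\<Phi> M p. bset \<Phi> M \<Longrightarrow> p \<ge> 1 \<Longrightarrow> r (set_pow \<Phi> p) \<le> r \<Phi> ^ p"
    and \<Psi>: "bset \<Psi> M"
  shows "let rr = (\<lambda>k::nat. r (S_ab \<alpha> \<beta> (set_pow \<Psi> (2 ^ k))) powr (1 / 2 ^ k)) in
           r (S_ab \<alpha> \<beta> \<Psi>) = rr 0 \<and> (\<forall>k<n. rr k \<le> rr (Suc k)) \<and> rr n \<le> r \<Psi> powr (\<alpha> + \<beta>)"
proof -
  let ?R = "\<lambda>k. r (S_ab \<alpha> \<beta> (set_pow \<Psi> (2 ^ k)))"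
  have bs: "bset (set_pow \<Psi> p) (M ^ p)" for p by (rule bset_set_pow[OF \<Psi>])
  have R0: "0 \<le> ?R k" for k by (rule nonneg[OF bset_S_ab[OF bs]])
  have r0: "0 \<le> r \<Psi>" by (rule nonneg[OF \<Psi>])
  have zero: "r (S_ab \<alpha> \<beta> \<Psi>) = ?R 0 powr (1 / 2 ^ 0)"
    using R0[of 0] set_pow_1[of \<Psi>] by (simp del: set_pow.simps set_pow_1)
  have step: "?R k powr (1 / 2 ^ k) \<le> ?R (Suc k) powr (1 / 2 ^ Suc k)" for k
  proof -
    have "set_pow (set_pow \<Psi> (2 ^ k)) 2 = set_pow \<Psi> (2 ^ Suc k)"
      by (simp add: set_pow_mult[OF \<Psi>] mult.commute)
    then have sq: "?R k ^ 2 \<le> ?R (Suc k)" using square[OF bs[of "2 ^ k"]] by simp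
    have "?R k powr (1 / 2 ^ k) = (?R k ^ 2) powr (1 / 2 ^ Suc k)"
      using power_powr[OF R0[of k], of 2] by simp
    also have "\<dots> \<le> ?R (Suc k) powr (1 / 2 ^ Suc k)" by (intro powr_mono2 sq) auto
    finally show ?thesis .
  qed
  have "?R n powr (1 / 2 ^ n) \<le> ((r \<Psi> ^ (2 ^ n)) powr (\<alpha> + \<beta>)) powr (1 / 2 ^ n)"
  proof (rule powr_mono2[OF _ R0])
    have "?R n \<le> r (set_pow \<Psi> (2 ^ n)) powr (\<alpha> + \<beta>)" by (rule upper[OF bs])
    also have "\<dots> \<le> (r \<Psi> ^ (2 ^ n)) powr (\<alpha> + \<beta>)"
      using sum_ge_1 by (intro powr_mono2 power[OF \<Psi>] nonneg[OF bs]) auto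
    finally show "?R n \<le> (r \<Psi> ^ (2 ^ n)) powr (\<alpha> + \<beta>)" .
  qed simp
  also have "\<dots> = r \<Psi> powr (\<alpha> + \<beta>)"
    using power_powr[OF r0, of "2 ^ n"] by (simp add: powr_powr)
  finally show ?thesis unfolding Let_def using zero step by blast
qed

lemma chain_hat:
  assumes "bset \<Psi> M"
  shows "let rr = (\<lambda>k::nat. ess_rad_hat (S_ab \<alpha> \<beta> (set_pow \<Psi> (2 ^ k))) powr (1 / 2 ^ k)) in
    ess_rad_hat (S_ab \<alpha> \<beta> \<Psi>) = rr 0 \<and> (\<forall>k<n. rr k \<le> rr (Suc k)) \<and> rr n \<le> ess_rad_hat \<Psi> powr (\<alpha> + \<beta>)"
proof (rule chain_of_radius[OF _ _ _ _ assms])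
  fix \<Phi> M assume P: "bset \<Phi> M"
  show "0 \<le> ess_rad_hat \<Phi>" by (rule hat_nonneg[OF P])
  have "ess_rad_hat (S_ab \<alpha> \<beta> \<Phi>) ^ 2 = ess_rad_hat (set_pow (S_ab \<alpha> \<beta> \<Phi>) 2)"
    by (rule hat_set_pow[OF bset_S_ab[OF P], symmetric]) simp
  also have "\<dots> \<le> ess_rad_hat (S_ab \<alpha> \<beta> (set_pow \<Phi> 2))"
    by (rule hat_mono[OF bset_set_pow[OF bset_S_ab[OF P]] bset_S_ab[OF bset_set_pow[OF P]] S_ab_square_dominated[OF P]])
  finally show "ess_rad_hat (S_ab \<alpha> \<beta> \<Phi>) ^ 2 \<le> ess_rad_hat (S_ab \<alpha> \<beta> (set_pow \<Phi> 2))" .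
  show "ess_rad_hat (S_ab \<alpha> \<beta> \<Phi>) \<le> ess_rad_hat \<Phi> powr (\<alpha> + \<beta>)"
    using hat_S2_le[OF P P] sum_ge_1 by (simp add: S_ab_eq_S2 pw_add hat_nonneg[OF P])
  show "ess_rad_hat (set_pow \<Phi> p) \<le> ess_rad_hat \<Phi> ^ p" if "p \<ge> 1" for p
    using hat_set_pow[OF P that] by simp
qed

lemma chain_set:
  assumes "bset \<Psi> M"
  shows "let rr = (\<lambda>k::nat. ess_rad_set (S_ab \<alpha> \<beta> (set_pow \<Psi> (2 ^ k))) powr (1 / 2 ^ k)) in
    ess_rad_set (S_ab \<alpha> \<beta> \<Psi>) = rr 0 \<and> (\<forall>k<n. rr k \<le> rr (Suc k)) \<and> rr n \<le> ess_rad_set \<Psi> powr (\<alpha> + \<beta>)"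
proof (rule chain_of_radius[OF _ _ _ _ assms])
  fix \<Phi> M assume P: "bset \<Phi> M"
  let ?S = "S_ab \<alpha> \<beta> \<Phi>" and ?S' = "S_ab \<alpha> \<beta> (set_pow \<Phi> 2)"
  note S = bset_S_ab[OF P] and S' = bset_S_ab[OF bset_set_pow[OF P, of 2]]
  show r0: "0 \<le> ess_rad_set \<Phi>" by (rule ess_rad_set_nonneg[OF P])
  have R0: "0 \<le> ess_rad_set ?S'" by (rule ess_rad_set_nonneg[OF S'])
  \<comment> \<open>The joint radius is a supremum over single matrices C, so each is squared by
    itself: C C lies in the m-th power of the squared set, is dominated by some D built from
    \<Phi>^2, and its radius is the square of that of C.\<close>
  have "ess_rad_set ?S \<le> sqrt (ess_rad_set ?S')"
  proof (rule ess_rad_set_leI[OF S])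
    fix m C assume m: "m \<ge> 1" and C: "C \<in> set_pow ?S m"
    note bC = set_pow_bm[OF S C]
    have "mat_mult C C \<in> set_pow ?S (m + m)" unfolding set_pow_add[OF S] using C by blast
    then have "mat_mult C C \<in> set_pow (set_pow ?S 2) m" by (simp add: set_pow_mult[OF S] mult_2)
    then obtain D where D: "D \<in> set_pow ?S' m" "\<And>i j. mat_mult C C i j \<le> D i j"
      using dominated_set_pow[OF bset_set_pow[OF S] S' S_ab_square_dominated[OF P]]
      unfolding dominated_def by blast
    have "ess_rad C ^ 2 = ess_rad (mat_mult C C)" by (rule ess_rad_square[OF bC, symmetric])
    also have "\<dots> \<le> ess_rad D" by (rule ess_rad_mono[OF bm_mult[OF bC bC] set_pow_bm[OF S' D(1)] D(2)])
    also have "\<dots> \<le> ess_rad_set ?S' ^ m" by (rule ess_rad_le_set[OF S' m D(1)])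
    also have "\<dots> = (sqrt (ess_rad_set ?S') ^ m) ^ 2"
      using R0 by (metis power_mult mult.commute real_sqrt_pow2)
    finally show "ess_rad C \<le> sqrt (ess_rad_set ?S') ^ m"
      by (rule power2_le_imp_le) (use R0 in simp)
  qed (use R0 in simp)
  then have "ess_rad_set ?S ^ 2 \<le> sqrt (ess_rad_set ?S') ^ 2"
    by (intro power_mono ess_rad_set_nonneg[OF S])
  then show "ess_rad_set ?S ^ 2 \<le> ess_rad_set ?S'" using R0 by simp
  show "ess_rad_set ?S \<le> ess_rad_set \<Phi> powr (\<alpha> + \<beta>)"
  proof (rule ess_rad_set_leI[OF S])
    fix m C assume m: "m \<ge> 1" and C: "C \<in> set_pow ?S m"
    then obtain A B where A: "A \<in> set_pow \<Phi> m" and B: "B \<in> set_pow \<Phi> m"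
      and le: "\<And>i j. C i j \<le> had A B i j"
      using S2_set_pow_dominated[OF P P m] unfolding S_ab_eq_S2 dominated_def S2_def by blast
    note bA = set_pow_bm[OF P A] and bB = set_pow_bm[OF P B]
    have "ess_rad C \<le> ess_rad (had A B)" by (rule ess_rad_mono[OF set_pow_bm[OF S C] bm_had_ex[OF bA bB] le])
    also have "\<dots> \<le> pw (ess_rad A) \<alpha> * pw (ess_rad B) \<beta>" by (rule ess_rad_had_le[OF bA bB])
    also have "\<dots> \<le> pw (ess_rad_set \<Phi> ^ m) \<alpha> * pw (ess_rad_set \<Phi> ^ m) \<beta>"
      by (intro mult_mono pw_mono ess_rad_le_set[OF P m A] ess_rad_le_set[OF P m B]
          ess_rad_nonneg[OF bA] ess_rad_nonneg[OF bB] \<alpha>_nonneg \<beta>_nonneg) auto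
    also have "\<dots> = (ess_rad_set \<Phi> ^ m) powr (\<alpha> + \<beta>)" using sum_ge_1 r0 by (simp add: pw_add)
    also have "\<dots> = (ess_rad_set \<Phi> powr (\<alpha> + \<beta>)) ^ m"
      using power_powr[OF r0 m] by (simp add: powr_power_eq[OF m] mult.commute)
    finally show "ess_rad C \<le> (ess_rad_set \<Phi> powr (\<alpha> + \<beta>)) ^ m" .
  qed simp
  show "ess_rad_set (set_pow \<Phi> p) \<le> ess_rad_set \<Phi> ^ p" if p: "p \<ge> 1" for p
  proof (rule ess_rad_set_leI[OF bset_set_pow[OF P]])
    fix m C assume m: "m \<ge> 1" and C: "C \<in> set_pow (set_pow \<Phi> p) m"
    then have "C \<in> set_pow \<Phi> (p * m)" by (simp add: set_pow_mult[OF P])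
    then show "ess_rad C \<le> (ess_rad_set \<Phi> ^ p) ^ m"
      using ess_rad_le_set[OF P, of "p * m" C] m p by (simp add: power_mult)
  qed (use r0 in simp)
qed

end

theorem theorem4p3:
  fixes \<Psi> :: "mat set" and r :: "mat set \<Rightarrow> real" and \<alpha> \<beta> :: real and n :: nat
  assumes "\<forall>A\<in>\<Psi>. nonneg_mat A \<and> defines_op A"
    and "bounded_mat_set \<Psi>"
    and "r = ess_rad_set \<or> r = ess_rad_hat"
    and "0 \<le> \<alpha>" and "0 \<le> \<beta>" and "1 \<le> \<alpha> + \<beta>"
  shows "let rr = (\<lambda>k::nat. r (S_ab \<alpha> \<beta> (set_pow \<Psi> (2 ^ k))) powr (1 / 2 ^ k)) in
           r (S_ab \<alpha> \<beta> \<Psi>) = rr 0 \<and> (\<forall>k<n. rr k \<le> rr (Suc k)) \<and> rr n \<le> r \<Psi> powr (\<alpha> + \<beta>)"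
proof -
  interpret exponents \<alpha> \<beta> by standard (use assms in auto)
  obtain M where M: "\<And>A x. A \<in> \<Psi> \<Longrightarrow> x \<in> l2 \<Longrightarrow> l2norm (mat_apply A x) \<le> M * l2norm x"
    using assms(2) unfolding bounded_mat_set_def by blast
  \<comment> \<open>The maximum makes the common bound strictly positive.\<close>
  have "bm A (max M 1)" if "A \<in> \<Psi>" for A
    using bm_weaken[OF bm_of_operator[of A M]] assms(1) M that by simp
  then have "bset \<Psi> (max M 1)" by (simp add: bset_def)
  then show ?thesis using chain_hat chain_set assms(3) by blast
qed

end
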